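(* Let $\Omega\subseteq\mathbb{R}^d$ be a convex set with non-empty interior, and let $\mu_0,\mu_1$ be probability measures supported on $\Omega$. Let $X_0\sim\mu_0$ and $X_1\sim\mu_1$ be independent, set $X_t=(1-t)X_0+tX_1$ for $t\in[0,1]$, and let $v(t,z)=\mathbb{E}[X_1-X_0\mid X_t=z]$. Suppose that there is a set $A\subseteq\Omega$ with $\mu_0(A)=1$ such that, for each $x\in A$, the integral equation $$\mathfrak{R}(t,x)=x+\int_0^t v(s,\mathfrak{R}(s,x))\,ds\quad\text{for all } t\in[0,1]$$ has a unique solution $t\mapsto\mathfrak{R}(t,x)$. Then, for all $t\in[0,1]$, the law of $\mathfrak{R}(t,X_0)$ is the same as the law of $X_t=(1-t)X_0+tX_1$.
   Context: $v(t,z)$ is the (rectified flow) velocity field, defined as a version of the conditional expectation of $X_1-X_0$ given $X_t=z$. *)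

theory Defs
  imports "HOL-Probability.Probability"
begin

definition interp :: "real \<Rightarrow> ('a::real_vector \<times> 'a) \<Rightarrow> 'a" where
  "interp t p = (1 - t) *\<^sub>R fst p + t *\<^sub>R snd p"

text \<open>v is a (jointly Borel measurable) version of the conditional expectation
  E[X1 - X0 | X_t = z], where (X0,X1) has law mu0 (x) mu1 (independence).
  Conditional expectation requires X1 - X0 integrable; the version property is the
  defining identity E[1_B(X_t) (X1 - X0)] = E[1_B(X_t) v(t,X_t)] for all Borel B.\<close>
definition is_velocity_field ::
  "'a::euclidean_space measure \<Rightarrow> 'a measure \<Rightarrow> (real \<Rightarrow> 'a \<Rightarrow> 'a) \<Rightarrow> bool" where
  "is_velocity_field \<mu>0 \<mu>1 v \<longleftrightarrow>
     (\<lambda>(t, z). v t z) \<in> borel_measurable borel \<and>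
     integrable (\<mu>0 \<Otimes>\<^sub>M \<mu>1) (\<lambda>p. snd p - fst p) \<and>
     (\<forall>t\<in>{0..1}.
        integrable (\<mu>0 \<Otimes>\<^sub>M \<mu>1) (\<lambda>p. v t (interp t p)) \<and>
        (\<forall>B\<in>sets borel.
           (\<integral>p. indicator B (interp t p) *\<^sub>R (snd p - fst p) \<partial>(\<mu>0 \<Otimes>\<^sub>M \<mu>1)) =
           (\<integral>p. indicator B (interp t p) *\<^sub>R v t (interp t p) \<partial>(\<mu>0 \<Otimes>\<^sub>M \<mu>1))))"

definition is_flow_solution :: "(real \<Rightarrow> 'a \<Rightarrow> 'a::euclidean_space) \<Rightarrow> 'a \<Rightarrow> (real \<Rightarrow> 'a) \<Rightarrow> bool" where
  "is_flow_solution v x R \<longleftrightarrow>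
     (\<forall>t\<in>{0..1}. set_integrable lborel {0..t} (\<lambda>s. v s (R s)) \<and>
                  R t = x + (LINT s:{0..t}|lborel. v s (R s)))"

end

theory Submission
  imports Defs "HOL-Complex_Analysis.Great_Picard"
begin

text \<open>Random paths with one-time marginals exactly those of X_t and which almost solve the flow
  equation are built as follows. Cut the time interval at many grid points. Between two of them the
  path is a straight segment of the coupling; at a grid point a new segment is drawn from the
  coupling conditioned on passing through the same tiny cell, independently of the past. The
  marginals are preserved, and the velocity minus its conditional mean, which is close to v, is a
  martingale difference that averages out. Approximating v in L1 by bounded Lipschitz fields, most
  of these paths are equicontinuous, and by Arzela-Ascoli they accumulate at true solutions started
  in a large compact subset of A, which by uniqueness are the given ones. Hence the end point pairs
  of the paths concentrate near a closed subset of the graph of the flow map. This yields both the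
  measurability of the flow map and the inequality between the two laws on closed sets; for
  probability measures that inequality implies equality.\<close>

section \<open>Gluing along countable labels\<close>

text \<open>The obstacle is that \<open>v\<close> is only Borel: along a limit of paths nothing can
  be said about \<open>v\<close> itself. So every bound that must survive the limit is stated
  through continuous approximants, whose mutual distances pass by Fatou, and through open sets,
  whose indicators are lower semicontinuous; \<open>v\<close> returns only at the end, as the
  pointwise limit of the approximants off these open sets. Such bounds are available because the
  expected time integral of a function of time and position depends only on the one-time marginals:
  errors measured under the law of the interpolation at a uniform time hold verbatim for every
  randomized path, which is why the marginals must be kept exactly. L1 errors \<open>4^-m\<close>
  against weights \<open>2^m\<close> leave summable slack for Markov's inequality. The cell size is
  chosen after the number of grid points, since each grid point costs one jump of cell size.
  Uniqueness from a fixed start removes the randomness in the limit. Measurability can be expected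
  only for the completion of \<open>\<mu>0\<close>, since \<open>\<R>\<close> is unrestricted off
  \<open>A\<close>.\<close>

lemma pred_eq_nat[measurable (raw)]:
  fixes f g :: "'b \<Rightarrow> nat"
  assumes [measurable]: "f \<in> measurable M (count_space UNIV)" "g \<in> measurable M (count_space UNIV)"
  shows "Measurable.pred M (\<lambda>x. f x = g x)"
proof -
  have "Measurable.pred M (\<lambda>x. \<exists>q. g x = q \<and> f x = q)" by measurable
  then show ?thesis by simp
qed

text \<open>A class of mass zero is a null set and there are only countably many classes, so almost
  no point lies in such a class. This licenses division by the mass of the class of a point.\<close>

lemma (in finite_measure) AE_label_mass_pos:
  fixes a :: "'a \<Rightarrow> nat"
  assumes [measurable]: "a \<in> measurable M (count_space UNIV)"
  shows "AE x in M. measure M {y \<in> space M. a y = a x} > 0"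
proof -
  have "AE x in M. measure M {y \<in> space M. a y = q} = 0 \<longrightarrow> a x \<noteq> q" for q
  proof (cases "measure M {y \<in> space M. a y = q} = 0")
    case True
    then have "{y \<in> space M. a y = q} \<in> null_sets M"
      by (auto simp: null_sets_def emeasure_eq_measure)
    then show ?thesis by (auto dest!: AE_not_in)
  qed simp
  then have "AE x in M. \<forall>q. measure M {y \<in> space M. a y = q} = 0 \<longrightarrow> a x \<noteq> q"
    by (simp add: AE_all_countable)
  then show ?thesis
    by eventually_elim (auto simp: zero_less_measure_iff)
qed

text \<open>Two random elements whose nat-valued labels have the same law are coupled so that the labels
  agree and the elements are conditionally independent given the label. Since there are only
  countably many labels, an explicit density does this without disintegration.\<close>

locale label_gluing = M: prob_space M + P: prob_space P
  for M :: "'b measure" and P :: "'p measure" +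
  fixes a' :: "'b \<Rightarrow> nat" and a :: "'p \<Rightarrow> nat"
  assumes a'[measurable]: "a' \<in> measurable M (count_space UNIV)"
    and a[measurable]: "a \<in> measurable P (count_space UNIV)"
    and same_law: "distr M (count_space UNIV) a' = distr P (count_space UNIV) a"
begin

sublocale MP: pair_prob_space M P ..

definition mass :: "nat \<Rightarrow> real" where
  "mass q = measure P {p \<in> space P. a p = q}"

text \<open>The mixture over \<open>q\<close>, with mixing weight \<open>mass q\<close>, of the
  products of the two laws conditioned on label \<open>q\<close> has density
  \<open>mass q / (mass q)^2\<close> against the product measure where both labels equal
  \<open>q\<close>. At a label of mass zero the quotient is 0, which only concerns a null
  set.\<close>

definition weight :: "'b \<Rightarrow> 'p \<Rightarrow> real" where
  "weight w p = (if a' w = a p then 1 / mass (a p) else 0)"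

definition glued :: "('b \<times> 'p) measure" where
  "glued = density (M \<Otimes>\<^sub>M P) (\<lambda>(w, p). weight w p)"

lemma mass_measurable[measurable]: "mass \<in> measurable (count_space UNIV) borel"
  by (rule measurableI) auto

lemma weight_measurable[measurable]:
  "(\<lambda>(w, p). weight w p) \<in> borel_measurable (M \<Otimes>\<^sub>M P)"
proof -
  have 1: "(\<lambda>x. 1 / mass (a (snd x))) \<in> borel_measurable (M \<Otimes>\<^sub>M P)"
    by (intro borel_measurable_divide borel_measurable_const measurable_compose[OF _ mass_measurable]
        measurable_compose[OF measurable_snd a])
  have 2: "Measurable.pred (M \<Otimes>\<^sub>M P) (\<lambda>x. a' (fst x) = a (snd x))"
    by (rule pred_eq_nat) measurable
  show ?thesis
    unfolding weight_def case_prod_beta using 1 2 by measurable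
qed

lemma weight_nonneg: "0 \<le> weight w p"
  by (simp add: weight_def mass_def)

text \<open>Equality of the label laws enters here; it makes the same \<open>weight\<close>
  integrate to 1 in either variable.\<close>

lemma mass_M: "measure M {w \<in> space M. a' w = q} = mass q"
proof -
  have "measure M {w \<in> space M. a' w = q} = measure (distr M (count_space UNIV) a') {q}"
    by (subst measure_distr) (auto intro!: arg_cong[where f="measure M"])
  also have "\<dots> = mass q"
    unfolding same_law mass_def
    by (subst measure_distr) (auto intro!: arg_cong[where f="measure P"])
  finally show ?thesis .
qed

lemma AE_mass_pos_P: "AE p in P. mass (a p) > 0"
  unfolding mass_def by (rule P.AE_label_mass_pos[OF a])

lemma AE_mass_pos_M: "AE w in M. mass (a' w) > 0"
  using M.AE_label_mass_pos[OF a'] by (simp add: mass_M)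

lemma nn_integral_weight_M: "AE p in P. (\<integral>\<^sup>+w. weight w p \<partial>M) = 1"
  using AE_mass_pos_P
proof eventually_elim
  case (elim p)
  have "(\<integral>\<^sup>+w. weight w p \<partial>M) =
      (\<integral>\<^sup>+w. ennreal (1 / mass (a p)) * indicator {w \<in> space M. a' w = a p} w \<partial>M)"
    by (intro nn_integral_cong) (auto simp: weight_def indicator_def)
  also have "\<dots> = ennreal (1 / mass (a p)) * ennreal (mass (a p))"
    by (subst nn_integral_cmult_indicator) (auto simp: M.emeasure_eq_measure mass_M)
  also have "\<dots> = 1"
    using elim by (simp flip: ennreal_mult)
  finally show ?case .
qed

lemma nn_integral_weight_P: "AE w in M. (\<integral>\<^sup>+p. weight w p \<partial>P) = 1"
  using AE_mass_pos_M
proof eventually_elim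
  case (elim w)
  have "(\<integral>\<^sup>+p. weight w p \<partial>P) =
      (\<integral>\<^sup>+p. ennreal (1 / mass (a' w)) * indicator {p \<in> space P. a p = a' w} p \<partial>P)"
    by (intro nn_integral_cong) (auto simp: weight_def indicator_def)
  also have "\<dots> = ennreal (1 / mass (a' w)) * ennreal (mass (a' w))"
    by (subst nn_integral_cmult_indicator) (auto simp: P.emeasure_eq_measure mass_def)
  also have "\<dots> = 1"
    using elim by (simp flip: ennreal_mult)
  finally show ?case .
qed

text \<open>Integrating out the first variable costs the factor 1. Besides the second marginal of
  \<open>glued\<close> this yields, for a measure glued to itself, the total expectation formula
  behind \<open>nn_integral_norm_avg_le\<close>.\<close>

lemma nn_integral_weight_snd:
  fixes f :: "'p \<Rightarrow> ennreal"
  assumes [measurable]: "f \<in> borel_measurable P"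
  shows "(\<integral>\<^sup>+w. \<integral>\<^sup>+p. weight w p * f p \<partial>P \<partial>M) = (\<integral>\<^sup>+p. f p \<partial>P)"
proof -
  have "(\<integral>\<^sup>+w. \<integral>\<^sup>+p. weight w p * f p \<partial>P \<partial>M) = (\<integral>\<^sup>+p. \<integral>\<^sup>+w. weight w p * f p \<partial>M \<partial>P)"
    by (rule MP.Fubini'[symmetric]) measurable
  also have "\<dots> = (\<integral>\<^sup>+p. (\<integral>\<^sup>+w. weight w p \<partial>M) * f p \<partial>P)"
    by (intro nn_integral_cong nn_integral_multc) measurable
  also have "\<dots> = (\<integral>\<^sup>+p. f p \<partial>P)"
    using nn_integral_weight_M by (intro nn_integral_cong_AE) (auto elim!: eventually_mono)
  finally show ?thesis .
qed

lemma sets_glued[measurable_cong]: "sets glued = sets (M \<Otimes>\<^sub>M P)"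
  by (simp add: glued_def)

lemma space_glued: "space glued = space M \<times> space P"
  by (simp add: glued_def space_pair_measure)

lemma nn_integral_glued:
  fixes f :: "'b \<times> 'p \<Rightarrow> ennreal"
  assumes [measurable]: "f \<in> borel_measurable (M \<Otimes>\<^sub>M P)"
  shows "(\<integral>\<^sup>+x. f x \<partial>glued) = (\<integral>\<^sup>+w. \<integral>\<^sup>+p. weight w p * f (w, p) \<partial>P \<partial>M)"
  unfolding glued_def
  by (subst nn_integral_density) (auto simp: P.nn_integral_fst[symmetric])

lemma distr_glued_snd: "distr glued P snd = P"
proof (rule measure_eqI)
  fix A assume "A \<in> sets (distr glued P snd)"
  then have [measurable]: "A \<in> sets P" by simp
  have "emeasure (distr glued P snd) A = (\<integral>\<^sup>+x. indicator A x \<partial>distr glued P snd)"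
    by simp
  also have "\<dots> = (\<integral>\<^sup>+x. indicator A (snd x) \<partial>glued)"
    by (subst nn_integral_distr) auto
  also have "\<dots> = (\<integral>\<^sup>+w. \<integral>\<^sup>+p. weight w p * (indicator A p :: ennreal) \<partial>P \<partial>M)"
    by (subst nn_integral_glued) auto
  also have "\<dots> = emeasure P A"
    by (subst nn_integral_weight_snd) auto
  finally show "emeasure (distr glued P snd) A = emeasure P A" .
qed simp

lemma distr_glued_fst: "distr glued M fst = M"
proof (rule measure_eqI)
  fix A assume "A \<in> sets (distr glued M fst)"
  then have [measurable]: "A \<in> sets M" by simp
  have "emeasure (distr glued M fst) A = (\<integral>\<^sup>+x. indicator A x \<partial>distr glued M fst)"
    by simp
  also have "\<dots> = (\<integral>\<^sup>+x. indicator A (fst x) \<partial>glued)"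
    by (subst nn_integral_distr) auto
  also have "\<dots> = (\<integral>\<^sup>+w. \<integral>\<^sup>+p. weight w p * (indicator A w :: ennreal) \<partial>P \<partial>M)"
    by (subst nn_integral_glued) auto
  also have "\<dots> = (\<integral>\<^sup>+w. (\<integral>\<^sup>+p. weight w p \<partial>P) * indicator A w \<partial>M)"
    by (intro nn_integral_cong nn_integral_multc) measurable
  also have "\<dots> = (\<integral>\<^sup>+w. indicator A w \<partial>M)"
    using nn_integral_weight_P by (intro nn_integral_cong_AE) (auto elim!: eventually_mono)
  finally show "emeasure (distr glued M fst) A = emeasure M A" by simp
qed simp

lemma prob_space_glued: "prob_space glued"
proof -
  have "prob_space (distr glued P snd)"
    by (simp add: distr_glued_snd P.prob_space_axioms)
  then show ?thesis by (rule prob_space_distrD[rotated]) simp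
qed

lemma AE_glued_labels: "AE x in glued. a' (fst x) = a (snd x)"
  unfolding glued_def by (subst AE_density) (auto simp: weight_def split: if_splits)

text \<open>Conditional independence given the label: with \<open>w\<close> fixed, the inner
  integral runs over the class of label \<open>a' w\<close> and is \<open>F w\<close> paired with a
  multiple of the class integral of \<open>G\<close>, which vanishes. Boundedness supplies the
  integrability for Fubini.\<close>

lemma integral_glued_inner_eq_0:
  fixes F :: "'b \<Rightarrow> 'v::euclidean_space" and G :: "'p \<Rightarrow> 'v"
  assumes F[measurable]: "F \<in> borel_measurable M" and G[measurable]: "G \<in> borel_measurable P"
    and bF: "\<And>w. w \<in> space M \<Longrightarrow> norm (F w) \<le> B1" and bG: "\<And>p. p \<in> space P \<Longrightarrow> norm (G p) \<le> B2"
    and G0: "\<And>q. (\<integral>p. indicator {q} (a p) *\<^sub>R G p \<partial>P) = 0"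
  shows "(\<integral>x. F (fst x) \<bullet> G (snd x) \<partial>glued) = 0"
proof -
  interpret Q: prob_space glued by (rule prob_space_glued)
  have "integrable glued (\<lambda>x. F (fst x) \<bullet> G (snd x))"
  proof (rule Q.integrable_const_bound)
    show "AE x in glued. norm (F (fst x) \<bullet> G (snd x)) \<le> B1 * B2"
    proof (rule AE_I2)
      fix x assume "x \<in> space glued"
      then have "norm (F (fst x)) \<le> B1" "norm (G (snd x)) \<le> B2"
        using bF bG by (auto simp: space_glued)
      moreover have "norm (F (fst x) \<bullet> G (snd x)) \<le> norm (F (fst x)) * norm (G (snd x))"
        by (simp add: Cauchy_Schwarz_ineq2)
      ultimately show "norm (F (fst x) \<bullet> G (snd x)) \<le> B1 * B2"
        by (meson mult_mono norm_ge_zero order_trans)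
    qed
  qed measurable
  then have i: "integrable (M \<Otimes>\<^sub>M P) (\<lambda>x. weight (fst x) (snd x) * (F (fst x) \<bullet> G (snd x)))"
    unfolding glued_def case_prod_beta
    by (subst (asm) integrable_density) (auto simp: weight_nonneg)
  have "(\<integral>x. F (fst x) \<bullet> G (snd x) \<partial>glued) =
      (\<integral>x. weight (fst x) (snd x) * (F (fst x) \<bullet> G (snd x)) \<partial>(M \<Otimes>\<^sub>M P))"
    unfolding glued_def case_prod_beta by (subst integral_density) (auto simp: weight_nonneg)
  also have "\<dots> = (\<integral>w. \<integral>p. weight w p * (F w \<bullet> G p) \<partial>P \<partial>M)"
    using MP.integral_fst'[OF i] by simp
  also have "\<dots> = (\<integral>w. 0 \<partial>M)"
  proof (intro Bochner_Integration.integral_cong refl)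
    fix w assume "w \<in> space M"
    have iG: "integrable P (\<lambda>p. indicator {a' w} (a p) *\<^sub>R G p)"
      by (rule P.integrable_const_bound[where B="max 0 B2"])
         (auto simp: indicator_def intro!: AE_I2 dest: bG)
    have "(\<integral>p. weight w p * (F w \<bullet> G p) \<partial>P) =
        (\<integral>p. F w \<bullet> ((1 / mass (a' w)) *\<^sub>R (indicator {a' w} (a p) *\<^sub>R G p)) \<partial>P)"
      by (intro Bochner_Integration.integral_cong) (auto simp: weight_def indicator_def)
    also have "\<dots> = F w \<bullet> ((1 / mass (a' w)) *\<^sub>R (\<integral>p. indicator {a' w} (a p) *\<^sub>R G p \<partial>P))"
      using iG by (simp only: integral_inner_right integral_scaleR_right integrable_scaleR_right)
    finally show "(\<integral>p. weight w p * (F w \<bullet> G p) \<partial>P) = 0" by (simp add: G0)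
  qed
  finally show ?thesis by simp
qed

end

text \<open>Induction on the length: a fresh element with law \<open>P\<close> is glued to the past
  along the label \<open>a (Suc k)\<close> evaluated at the last element, whose law is
  \<open>P\<close> as well. The new term of the sum is orthogonal to the earlier ones, so second
  moments add. All lengths use the space of infinite sequences; only the coordinates up to
  \<open>k\<close> are controlled. The weights \<open>w\<close> are quantified inside so that one
  measure serves all times.\<close>

lemma chain_exists:
  fixes P :: "'p measure" and a :: "nat \<Rightarrow> 'p \<Rightarrow> nat" and D :: "nat \<Rightarrow> 'p \<Rightarrow> 'v::euclidean_space"
  assumes P: "prob_space P"
    and a[measurable]: "\<And>i. a i \<in> measurable P (count_space UNIV)"
    and D[measurable]: "\<And>i. D i \<in> borel_measurable P"
    and B: "\<And>i p. p \<in> space P \<Longrightarrow> norm (D i p) \<le> B"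
    and D0: "\<And>i q. (\<integral>p. indicator {q} (a i p) *\<^sub>R D i p \<partial>P) = 0"
  shows "\<exists>M. prob_space M \<and> sets M = sets (PiM UNIV (\<lambda>_::nat. P)) \<and>
    (\<forall>i\<le>k. distr M P (\<lambda>\<omega>. \<omega> i) = P) \<and>
    (\<forall>i<k. AE \<omega> in M. a (Suc i) (\<omega> i) = a (Suc i) (\<omega> (Suc i))) \<and>
    (\<forall>w. (\<integral>\<omega>. (norm (\<Sum>i\<le>k. w i *\<^sub>R D i (\<omega> i)))\<^sup>2 \<partial>M) \<le> (\<Sum>i\<le>k. (w i)\<^sup>2 * B\<^sup>2))"
proof -
  interpret P: prob_space P by fact
  let ?S = "PiM UNIV (\<lambda>_::nat. P)"
  have sq: "(norm (D i p))\<^sup>2 \<le> B\<^sup>2" if "p \<in> space P" for i p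
    using B[OF that, of i] by (intro power_mono) auto
  have ED: "(\<integral>p. (norm (D i p))\<^sup>2 \<partial>P) \<le> B\<^sup>2" for i
    by (intro P.integral_le_const P.integrable_const_bound[where B="B\<^sup>2"])
       (auto simp: sq intro!: AE_I2)
  show ?thesis
  proof (induction k)
    case 0
    have m[measurable]: "(\<lambda>p. (\<lambda>_. p)) \<in> measurable P ?S"
      by (rule measurable_PiM_single') auto
    interpret M: prob_space "distr P ?S (\<lambda>p _. p)"
      by (rule P.prob_space_distr) measurable
    have "(\<integral>\<omega>. (norm (w 0 *\<^sub>R D 0 (\<omega> 0)))\<^sup>2 \<partial>distr P ?S (\<lambda>p _. p)) \<le> (w 0)\<^sup>2 * B\<^sup>2" for w :: "nat \<Rightarrow> real"
      using ED[of 0] by (subst integral_distr) (auto simp: power_mult_distrib intro!: mult_left_mono)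
    then show ?case
      by (intro exI[of _ "distr P ?S (\<lambda>p _. p)"])
         (auto simp: M.prob_space_axioms distr_distr comp_def)
  next
    case (Suc k)
    then obtain M where M: "prob_space M" and sM[measurable_cong]: "sets M = sets ?S"
      and marg: "\<And>i. i \<le> k \<Longrightarrow> distr M P (\<lambda>\<omega>. \<omega> i) = P"
      and agree: "\<And>i. i < k \<Longrightarrow> AE \<omega> in M. a (Suc i) (\<omega> i) = a (Suc i) (\<omega> (Suc i))"
      and L2: "\<And>w. (\<integral>\<omega>. (norm (\<Sum>i\<le>k. w i *\<^sub>R D i (\<omega> i)))\<^sup>2 \<partial>M) \<le> (\<Sum>i\<le>k. (w i)\<^sup>2 * B\<^sup>2)"
      by blast
    interpret M: prob_space M by fact
    have coord: "\<omega> i \<in> space P" if "\<omega> \<in> space M" for \<omega> i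
      using that sets_eq_imp_space_eq[OF sM] by (auto simp: space_PiM)
    have law: "distr M (count_space UNIV) (\<lambda>\<omega>. a (Suc k) (\<omega> k)) = distr P (count_space UNIV) (a (Suc k))"
    proof -
      have "distr M (count_space UNIV) (\<lambda>\<omega>. a (Suc k) (\<omega> k)) =
          distr (distr M P (\<lambda>\<omega>. \<omega> k)) (count_space UNIV) (a (Suc k))"
        by (subst distr_distr) (auto simp: comp_def)
      then show ?thesis by (simp add: marg)
    qed
    interpret G: label_gluing M P "\<lambda>\<omega>. a (Suc k) (\<omega> k)" "a (Suc k)"
      by unfold_locales (use law in auto)
    note [measurable_cong] = G.sets_glued
    interpret Q: prob_space G.glued by (rule G.prob_space_glued)
    \<comment> \<open>The extended sequence overwrites coordinate \<open>Suc k\<close> by the fresh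
      element and leaves the coordinates up to \<open>k\<close> untouched, so all statements about
      the past transfer.\<close>
    define upd where "upd = (\<lambda>(\<omega>::nat \<Rightarrow> 'p, p). fun_upd \<omega> (Suc k) p)"
    have upd[measurable]: "upd \<in> measurable G.glued ?S"
      unfolding upd_def case_prod_beta
      by (rule measurable_fun_upd[of _ UNIV]) (auto simp: measurable_fst'' )
    define M' where "M' = distr G.glued ?S upd"
    have upd_simps: "upd x (Suc k) = snd x" "i \<le> k \<Longrightarrow> upd x i = fst x i" for x i
      by (auto simp: upd_def split: prod.splits)
    have "prob_space M'" unfolding M'_def by (rule Q.prob_space_distr) measurable
    moreover have "sets M' = sets ?S" by (simp add: M'_def)
    moreover have "distr M' P (\<lambda>\<omega>. \<omega> i) = P" if "i \<le> Suc k" for i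
    proof (cases "i = Suc k")
      case True
      then show ?thesis
        unfolding M'_def by (subst distr_distr) (auto simp: comp_def upd_simps G.distr_glued_snd)
    next
      case False
      then have "i \<le> k" using that by simp
      have "distr M' P (\<lambda>\<omega>. \<omega> i) = distr G.glued P (\<lambda>x. fst x i)"
        unfolding M'_def using \<open>i \<le> k\<close> by (subst distr_distr) (auto simp: comp_def upd_simps)
      also have "\<dots> = distr (distr G.glued M fst) P (\<lambda>\<omega>. \<omega> i)"
        by (subst distr_distr) (auto simp: comp_def)
      finally show ?thesis by (simp add: G.distr_glued_fst marg \<open>i \<le> k\<close>)
    qed
    moreover have "AE \<omega> in M'. a (Suc i) (\<omega> i) = a (Suc i) (\<omega> (Suc i))" if "i < Suc k" for i
    proof (cases "i = k")
      case True
      then show ?thesis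
        unfolding M'_def using G.AE_glued_labels
        by (subst AE_distr_iff) (auto simp: upd_simps)
    next
      case False
      then have "i < k" using that by simp
      have "AE \<omega> in distr G.glued M fst. a (Suc i) (\<omega> i) = a (Suc i) (\<omega> (Suc i))"
        unfolding G.distr_glued_fst by (rule agree) fact
      then have "AE x in G.glued. a (Suc i) (fst x i) = a (Suc i) (fst x (Suc i))"
        by (rule AE_distrD[rotated]) measurable
      then show ?thesis
        unfolding M'_def using \<open>i < k\<close>
        by (subst AE_distr_iff) (auto simp: upd_simps)
    qed
    moreover have "(\<integral>\<omega>. (norm (\<Sum>i\<le>Suc k. w i *\<^sub>R D i (\<omega> i)))\<^sup>2 \<partial>M') \<le> (\<Sum>i\<le>Suc k. (w i)\<^sup>2 * B\<^sup>2)"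
      for w :: "nat \<Rightarrow> real"
    proof -
      define N where "N \<omega> = (\<Sum>i\<le>k. w i *\<^sub>R D i (\<omega> i))" for \<omega>
      define D' where "D' p = w (Suc k) *\<^sub>R D (Suc k) p" for p
      have N[measurable]: "N \<in> borel_measurable M" unfolding N_def by measurable
      have D'[measurable]: "D' \<in> borel_measurable P" unfolding D'_def by measurable
      have bN: "norm (N \<omega>) \<le> (\<Sum>i\<le>k. \<bar>w i\<bar> * B)" if "\<omega> \<in> space M" for \<omega>
        unfolding N_def using that coord B by (intro sum_norm_le) (auto intro!: mult_left_mono)
      have bD': "norm (D' p) \<le> \<bar>w (Suc k)\<bar> * B" if "p \<in> space P" for p
        unfolding D'_def using that B by (auto intro!: mult_left_mono)
      have i1: "integrable M (\<lambda>\<omega>. (norm (N \<omega>))\<^sup>2)"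
        by (rule M.integrable_const_bound[where B="(\<Sum>i\<le>k. \<bar>w i\<bar> * B)\<^sup>2"])
           (auto intro!: AE_I2 power_mono bN)
      have i2: "integrable P (\<lambda>p. (norm (D' p))\<^sup>2)"
        by (rule P.integrable_const_bound[where B="(\<bar>w (Suc k)\<bar> * B)\<^sup>2"])
           (auto intro!: AE_I2 power_mono bD')
      have j1: "integrable G.glued (\<lambda>x. (norm (N (fst x)))\<^sup>2)"
        by (rule integrable_distr[of fst _ M]) (auto simp: G.distr_glued_fst i1)
      have j2: "integrable G.glued (\<lambda>x. (norm (D' (snd x)))\<^sup>2)"
        by (rule integrable_distr[of snd _ P]) (auto simp: G.distr_glued_snd i2)
      have j3: "integrable G.glued (\<lambda>x. 2 * (N (fst x) \<bullet> D' (snd x)))"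
      proof (rule Bochner_Integration.integrable_bound[OF Bochner_Integration.integrable_add[OF j1 j2]])
        show "AE x in G.glued. norm (2 * (N (fst x) \<bullet> D' (snd x)))
            \<le> norm ((norm (N (fst x)))\<^sup>2 + (norm (D' (snd x)))\<^sup>2)"
        proof (rule AE_I2)
          fix x
          have "\<bar>N (fst x) \<bullet> D' (snd x)\<bar> \<le> norm (N (fst x)) * norm (D' (snd x))"
            by (rule Cauchy_Schwarz_ineq2)
          then show "norm (2 * (N (fst x) \<bullet> D' (snd x)))
              \<le> norm ((norm (N (fst x)))\<^sup>2 + (norm (D' (snd x)))\<^sup>2)"
            using sum_squares_bound[of "norm (N (fst x))" "norm (D' (snd x))"] by simp
        qed
      qed measurable
      \<comment> \<open>\<open>N\<close> depends on the past, also through the label, but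
        \<open>D (Suc k)\<close> integrates to 0 over every class of \<open>a (Suc k)\<close>, the
        label along which the gluing was made.\<close>
      have cross: "(\<integral>x. N (fst x) \<bullet> D' (snd x) \<partial>G.glued) = 0"
      proof (rule G.integral_glued_inner_eq_0[OF N D' bN bD'])
        fix q
        have "(\<integral>p. indicator {q} (a (Suc k) p) *\<^sub>R D' p \<partial>P) =
            (\<integral>p. w (Suc k) *\<^sub>R (indicator {q} (a (Suc k) p) *\<^sub>R D (Suc k) p) \<partial>P)"
          by (simp add: D'_def mult.commute)
        then show "(\<integral>p. indicator {q} (a (Suc k) p) *\<^sub>R D' p \<partial>P) = 0"
          by (simp only: integral_scaleR_right D0 scaleR_zero_right)
      qed
      have "(\<integral>\<omega>. (norm (\<Sum>i\<le>Suc k. w i *\<^sub>R D i (\<omega> i)))\<^sup>2 \<partial>M') =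
          (\<integral>x. (norm (N (fst x) + D' (snd x)))\<^sup>2 \<partial>G.glued)"
        unfolding M'_def N_def D'_def
        by (subst integral_distr) (auto simp: upd_simps intro!: Bochner_Integration.integral_cong)
      also have "\<dots> = (\<integral>x. ((norm (N (fst x)))\<^sup>2 + (norm (D' (snd x)))\<^sup>2)
            + 2 * (N (fst x) \<bullet> D' (snd x)) \<partial>G.glued)"
        by (simp add: dot_norm field_simps)
      also have "\<dots> = (\<integral>x. (norm (N (fst x)))\<^sup>2 \<partial>G.glued) + (\<integral>x. (norm (D' (snd x)))\<^sup>2 \<partial>G.glued)"
        using j1 j2 j3 cross by simp
      also have "(\<integral>x. (norm (N (fst x)))\<^sup>2 \<partial>G.glued) = (\<integral>\<omega>. (norm (N \<omega>))\<^sup>2 \<partial>distr G.glued M fst)"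
        by (subst integral_distr) auto
      also have "\<dots> = (\<integral>\<omega>. (norm (N \<omega>))\<^sup>2 \<partial>M)" by (simp add: G.distr_glued_fst)
      also have "(\<integral>x. (norm (D' (snd x)))\<^sup>2 \<partial>G.glued) = (\<integral>p. (norm (D' p))\<^sup>2 \<partial>distr G.glued P snd)"
        by (subst integral_distr) auto
      also have "\<dots> = (w (Suc k))\<^sup>2 * (\<integral>p. (norm (D (Suc k) p))\<^sup>2 \<partial>P)"
        by (simp add: G.distr_glued_snd D'_def power_mult_distrib)
      also have "(\<integral>\<omega>. (norm (N \<omega>))\<^sup>2 \<partial>M) + (w (Suc k))\<^sup>2 * (\<integral>p. (norm (D (Suc k) p))\<^sup>2 \<partial>P)
          \<le> (\<Sum>i\<le>k. (w i)\<^sup>2 * B\<^sup>2) + (w (Suc k))\<^sup>2 * B\<^sup>2"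
        using L2[of w] ED[of "Suc k"] by (intro add_mono mult_left_mono) (auto simp: N_def)
      finally show ?thesis by simp
    qed
    ultimately show ?case by blast
  qed
qed

section \<open>Truncation, cells and grid shifts\<close>

text \<open>Needed because the velocity is merely integrable, whereas the second moment bound of
  \<open>chain_exists\<close> requires uniformly bounded terms.\<close>

lemma (in prob_space) truncation_exists:
  fixes Y :: "'a \<Rightarrow> 'v::euclidean_space"
  assumes Y: "integrable M Y" and \<epsilon>: "0 < \<epsilon>"
  obtains Z B where "Z \<in> borel_measurable M" "\<And>x. norm (Z x) \<le> B" "0 \<le> B"
    "(\<integral>\<^sup>+x. norm (Y x - Z x) \<partial>M) \<le> ennreal \<epsilon>"
proof -
  define Z where "Z n x = indicator {x. norm (Y x) \<le> real n} x *\<^sub>R Y x" for n :: nat and x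
  have [measurable]: "Y \<in> borel_measurable M" using Y by auto
  have [measurable]: "Z n \<in> borel_measurable M" for n unfolding Z_def by measurable
  have le: "norm (Y x - Z n x) \<le> norm (Y x)" for x n
    by (auto simp: Z_def indicator_def)
  have "(\<lambda>n. \<integral>x. norm (Y x - Z n x) \<partial>M) \<longlonglongrightarrow> (\<integral>x. 0 \<partial>M)"
  proof (rule integral_dominated_convergence[where w="\<lambda>x. norm (Y x)"])
    show "AE x in M. (\<lambda>n. norm (Y x - Z n x)) \<longlonglongrightarrow> 0"
    proof (rule AE_I2)
      fix x
      obtain N :: nat where N: "norm (Y x) \<le> N" using real_arch_simple by blast
      have "\<forall>\<^sub>F n in sequentially. norm (Y x - Z n x) = 0"
        using eventually_ge_at_top[of N]
        by eventually_elim (use N in \<open>auto simp: Z_def indicator_def\<close>)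
      then show "(\<lambda>n. norm (Y x - Z n x)) \<longlonglongrightarrow> 0"
        by (simp add: tendsto_eventually)
    qed
  qed (use Y le in auto)
  then have "\<forall>\<^sub>F n in sequentially. (\<integral>x. norm (Y x - Z n x) \<partial>M) < \<epsilon>"
    using \<epsilon> by (intro order_tendstoD) auto
  then obtain n where n: "(\<integral>x. norm (Y x - Z n x) \<partial>M) < \<epsilon>"
    by (auto simp: eventually_sequentially)
  have "integrable M (\<lambda>x. norm (Y x - Z n x))"
    by (rule Bochner_Integration.integrable_bound[OF Y]) (auto simp: le)
  then have "(\<integral>\<^sup>+x. norm (Y x - Z n x) \<partial>M) = ennreal (\<integral>x. norm (Y x - Z n x) \<partial>M)"
    by (intro nn_integral_eq_integral) auto
  also have "\<dots> \<le> ennreal \<epsilon>" using n by (intro ennreal_leI) auto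
  finally show thesis
    by (intro that[of "Z n" "real n"]) (auto simp: Z_def indicator_def)
qed

text \<open>The cell of a point is the index of the first point of a countable dense set within
  distance \<open>h / 2\<close>. Being a least index, it is Borel; two points of one cell share this
  center.\<close>

lemma countable_cells_exist:
  assumes h: "0 < h"
  obtains cell :: "'a::euclidean_space \<Rightarrow> nat"
  where "cell \<in> measurable borel (count_space UNIV)" "\<And>x y. cell x = cell y \<Longrightarrow> dist x y \<le> h"
proof -
  obtain D :: "'a set" where D: "countable D" "\<And>X. open X \<Longrightarrow> X \<noteq> {} \<Longrightarrow> \<exists>d\<in>D. d \<in> X"
    using countable_dense_exists by blast
  define d where "d = from_nat_into D"
  have "D \<noteq> {}" using D(2)[of UNIV] by auto
  then have D_eq: "range d = D" using D(1) by (simp add: d_def range_from_nat_into)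
  have ex: "\<exists>i. dist x (d i) < h / 2" for x
  proof -
    have "\<exists>y\<in>D. y \<in> ball x (h / 2)" using h by (intro D(2)) auto
    then obtain y where "y \<in> range d" "dist x y < h / 2" unfolding D_eq by auto
    then show ?thesis by auto
  qed
  define cell where "cell x = (LEAST i. dist x (d i) < h / 2)" for x
  have near: "dist x (d (cell x)) < h / 2" for x
    unfolding cell_def by (rule LeastI_ex) (rule ex)
  have "cell \<in> measurable borel (count_space UNIV)"
    unfolding cell_def by measurable
  moreover have "dist x y \<le> h" if "cell x = cell y" for x y
    using near[of x] near[of y] dist_triangle3[of x y "d (cell x)"] that
    by (simp add: dist_commute)
  ultimately show thesis by (rule that)
qed

text \<open>The field error is only integrable in time, so its Riemann sums are controlled for a
  suitable shift of the grid, not for every grid.\<close>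

lemma good_shift_exists:
  fixes f :: "real \<Rightarrow> ennreal"
  assumes f[measurable]: "f \<in> borel_measurable borel" and n: "0 < n" and \<epsilon>: "0 < \<epsilon>"
  obtains \<tau> where "0 < \<tau>" "\<tau> < 1 / real n"
    "(\<Sum>i<n. f (\<tau> + real i / real n)) \<le> of_nat n * ((\<integral>\<^sup>+t. f t * indicator {0..1} t \<partial>lborel) + ennreal \<epsilon>)"
proof -
  define I where "I = (\<integral>\<^sup>+t. f t * indicator {0..1} t \<partial>lborel)"
  have "\<exists>\<tau>. 0 < \<tau> \<and> \<tau> < 1 / real n \<and> (\<Sum>i<n. f (\<tau> + i / n)) \<le> of_nat n * (I + ennreal \<epsilon>)"
  proof (rule ccontr)
    assume "\<not> ?thesis"
    \<comment> \<open>If every shift failed, integrating over \<open>0 < \<tau> < 1/n\<close> would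
      give a contradiction: the \<open>n\<close> translated windows tile the unit interval up to its
      grid points, so the Riemann sums integrate to at most \<open>I\<close>.\<close>
    then have gt: "(\<Sum>i<n. f (\<tau> + i / n)) > of_nat n * (I + ennreal \<epsilon>)"
      if "0 < \<tau>" "\<tau> < 1 / n" for \<tau> using that by (meson not_le)
    let ?J = "\<lambda>i::nat. {i / n <..< (i + 1) / n}"
    have "of_nat n * (I + ennreal \<epsilon>) * ennreal (1 / n)
        = (\<integral>\<^sup>+\<tau>. of_nat n * (I + ennreal \<epsilon>) * indicator {0<..<1/n} \<tau> \<partial>lborel)"
      by (subst nn_integral_cmult_indicator) auto
    also have "\<dots> \<le> (\<integral>\<^sup>+\<tau>. (\<Sum>i<n. f (\<tau> + i / n)) * indicator {0<..<1/n} \<tau> \<partial>lborel)"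
      by (intro nn_integral_mono) (auto simp: indicator_def dest!: gt)
    also have "\<dots> = (\<Sum>i<n. \<integral>\<^sup>+\<tau>. f (\<tau> + i / n) * indicator {0<..<1/n} \<tau> \<partial>lborel)"
      by (subst nn_integral_sum[symmetric]) (auto simp: sum_distrib_right)
    also have "\<dots> = (\<Sum>i<n. \<integral>\<^sup>+\<tau>. f \<tau> * indicator (?J i) \<tau> \<partial>lborel)"
    proof (intro sum.cong refl)
      fix i
      have "(\<integral>\<^sup>+\<tau>. f \<tau> * indicator (?J i) \<tau> \<partial>lborel) =
          (\<integral>\<^sup>+\<tau>. f (i / n + 1 * \<tau>) * indicator (?J i) (i / n + 1 * \<tau>) \<partial>lborel)"
        by (subst nn_integral_real_affine[where c=1 and t="i / n"]) auto
      also have "\<dots> = (\<integral>\<^sup>+\<tau>. f (\<tau> + i / n) * indicator {0<..<1/n} \<tau> \<partial>lborel)"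
        by (intro nn_integral_cong) (auto simp: indicator_def add.commute add_divide_distrib)
      finally show "(\<integral>\<^sup>+\<tau>. f (\<tau> + i / n) * indicator {0<..<1/n} \<tau> \<partial>lborel) =
          (\<integral>\<^sup>+\<tau>. f \<tau> * indicator (?J i) \<tau> \<partial>lborel)" ..
    qed
    also have "\<dots> = (\<integral>\<^sup>+\<tau>. (\<Sum>i<n. f \<tau> * indicator (?J i) \<tau>) \<partial>lborel)"
      by (subst nn_integral_sum) auto
    also have "\<dots> = (\<integral>\<^sup>+\<tau>. f \<tau> * indicator (\<Union>i<n. ?J i) \<tau> \<partial>lborel)"
    proof -
      have "disjoint_family_on ?J {..<n}"
        unfolding disjoint_family_on_def
      proof (intro ballI impI)
        fix i j :: nat assume "i \<noteq> j"
        then consider "i + 1 \<le> j" | "j + 1 \<le> i" by linarith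
        then show "?J i \<inter> ?J j = {}"
        proof cases
          case 1
          then have "(i + 1) / real n \<le> j / real n" by (intro divide_right_mono) linarith+
          then show ?thesis by auto
        next
          case 2
          then have "(j + 1) / real n \<le> i / real n" by (intro divide_right_mono) linarith+
          then show ?thesis by auto
        qed
      qed
      then show ?thesis
        by (subst indicator_UN_disjoint) (auto simp: sum_distrib_left)
    qed
    also have "\<dots> \<le> I"
      unfolding I_def
    proof (intro nn_integral_mono mult_left_mono)
      fix t :: real
      have sub: "(\<Union>i<n. ?J i) \<subseteq> {0..1}"
      proof
        fix x assume "x \<in> (\<Union>i<n. ?J i)"
        then obtain i where i: "i < n" "i / n < x" "x < (i + 1) / n" by (auto simp: add.commute)
        have "0 \<le> i / real n" by simp
        moreover have "(i + 1) / real n \<le> 1" using i(1) by (simp add: field_simps)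
        ultimately show "x \<in> {0..1}"
          using i(2,3) by (simp only: atLeastAtMost_iff of_nat_add of_nat_1) linarith
      qed
      show "indicator (\<Union>i<n. ?J i) t \<le> (indicator {0..1} t :: ennreal)"
      proof -
        have "indicator A t \<le> (indicator B t :: ennreal)" if "A \<subseteq> B" for A B
          using that by (auto simp: indicator_def)
        from this[OF sub] show ?thesis .
      qed
    qed simp
    finally have le: "of_nat n * (I + ennreal \<epsilon>) * ennreal (1 / n) \<le> I" .
    have "of_nat n * (I + ennreal \<epsilon>) * ennreal (1 / n) = (of_nat n * ennreal (1 / n)) * (I + ennreal \<epsilon>)"
      by (simp add: ac_simps)
    also have "of_nat n * ennreal (1 / n) = 1"
      using n by (simp add: ennreal_of_nat_eq_real_of_nat flip: ennreal_mult)
    finally have "I + ennreal \<epsilon> \<le> I" using le by simp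
    \<comment> \<open>Only an infinite integral remains possible, and then \<open>gt\<close> would
      demand a value above infinity; the midpoint of the window provides a shift to apply it
      to.\<close>
    then have "I = \<infinity>"
      using \<epsilon> by (cases I) (auto simp flip: ennreal_plus)
    then show False using gt[of "1 / (2 * n)"] n by (auto simp: ennreal_mult_top field_simps)
  qed
  then obtain \<tau> where "0 < \<tau>" "\<tau> < 1 / real n" "(\<Sum>i<n. f (\<tau> + i / n)) \<le> of_nat n * (I + ennreal \<epsilon>)"
    by (elim exE conjE)
  then show thesis unfolding I_def by (rule that)
qed

section \<open>Averages over labels\<close>

lemma norm_integral_le:
  fixes f :: "'b \<Rightarrow> 'v::{banach, second_countable_topology}"
  assumes "integrable M g" "\<And>x. x \<in> space M \<Longrightarrow> norm (f x) \<le> g x"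
  shows "norm (integral\<^sup>L M f) \<le> integral\<^sup>L M g"
proof -
  have "(\<integral>x. norm (f x) \<partial>M) \<le> integral\<^sup>L M g"
  proof (rule integral_mono'[OF assms])
    show "0 \<le> g x" if "x \<in> space M" for x
      using assms(2)[OF that] norm_ge_zero by (rule order_trans[rotated])
  qed
  then show ?thesis by (rule order_trans[OF integral_norm_bound])
qed

text \<open>Conditional expectation on a countable partition. Gluing \<open>P\<close> to itself
  provides \<open>mass\<close>, \<open>weight\<close> and the total expectation formula.\<close>

locale labelled = prob_space P for P :: "'p measure" +
  fixes a :: "'p \<Rightarrow> nat"
  assumes label_measurable: "a \<in> measurable P (count_space UNIV)"
begin

sublocale self: label_gluing P P a a
  using label_measurable by unfold_locales auto

text \<open>The conditional expectation of \<open>H\<close> on the class of label \<open>q\<close>;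
  on classes of mass zero it is 0 through division by zero.\<close>

definition avg :: "('p \<Rightarrow> 'v::euclidean_space) \<Rightarrow> nat \<Rightarrow> 'v" where
  "avg H q = (1 / self.mass q) *\<^sub>R (\<integral>p. indicator {q} (a p) *\<^sub>R H p \<partial>P)"

lemma integrable_on_label:
  fixes H :: "'p \<Rightarrow> 'v::euclidean_space"
  assumes "integrable P H"
  shows "integrable P (\<lambda>p. indicator {q} (a p) *\<^sub>R H p)"
proof -
  note [measurable] = label_measurable borel_measurable_integrable[OF assms]
  show ?thesis
    by (rule Bochner_Integration.integrable_bound[OF assms]) (auto simp: indicator_def)
qed

lemma integrable_label: "integrable P (\<lambda>p. indicator {q} (a p) :: real)"
proof -
  note [measurable] = label_measurable
  show ?thesis by (rule integrable_const_bound[where B=1]) (auto simp: indicator_def)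
qed

lemma measurable_avg[measurable]: "(\<lambda>p. avg H (a p)) \<in> borel_measurable P"
  by (rule measurable_compose[OF label_measurable]) simp

lemma avg_add:
  assumes "integrable P H1" "integrable P H2"
  shows "avg (\<lambda>p. H1 p + H2 p) q = avg H1 q + avg H2 q"
  using assms by (simp add: avg_def scaleR_add_right integrable_on_label)

lemma integral_label: "(\<integral>p. indicator {q} (a p) \<partial>P) = self.mass q"
proof -
  note [measurable] = label_measurable
  have "(\<integral>p. indicator {q} (a p) \<partial>P) = (\<integral>p. indicator {p \<in> space P. a p = q} p \<partial>P)"
    by (intro Bochner_Integration.integral_cong) (auto simp: indicator_def)
  also have "\<dots> = measure P {p \<in> space P. a p = q}" by simp
  finally show ?thesis by (simp add: self.mass_def)
qed

text \<open>The division-free form, valid for null classes too since both sides vanish there. It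
  lets later identities hold for every label, not just for almost every one.\<close>

lemma mass_avg:
  assumes "integrable P H"
  shows "self.mass q *\<^sub>R avg H q = (\<integral>p. indicator {q} (a p) *\<^sub>R H p \<partial>P)"
proof (cases "self.mass q = 0")
  case True
  note [measurable] = label_measurable
  have "{p \<in> space P. a p = q} \<in> null_sets P"
    using True by (auto simp: self.mass_def null_sets_def emeasure_eq_measure)
  then have "AE p in P. a p \<noteq> q" by (auto dest!: AE_not_in)
  then have "(\<integral>p. indicator {q} (a p) *\<^sub>R H p \<partial>P) = 0"
    by (intro integral_eq_zero_AE) (auto elim!: eventually_mono)
  then show ?thesis using True by simp
qed (simp add: avg_def)

lemma norm_avg_le:
  assumes "integrable P H" "\<And>p. norm (H p) \<le> B" "0 \<le> B"
  shows "norm (avg H q) \<le> B"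
proof (cases "self.mass q = 0")
  case False
  then have m: "self.mass q > 0" by (simp add: self.mass_def zero_less_measure_iff)
  have "norm (\<integral>p. indicator {q} (a p) *\<^sub>R H p \<partial>P) \<le> (\<integral>p. indicator {q} (a p) * B \<partial>P)"
    by (intro norm_integral_le integrable_mult_left integrable_label) (simp add: indicator_def assms)
  also have "\<dots> = self.mass q * B" by (simp add: integral_label)
  finally show ?thesis using m by (simp add: avg_def field_simps)
qed (simp add: avg_def assms)

text \<open>Conditional Jensen inequality for the norm: on the class of \<open>w\<close> the average
  is at most the integral of the norm against \<open>weight w\<close>, and integrating over
  \<open>w\<close> is the total expectation formula.\<close>

lemma nn_integral_norm_avg_le:
  fixes H :: "'p \<Rightarrow> 'v::euclidean_space"
  assumes H: "integrable P H"
  shows "(\<integral>\<^sup>+p. norm (avg H (a p)) \<partial>P) \<le> (\<integral>\<^sup>+p. norm (H p) \<partial>P)"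
proof -
  note [measurable] = label_measurable borel_measurable_integrable[OF H]
  have "ennreal (norm (avg H (a w))) \<le> (\<integral>\<^sup>+p. self.weight w p * ennreal (norm (H p)) \<partial>P)" for w
  proof -
    have eq: "avg H (a w) = (\<integral>p. (1 / self.mass (a w)) *\<^sub>R (indicator {a w} (a p) *\<^sub>R H p) \<partial>P)"
      unfolding avg_def by (simp only: integral_scaleR_right)
    have "ennreal (norm (avg H (a w)))
        \<le> (\<integral>\<^sup>+p. norm ((1 / self.mass (a w)) *\<^sub>R (indicator {a w} (a p) *\<^sub>R H p)) \<partial>P)"
      unfolding eq by (intro integral_norm_bound_ennreal integrable_scaleR_right integrable_on_label H)
    also have "\<dots> = (\<integral>\<^sup>+p. self.weight w p * ennreal (norm (H p)) \<partial>P)"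
      by (intro nn_integral_cong)
         (auto simp: self.weight_def indicator_def self.mass_def simp flip: ennreal_mult)
    finally show ?thesis .
  qed
  then have "(\<integral>\<^sup>+p. norm (avg H (a p)) \<partial>P) \<le> (\<integral>\<^sup>+w. \<integral>\<^sup>+p. self.weight w p * ennreal (norm (H p)) \<partial>P \<partial>P)"
    by (intro nn_integral_mono)
  also have "\<dots> = (\<integral>\<^sup>+p. norm (H p) \<partial>P)"
    by (rule self.nn_integral_weight_snd) measurable
  finally show ?thesis .
qed

lemma norm_avg_diff_le:
  fixes H :: "'p \<Rightarrow> 'v::euclidean_space"
  assumes H: "integrable P H" and d: "\<And>x y. a x = a y \<Longrightarrow> dist (H x) (H y) \<le> d"
    and m: "self.mass (a p) > 0"
  shows "norm (avg H (a p) - H p) \<le> d"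
proof -
  have d0: "0 \<le> d" using d[of p p] by simp
  have "(\<integral>x. indicator {a p} (a x) *\<^sub>R (H x - H p) \<partial>P) =
      (\<integral>x. indicator {a p} (a x) *\<^sub>R H x \<partial>P) - self.mass (a p) *\<^sub>R H p"
    using integrable_on_label[OF H] integrable_label integral_label[of "a p"]
    by (simp add: scaleR_diff_right)
  then have "self.mass (a p) *\<^sub>R (avg H (a p) - H p) = (\<integral>x. indicator {a p} (a x) *\<^sub>R (H x - H p) \<partial>P)"
    by (simp add: scaleR_diff_right mass_avg[OF H])
  moreover have "norm (\<integral>x. indicator {a p} (a x) *\<^sub>R (H x - H p) \<partial>P)
      \<le> (\<integral>x. indicator {a p} (a x) * d \<partial>P)"
    using d d0
    by (intro norm_integral_le integrable_mult_left integrable_label)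
       (simp add: indicator_def dist_norm[symmetric])
  ultimately have "norm (self.mass (a p) *\<^sub>R (avg H (a p) - H p)) \<le> self.mass (a p) * d"
    by (simp only: integral_mult_left_zero integral_label)
  then have "self.mass (a p) * norm (avg H (a p) - H p) \<le> self.mass (a p) * d"
    using m by simp
  then show ?thesis using m by simp
qed

text \<open>This centering is the martingale difference property that \<open>chain_exists\<close>
  asks for as \<open>D0\<close>.\<close>

lemma integral_label_minus_avg:
  fixes H :: "'p \<Rightarrow> 'v::euclidean_space"
  assumes H: "integrable P H"
  shows "(\<integral>p. indicator {q} (a p) *\<^sub>R (H p - avg H (a p)) \<partial>P) = 0"
proof -
  have "(\<integral>p. indicator {q} (a p) *\<^sub>R (H p - avg H (a p)) \<partial>P) =
      (\<integral>p. indicator {q} (a p) *\<^sub>R H p - indicator {q} (a p) *\<^sub>R avg H q \<partial>P)"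
    by (intro Bochner_Integration.integral_cong) (auto simp: indicator_def)
  also have "\<dots> = (\<integral>p. indicator {q} (a p) *\<^sub>R H p \<partial>P) - self.mass q *\<^sub>R avg H q"
    using integrable_label integrable_on_label[OF H] integral_label[of q] by simp
  finally show ?thesis by (simp add: mass_avg[OF H])
qed

end

section \<open>The velocity field as a conditional expectation\<close>

lemma interp_diff: "interp t p - interp s p = (t - s) *\<^sub>R (snd p - fst p)"
  by (simp add: interp_def algebra_simps)

lemma measurable_interp[measurable (raw)]:
  fixes f :: "'b \<Rightarrow> real" and g :: "'b \<Rightarrow> 'a::euclidean_space \<times> 'a"
  assumes [measurable]: "f \<in> borel_measurable M" "g \<in> borel_measurable M"
  shows "(\<lambda>x. interp (f x) (g x)) \<in> borel_measurable M"
proof -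
  have [measurable]: "fst \<in> borel_measurable (borel :: ('a \<times> 'a) measure)"
    by (rule measurable_fst[of "borel :: 'a measure" "borel :: 'a measure", unfolded borel_prod])
  have [measurable]: "snd \<in> borel_measurable (borel :: ('a \<times> 'a) measure)"
    by (rule measurable_snd[of "borel :: 'a measure" "borel :: 'a measure", unfolded borel_prod])
  show ?thesis unfolding interp_def by measurable
qed

text \<open>Only the defining identity of the velocity field is used, so the coupling of the end
  points need not be a product.\<close>

locale rectified_flow = prob_space P for P :: "('a::euclidean_space \<times> 'a) measure" +
  fixes v :: "real \<Rightarrow> 'a \<Rightarrow> 'a"
  assumes sets_P[measurable_cong]: "sets P = sets borel"
    and v[measurable]: "(\<lambda>x. v (fst x) (snd x)) \<in> borel_measurable borel"
    and integrable_velocity: "integrable P (\<lambda>p. snd p - fst p)"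
    and integrable_field: "\<And>t. t \<in> {0..1} \<Longrightarrow> integrable P (\<lambda>p. v t (interp t p))"
    and field_eq: "\<And>t B. t \<in> {0..1} \<Longrightarrow> B \<in> sets borel \<Longrightarrow>
      (\<integral>p. indicator B (interp t p) *\<^sub>R (snd p - fst p) \<partial>P) =
      (\<integral>p. indicator B (interp t p) *\<^sub>R v t (interp t p) \<partial>P)"
begin

lemma space_P[simp]: "space P = UNIV"
  using sets_eq_imp_space_eq[OF sets_P] by simp

lemma measurable_field[measurable (raw)]:
  assumes [measurable]: "f \<in> borel_measurable M" "g \<in> borel_measurable M"
  shows "(\<lambda>x. v (f x) (g x)) \<in> borel_measurable M"
proof -
  have "(\<lambda>x. (f x, g x)) \<in> measurable M borel" by measurable
  from measurable_compose[OF this v] show ?thesis by simp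
qed

definition field_error :: "(real \<times> 'a \<Rightarrow> 'a) \<Rightarrow> real \<Rightarrow> ennreal" where
  "field_error c t = (\<integral>\<^sup>+p. norm (v t (interp t p) - c (t, interp t p)) \<partial>P)"

lemma measurable_field_error[measurable]:
  assumes [measurable]: "c \<in> borel_measurable borel"
  shows "field_error c \<in> borel_measurable borel"
proof -
  have "(\<lambda>x. (fst x, interp (fst x) (snd x))) \<in> measurable (borel \<Otimes>\<^sub>M P) borel"
    by measurable
  from measurable_compose[OF this assms]
  have [measurable]: "(\<lambda>x. c (fst x, interp (fst x) (snd x))) \<in> borel_measurable (borel \<Otimes>\<^sub>M P)" .
  show ?thesis
    unfolding field_error_def by measurable
qed

text \<open>The truncated velocity \<open>Z\<close> is replaced by the velocity, the average of the
  velocity by that of \<open>v t\<close>, the field \<open>v t\<close> by \<open>c\<close>, and the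
  average of \<open>c\<close> by its value. Averaging does not increase L1 norms, so these
  replacements cost the truncation error, nothing, the field error and the oscillation of
  \<open>c\<close> over a cell.\<close>

lemma drift_error:
  fixes c :: "real \<times> 'a \<Rightarrow> 'a" and Z :: "'a \<times> 'a \<Rightarrow> 'a"
  assumes t: "t \<in> {0..1}" and cell: "cell \<in> measurable borel (count_space UNIV)"
    and h: "\<And>x y. cell x = cell y \<Longrightarrow> dist x y \<le> h"
    and c: "L-lipschitz_on UNIV c" and bc: "\<And>x. norm (c x) \<le> Bc"
    and Z[measurable]: "Z \<in> borel_measurable P" and bZ: "\<And>p. norm (Z p) \<le> B"
  shows "(\<integral>\<^sup>+p. norm (labelled.avg P (\<lambda>p. cell (interp t p)) Z (cell (interp t p)) - c (t, interp t p)) \<partial>P)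
    \<le> (\<integral>\<^sup>+p. norm (snd p - fst p - Z p) \<partial>P) + field_error c t + ennreal (L * h)"
proof -
  let ?a = "\<lambda>p. cell (interp t p)"
  have a[measurable]: "?a \<in> measurable P (count_space UNIV)"
    by (rule measurable_compose[OF _ cell]) measurable
  have cm[measurable]: "c \<in> borel_measurable borel"
    by (intro borel_measurable_continuous_onI lipschitz_on_continuous_on[OF c])
  have [measurable]: "(\<lambda>p. c (t, interp t p)) \<in> borel_measurable P"
    by (rule measurable_compose[OF _ cm]) measurable
  interpret A: labelled P ?a by unfold_locales measurable
  have iZ: "integrable P Z"
    by (rule integrable_const_bound[where B=B]) (auto simp: bZ)
  have ic: "integrable P (\<lambda>p. c (t, interp t p))"
    by (rule integrable_const_bound[where B=Bc]) (auto simp: bc)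
  let ?Y = "\<lambda>p::'a \<times> 'a. snd p - fst p" and ?V = "\<lambda>p. v t (interp t p)"
  let ?c = "\<lambda>p. c (t, interp t p)"
  note int = iZ ic integrable_velocity integrable_field[OF t]
  \<comment> \<open>A class of the label is the event that \<open>interp t\<close> lies in a Borel
    cell, so the defining identity of the velocity field applies to it.\<close>
  have avgY: "A.avg ?Y q = A.avg ?V q" for q
  proof -
    have "cell -` {q} \<in> sets borel"
      using measurable_sets[OF cell, of "{q}"] by simp
    from field_eq[OF t this] show ?thesis
      unfolding A.avg_def by (simp add: indicator_def)
  qed
  have split: "A.avg Z q = A.avg (\<lambda>p. Z p - ?Y p) q + A.avg (\<lambda>p. ?V p - ?c p) q + A.avg ?c q" for q
  proof -
    have "A.avg Z q = A.avg (\<lambda>p. (Z p - ?Y p) + ?Y p) q" by simp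
    also have "\<dots> = A.avg (\<lambda>p. Z p - ?Y p) q + A.avg ?V q"
      unfolding avgY[symmetric] by (rule A.avg_add) (use int in auto)
    also have "A.avg ?V q = A.avg (\<lambda>p. (?V p - ?c p) + ?c p) q" by simp
    also have "\<dots> = A.avg (\<lambda>p. ?V p - ?c p) q + A.avg ?c q"
      by (rule A.avg_add) (use int in auto)
    finally show ?thesis by (simp add: add.assoc)
  qed
  have osc: "dist (?c x) (?c y) \<le> L * h" if "?a x = ?a y" for x y
  proof -
    have "dist (?c x) (?c y) \<le> L * dist (t, interp t x) (t, interp t y)"
      using lipschitz_onD[OF c] by blast
    also have "\<dots> \<le> L * h"
      using h[OF that] lipschitz_on_nonneg[OF c] by (intro mult_left_mono) (auto simp: dist_Pair_Pair)
    finally show ?thesis .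
  qed
  have Lh: "0 \<le> L * h" using osc[of undefined undefined] by simp
  have "(\<integral>\<^sup>+p. norm (A.avg Z (?a p) - ?c p) \<partial>P) \<le>
      (\<integral>\<^sup>+p. (ennreal (norm (A.avg (\<lambda>p. Z p - ?Y p) (?a p))) + ennreal (norm (A.avg (\<lambda>p. ?V p - ?c p) (?a p))))
        + ennreal (L * h) \<partial>P)"
  proof (rule nn_integral_mono_AE)
    show "AE p in P. ennreal (norm (A.avg Z (?a p) - ?c p)) \<le>
        (ennreal (norm (A.avg (\<lambda>p. Z p - ?Y p) (?a p))) + ennreal (norm (A.avg (\<lambda>p. ?V p - ?c p) (?a p))))
        + ennreal (L * h)"
      using A.self.AE_mass_pos_P
    proof eventually_elim
      case (elim p)
      have 1: "norm (A.avg ?c (?a p) - ?c p) \<le> L * h"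
        by (rule A.norm_avg_diff_le[OF ic osc elim])
      have "A.avg Z (?a p) - ?c p = A.avg (\<lambda>p. Z p - ?Y p) (?a p) + A.avg (\<lambda>p. ?V p - ?c p) (?a p)
          + (A.avg ?c (?a p) - ?c p)"
        by (simp add: split[of "?a p"])
      then have "norm (A.avg Z (?a p) - ?c p) \<le> norm (A.avg (\<lambda>p. Z p - ?Y p) (?a p))
          + norm (A.avg (\<lambda>p. ?V p - ?c p) (?a p)) + L * h"
        using 1 norm_triangle_ineq by (smt (verit))
      then show ?case
        using Lh by (simp add: ennreal_leI flip: ennreal_plus)
    qed
  qed
  also have "\<dots> = (\<integral>\<^sup>+p. norm (A.avg (\<lambda>p. Z p - ?Y p) (?a p)) \<partial>P)
      + (\<integral>\<^sup>+p. norm (A.avg (\<lambda>p. ?V p - ?c p) (?a p)) \<partial>P) + ennreal (L * h)"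
    by (simp add: nn_integral_add emeasure_space_1[unfolded space_P])
  also have "\<dots> \<le> (\<integral>\<^sup>+p. norm (Z p - ?Y p) \<partial>P) + (\<integral>\<^sup>+p. norm (?V p - ?c p) \<partial>P) + ennreal (L * h)"
    by (intro add_mono A.nn_integral_norm_avg_le order_refl) (use int in auto)
  finally show ?thesis
    unfolding field_error_def by (simp add: norm_minus_commute)
qed

end

section \<open>Approximate flows\<close>

locale time_grid =
  fixes n :: nat and \<tau> :: real
  assumes n: "0 < n" and \<tau>: "0 < \<tau>" "\<tau> < 1 / real n"
begin

text \<open>For times before the shift the floor is negative and is truncated to 0, so segment 0 covers
  the whole interval up to the second grid point; accordingly the first node is 0.\<close>

definition seg :: "real \<Rightarrow> nat" where
  "seg t = nat \<lfloor>(t - \<tau>) * real n\<rfloor>"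

definition node :: "nat \<Rightarrow> real" where
  "node i = (if i = 0 then 0 else \<tau> + real i / real n)"

text \<open>The length of the part of segment \<open>i\<close> that lies before \<open>t\<close>;
  clipping both ends makes it 0 for later segments.\<close>

definition len :: "real \<Rightarrow> nat \<Rightarrow> real" where
  "len t i = min t (node (Suc i)) - min t (node i)"

lemma measurable_seg[measurable]: "seg \<in> measurable borel (count_space UNIV)"
  unfolding seg_def by measurable

lemma seg_eq_iff:
  assumes "0 \<le> t"
  shows "seg t = i \<longleftrightarrow> node i \<le> t \<and> t < node (Suc i)"
proof (cases i)
  case 0
  have "seg t = 0 \<longleftrightarrow> (t - \<tau>) * real n < 1"
    unfolding seg_def by (simp add: floor_less_iff)
  also have "\<dots> \<longleftrightarrow> t < \<tau> + 1 / real n"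
    using n by (simp add: field_simps)
  finally show ?thesis using 0 assms by (simp add: node_def)
next
  case (Suc j)
  have "seg t = i \<longleftrightarrow> \<lfloor>(t - \<tau>) * real n\<rfloor> = int i"
    unfolding seg_def using Suc by auto
  also have "\<dots> \<longleftrightarrow> real i \<le> (t - \<tau>) * real n \<and> (t - \<tau>) * real n < real i + 1"
    by (simp add: floor_eq_iff)
  also have "\<dots> \<longleftrightarrow> \<tau> + real i / real n \<le> t \<and> t < \<tau> + (real i + 1) / real n"
    using n by (simp add: field_simps)
  finally show ?thesis using Suc by (simp add: node_def add_ac)
qed

text \<open>Strict because \<open>\<tau>\<close> is positive: even at \<open>t = 1\<close> the floor
  stays below \<open>n\<close>.\<close>

lemma seg_less:
  assumes "t \<le> 1" shows "seg t < n"
proof -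
  have "(t - \<tau>) * real n < 1 * real n"
    using n \<tau> assms by (intro mult_strict_right_mono) auto
  then have "\<lfloor>(t - \<tau>) * real n\<rfloor> < int n" by (simp add: floor_less_iff)
  then show ?thesis unfolding seg_def using n by linarith
qed

lemma node_mono: "i \<le> j \<Longrightarrow> node i \<le> node j"
  using \<tau>(1) n by (auto simp: node_def divide_right_mono)

text \<open>The factor 2 is for segment 0, whose length is \<open>\<tau> + 1 / n\<close>; all others
  have length \<open>1 / n\<close>.\<close>

lemma node_Suc_le: "node (Suc i) - node i \<le> 2 / real n"
  using \<tau> n by (auto simp: node_def add_divide_distrib)

lemma len_nonneg: "0 \<le> len t i"
  using node_mono[of i "Suc i"] by (auto simp: len_def)

lemma len_le: "len t i \<le> 2 / real n"
  using node_Suc_le[of i] node_mono[of i "Suc i"] n by (auto simp: len_def min_def)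

lemma len_eq_0: "0 \<le> t \<Longrightarrow> seg t < i \<Longrightarrow> len t i = 0"
  using seg_eq_iff[of t "seg t"] node_mono[of "Suc (seg t)" i] node_mono[of i "Suc i"]
  by (simp add: len_def)

lemma emeasure_seg:
  assumes t: "0 \<le> t"
  shows "emeasure lborel {r \<in> {0..t}. seg r = i} = ennreal (len t i)"
proof -
  have *: "{r \<in> {0..t}. seg r = i} = {0..t} \<inter> {node i..<node (Suc i)}"
    using seg_eq_iff[of _ i] by fastforce
  have 0: "0 \<le> node i" using node_mono[of 0 i] by (simp add: node_def)
  have m: "node i \<le> node (Suc i)" by (rule node_mono) simp
  consider "t < node i" | "node i \<le> t" "t < node (Suc i)" | "node (Suc i) \<le> t" by linarith
  then show ?thesis
  proof cases
    case 1
    then have "{0..t} \<inter> {node i..<node (Suc i)} = {}" by auto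
    then show ?thesis using 1 m unfolding * by (simp add: len_def)
  next
    case 2
    then have "{0..t} \<inter> {node i..<node (Suc i)} = {node i..t}" using 0 by auto
    then show ?thesis using 2 m unfolding * by (simp add: len_def)
  next
    case 3
    then have "{0..t} \<inter> {node i..<node (Suc i)} = {node i..<node (Suc i)}" using 0 by auto
    then show ?thesis using 3 m unfolding * by (simp add: len_def)
  qed
qed

lemma has_integral_seg:
  fixes f :: "nat \<Rightarrow> 'v::euclidean_space"
  assumes t: "t \<in> {0..1}"
  shows "set_integrable lborel {0..t} (\<lambda>r. f (seg r))"
    and "(LINT r:{0..t}|lborel. f (seg r)) = (\<Sum>i<n. len t i *\<^sub>R f i)"
proof -
  let ?S = "\<lambda>i. {r \<in> {0..t}. seg r = i}"
  have eq: "indicator {0..t} r *\<^sub>R f (seg r) = (\<Sum>i<n. indicator (?S i) r *\<^sub>R f i)" for r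
  proof (cases "r \<in> {0..t}")
    case True
    then have "seg r < n" using t by (intro seg_less) auto
    moreover have "(\<Sum>i<n. indicator (?S i) r *\<^sub>R f i) = (\<Sum>i<n. if i = seg r then f i else 0)"
      using True by (intro sum.cong) (auto simp: indicator_def)
    ultimately show ?thesis using True by simp
  next
    case False
    then have "indicator (?S i) r = (0::real)" for i by (auto simp: indicator_def)
    then show ?thesis using False by simp
  qed
  have S[measurable]: "?S i \<in> sets lborel" for i by simp
  have fin: "emeasure lborel (?S i) < \<infinity>" for i
    using t by (subst emeasure_seg) auto
  have int: "integrable lborel (\<lambda>r. indicator (?S i) r *\<^sub>R f i)" for i
    using fin[of i] by (intro integrable_scaleR_left integrable_real_indicator) auto
  show "set_integrable lborel {0..t} (\<lambda>r. f (seg r))"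
    unfolding set_integrable_def eq by (intro Bochner_Integration.integrable_sum int)
  show "(LINT r:{0..t}|lborel. f (seg r)) = (\<Sum>i<n. len t i *\<^sub>R f i)"
    unfolding set_lebesgue_integral_def eq
    by (subst Bochner_Integration.integral_sum[OF int])
       (use t fin emeasure_seg[of t] in \<open>simp add: measure_def len_nonneg\<close>)
qed

lemma nn_integral_seg:
  fixes F :: "nat \<Rightarrow> ennreal"
  shows "(\<integral>\<^sup>+r. F (seg r) * indicator {0..1} r \<partial>lborel) = (\<Sum>i<n. ennreal (len 1 i) * F i)"
proof -
  let ?S = "\<lambda>i. {r \<in> {0..1}. seg r = i}"
  have eq: "F (seg r) * indicator {0..1} r = (\<Sum>i<n. F i * indicator (?S i) r)" for r :: real
  proof (cases "r \<in> {0..1}")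
    case True
    then have "seg r < n" by (intro seg_less) auto
    moreover have "(\<Sum>i<n. F i * indicator (?S i) r) = (\<Sum>i<n. if i = seg r then F i else 0)"
      using True by (intro sum.cong) (auto simp: indicator_def)
    ultimately show ?thesis using True by simp
  next
    case False
    then have "indicator (?S i) r = (0::ennreal)" for i by (auto simp: indicator_def)
    then show ?thesis using False by simp
  qed
  have S[measurable]: "?S i \<in> sets lborel" for i by simp
  show ?thesis
    unfolding eq by (subst nn_integral_sum) (simp_all only: nn_integral_cmult_indicator[OF S] emeasure_seg[OF zero_le_one] mult.commute, measurable)
qed

text \<open>On a segment the path moves with constant velocity, at a node it jumps from one line to
  the next; the displacement is the sum of both. The first sum runs over all \<open>n\<close>
  segments because \<open>len\<close> vanishes beyond \<open>seg t\<close>, which keeps its index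
  set independent of \<open>t\<close>.\<close>

lemma telescope:
  fixes \<omega> :: "nat \<Rightarrow> 'a::euclidean_space \<times> 'a"
  assumes t: "t \<in> {0..1}"
  shows "interp t (\<omega> (seg t)) - interp 0 (\<omega> (seg 0)) =
    (\<Sum>i<n. len t i *\<^sub>R (snd (\<omega> i) - fst (\<omega> i))) +
    (\<Sum>i<seg t. interp (node (Suc i)) (\<omega> (Suc i)) - interp (node (Suc i)) (\<omega> i))"
proof -
  \<comment> \<open>Clipping the nodes at \<open>t\<close> lets the last, incomplete segment be
    treated like the others in one summation by parts.\<close>
  define u where "u i = min t (node i)" for i
  have tele: "(\<Sum>i\<le>k. interp (u (Suc i)) (\<omega> i) - interp (u i) (\<omega> i)) =
      interp (u (Suc k)) (\<omega> k) - interp (u 0) (\<omega> 0)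
      - (\<Sum>i<k. interp (u (Suc i)) (\<omega> (Suc i)) - interp (u (Suc i)) (\<omega> i))" for k
    by (induction k) (simp_all add: algebra_simps)
  have t0: "0 \<le> t" and sn: "seg t < n" using t seg_less by auto
  have seg_t: "node (seg t) \<le> t" "t < node (Suc (seg t))"
    using seg_eq_iff[OF t0, of "seg t"] by auto
  have seg0: "seg 0 = 0" using seg_eq_iff[of 0 0] \<tau> n by (simp add: node_def)
  have u0: "u 0 = 0" using t0 by (simp add: u_def node_def)
  have uS: "u (Suc i) = node (Suc i)" if "i < seg t" for i
    using seg_t(1) node_mono[of "Suc i" "seg t"] that by (simp add: u_def)
  have "(\<Sum>i<n. len t i *\<^sub>R (snd (\<omega> i) - fst (\<omega> i))) = (\<Sum>i\<le>seg t. len t i *\<^sub>R (snd (\<omega> i) - fst (\<omega> i)))"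
    using sn t0 by (intro sum.mono_neutral_right) (auto simp: len_eq_0)
  also have "\<dots> = (\<Sum>i\<le>seg t. interp (u (Suc i)) (\<omega> i) - interp (u i) (\<omega> i))"
    by (simp add: interp_diff u_def len_def)
  also have "\<dots> = interp (u (Suc (seg t))) (\<omega> (seg t)) - interp (u 0) (\<omega> 0)
      - (\<Sum>i<seg t. interp (u (Suc i)) (\<omega> (Suc i)) - interp (u (Suc i)) (\<omega> i))"
    by (rule tele)
  also have "u (Suc (seg t)) = t" using seg_t by (simp add: u_def)
  also have "(\<Sum>i<seg t. interp (u (Suc i)) (\<omega> (Suc i)) - interp (u (Suc i)) (\<omega> i)) =
      (\<Sum>i<seg t. interp (node (Suc i)) (\<omega> (Suc i)) - interp (node (Suc i)) (\<omega> i))"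
    by (intro sum.cong) (auto simp: uS)
  finally show ?thesis by (simp add: u0 seg0)
qed

text \<open>The base point is where the label of a segment is evaluated. For segment 0 it is
  \<open>\<tau>\<close> and not the node 0, so it may lie after \<open>r\<close>;
  \<open>\<tau> < 1 / n\<close> keeps the bound the same.\<close>

lemma dist_base_point:
  assumes "r \<in> {0..1}"
  shows "\<bar>r - (\<tau> + real (seg r) / real n)\<bar> \<le> 1 / real n"
proof -
  have "node (seg r) \<le> r" "r < node (Suc (seg r))"
    using seg_eq_iff[of r "seg r"] assms by auto
  then show ?thesis
    using \<tau> n assms by (cases "seg r = 0") (auto simp: node_def add_divide_distrib abs_le_iff)
qed

lemma base_point_bounds:
  assumes "i < n" shows "\<tau> + real i / real n \<in> {0..1}"
proof -
  have "real i + 1 \<le> real n" using assms by linarith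
  then have "real i / real n + 1 / real n \<le> 1"
    using n by (simp add: field_simps)
  then show ?thesis using \<tau> by simp
qed

end

lemma set_integrable_bounded_interval:
  fixes f :: "real \<Rightarrow> 'v::euclidean_space"
  assumes [measurable]: "f \<in> borel_measurable borel" and B: "\<And>r. norm (f r) \<le> B"
  shows "set_integrable lborel {a..b} f"
  unfolding set_integrable_def
proof (rule integrableI_bounded_set_indicator[where B=B])
  show "emeasure lborel {a..b} < \<infinity>" by (cases "a \<le> b") auto
qed (use B in auto)

section \<open>Construction of the approximate flow\<close>

context rectified_flow begin

text \<open>The displacement minus the drift of \<open>c\<close> splits into jumps at the nodes,
  controlled by the cell size; centered noise \<open>D\<close>, controlled in L2 by orthogonality;
  and the error of the mean velocity against \<open>c\<close>, controlled by
  \<open>drift_error\<close> at the base points. The Lipschitz constant of \<open>c\<close> covers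
  its oscillation over a cell and over a time step.\<close>

lemma approximate_flow_exists:
  fixes c :: "real \<times> 'a \<Rightarrow> 'a"
  assumes c: "L-lipschitz_on UNIV c" and bc: "\<And>x. norm (c x) \<le> Bc" and \<epsilon>: "0 < \<epsilon>"
  obtains M :: "(nat \<Rightarrow> 'a \<times> 'a) measure" and \<gamma>
  where "prob_space M"
    and "(\<lambda>x. \<gamma> (fst x) (snd x)) \<in> borel_measurable (borel \<Otimes>\<^sub>M M)"
    and "\<And>t. t \<in> {0..1} \<Longrightarrow> distr M borel (\<gamma> t) = distr P borel (interp t)"
    and "\<And>t. t \<in> {0..1} \<Longrightarrow>
      (\<integral>\<^sup>+\<omega>. norm (\<gamma> t \<omega> - \<gamma> 0 \<omega> - (LINT r:{0..t}|lborel. c (r, \<gamma> r \<omega>))) \<partial>M)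
      \<le> 2 * (\<integral>\<^sup>+r. field_error c r * indicator {0..1} r \<partial>lborel) + ennreal \<epsilon>"
proof -
  \<comment> \<open>Budget: one \<open>e\<close> for the jumps, one for the noise, six for the mean
    velocity.\<close>
  define e where "e = \<epsilon> / 8"
  have e: "0 < e" using \<epsilon> by (simp add: e_def)
  let ?Y = "\<lambda>p::'a \<times> 'a. snd p - fst p"
  define EY where "EY = (\<integral>p. norm (?Y p) \<partial>P)"
  have EY0: "0 \<le> EY" by (simp add: EY_def)
  have L0: "0 \<le> L" using c by (rule lipschitz_on_nonneg)
  obtain Z B where Z[measurable]: "Z \<in> borel_measurable P" and B: "\<And>p. norm (Z p) \<le> B" "0 \<le> B"
    and YZ: "(\<integral>\<^sup>+p. norm (?Y p - Z p) \<partial>P) \<le> ennreal e"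
    using truncation_exists[OF integrable_velocity e] by blast
  have iZ: "integrable P Z" by (rule integrable_const_bound[where B=B]) (auto simp: B)
  \<comment> \<open>\<open>16 * B^2 / n\<close> bounds the second moment of the noise,
    \<open>n\<close> terms of size at most \<open>(2/n)^2 * (2 B)^2\<close>;
    \<open>L * (1 + EY) / n\<close> bounds the mean variation of \<open>c\<close> along a line
    during one time step.\<close>
  obtain n where n: "max 1 (max (16 * B\<^sup>2 / e\<^sup>2) (L * (1 + EY) / e)) \<le> real n"
    using real_arch_simple by blast
  then have n0: "0 < n" and n1: "16 * B\<^sup>2 / real n \<le> e\<^sup>2" and n2: "L * (1 + EY) / real n \<le> e"
    using e by (auto simp: field_simps)
  \<comment> \<open>At most \<open>n\<close> jumps of size \<open>h\<close> must add up to at most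
    \<open>e\<close>, and \<open>L * h\<close> must be at most \<open>e\<close>; the
    \<open>1 +\<close> avoids dividing by \<open>L = 0\<close>.\<close>
  define h where "h = e / (real n * (1 + L))"
  have h: "0 < h" using e n0 L0 by (simp add: h_def)
  have nh: "real n * h \<le> e" and Lh: "L * h \<le> e"
  proof -
    have "real n * h = e / (1 + L)" using n0 by (simp add: h_def)
    also have "\<dots> \<le> e" using L0 e by (simp add: field_simps)
    finally show nh: "real n * h \<le> e" .
    have "L * h \<le> (1 + L) * (real n * h)"
    proof (rule mult_mono)
      have "1 * h \<le> real n * h" using n0 h by (intro mult_right_mono) auto
      then show "h \<le> real n * h" by simp
    qed (use L0 h in auto)
    also have "\<dots> = e" using n0 L0 by (simp add: h_def)
    finally show "L * h \<le> e" .
  qed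
  obtain cell :: "'a \<Rightarrow> nat" where cell: "cell \<in> measurable borel (count_space UNIV)"
    and near: "\<And>x y. cell x = cell y \<Longrightarrow> dist x y \<le> h"
    using countable_cells_exist[OF h] by blast
  have cm[measurable]: "c \<in> borel_measurable borel"
    by (intro borel_measurable_continuous_onI lipschitz_on_continuous_on[OF c])
  define I where "I = (\<integral>\<^sup>+r. field_error c r * indicator {0..1} r \<partial>lborel)"
  obtain \<tau> where \<tau>: "0 < \<tau>" "\<tau> < 1 / real n"
    and shift: "(\<Sum>i<n. field_error c (\<tau> + real i / real n)) \<le> of_nat n * (I + ennreal e)"
    unfolding I_def by (rule good_shift_exists[OF measurable_field_error[OF cm] n0 e])
  interpret time_grid n \<tau> using n0 \<tau> by unfold_locales
  define s where "s i = \<tau> + real i / real n" for i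
  define a where "a i p = cell (interp (s i) p)" for i p
  have a[measurable]: "a i \<in> measurable P (count_space UNIV)" for i
    unfolding a_def by (rule measurable_compose[OF _ cell]) measurable
  have A: "labelled P (a i)" for i by unfold_locales measurable
  define z where "z i p = labelled.avg P (a i) Z (a i p)" for i p
  have z[measurable]: "z i \<in> borel_measurable P" for i
    unfolding z_def by (rule labelled.measurable_avg[OF A])
  \<comment> \<open>The noise: truncated velocity minus its average over the cell at the base point.
    The average \<open>z i\<close> is what should be close to \<open>c\<close>.\<close>
  define D where "D i p = Z p - z i p" for i p
  have D[measurable]: "D i \<in> borel_measurable P" for i unfolding D_def by measurable
  have bD: "norm (D i p) \<le> 2 * B" for i p
    using norm_triangle_ineq4[of "Z p" "z i p"] B(1)[of p]
      labelled.norm_avg_le[OF A iZ B(1) B(2), of i "a i p"]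
    by (simp add: D_def z_def)
  have D0: "(\<integral>p. indicator {q} (a i p) *\<^sub>R D i p \<partial>P) = 0" for i q
    unfolding D_def z_def by (rule labelled.integral_label_minus_avg[OF A iZ])
  from chain_exists[where P=P and a=a and D=D and B="2 * B" and k=n, OF prob_space_axioms a D bD D0]
  obtain M where M: "prob_space M" and sM[measurable_cong]: "sets M = sets (PiM UNIV (\<lambda>_::nat. P))"
    and marg': "\<forall>i\<le>n. distr M P (\<lambda>\<omega>. \<omega> i) = P"
    and agree': "\<forall>i<n. AE \<omega> in M. a (Suc i) (\<omega> i) = a (Suc i) (\<omega> (Suc i))"
    and L2': "\<forall>w. (\<integral>\<omega>. (norm (\<Sum>i\<le>n. w i *\<^sub>R D i (\<omega> i)))\<^sup>2 \<partial>M) \<le> (\<Sum>i\<le>n. (w i)\<^sup>2 * (2 * B)\<^sup>2)"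
    by (elim exE conjE)
  note marg = marg'[rule_format] and agree = agree'[rule_format] and L2 = L2'[rule_format]
  interpret M: prob_space M by fact
  have at_seg: "(\<lambda>x. g (seg (fst x)) (fst x, snd x (seg (fst x)))) \<in> borel_measurable (borel \<Otimes>\<^sub>M M)"
    if [measurable]: "\<And>i. g i \<in> borel_measurable (borel \<Otimes>\<^sub>M P)"
    for g :: "nat \<Rightarrow> real \<times> 'a \<times> 'a \<Rightarrow> 'a"
    by (rule measurable_compose_countable[of "\<lambda>i x. g i (fst x, snd x i)"]) measurable
  \<comment> \<open>A piecewise affine path with jumps at the nodes. At a fixed time it reads one
    coordinate, whose law is \<open>P\<close>, which gives the exact marginals.\<close>
  define \<gamma> where "\<gamma> t \<omega> = interp t (\<omega> (seg t))" for t and \<omega> :: "nat \<Rightarrow> 'a \<times> 'a"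
  have \<gamma>[measurable]: "(\<lambda>x. \<gamma> (fst x) (snd x)) \<in> borel_measurable (borel \<Otimes>\<^sub>M M)"
    using at_seg[of "\<lambda>i x. interp (fst x) (snd x)"] by (simp add: \<gamma>_def)
  have law: "distr M borel (\<gamma> t) = distr P borel (interp t)" if "t \<in> {0..1}" for t
  proof -
    have "distr M borel (\<gamma> t) = distr (distr M P (\<lambda>\<omega>. \<omega> (seg t))) borel (interp t)"
      unfolding \<gamma>_def by (subst distr_distr) (auto simp: comp_def)
    then show ?thesis using marg[of "seg t"] seg_less[of t] that by simp
  qed
  \<comment> \<open>Velocity minus noise minus \<open>c\<close>: since \<open>D\<close> is
    \<open>Z - z\<close>, this is the truncation error plus the mean velocity minus
    \<open>c\<close>.\<close>
  define g where "g i x = ?Y (snd x) - D i (snd x) - c (fst x, interp (fst x) (snd x))" for i x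
  have cint[measurable]: "(\<lambda>x. c (fst x, interp (fst x) (snd x))) \<in> borel_measurable (borel \<Otimes>\<^sub>M P)"
    by (rule measurable_compose[OF _ cm]) measurable
  have Ym[measurable]: "?Y \<in> borel_measurable P"
    using integrable_velocity by auto
  have g[measurable]: "g i \<in> borel_measurable (borel \<Otimes>\<^sub>M P)" for i
    unfolding g_def by measurable
  define err where "err r \<omega> = g (seg r) (r, \<omega> (seg r))" for r \<omega>
  have err[measurable]: "(\<lambda>x. err (fst x) (snd x)) \<in> borel_measurable (borel \<Otimes>\<^sub>M M)"
    unfolding err_def by (rule at_seg) measurable
  \<comment> \<open>The four \<open>e\<close> are the truncation error, once directly and once
    inside \<open>drift_error\<close>, the oscillation over a cell, and the move from the base point
    \<open>s i\<close> to \<open>r\<close>.\<close>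
  have seg_err: "(\<integral>\<^sup>+p. norm (g i (r, p)) \<partial>P) \<le> ennreal (4 * e) + field_error c (s i)"
    if r: "r \<in> {0..1}" and i: "i = seg r" for r i
  proof -
    have si: "s i \<in> {0..1}" unfolding s_def i using r by (intro base_point_bounds seg_less) auto
    have rs: "\<bar>r - s i\<bar> \<le> 1 / real n" unfolding s_def i by (rule dist_base_point[OF r])
    have [measurable]: "(\<lambda>p. c (s i, interp (s i) p)) \<in> borel_measurable P"
      by (rule measurable_compose[OF _ cm]) measurable
    have osc: "norm (c (s i, interp (s i) p) - c (r, interp r p)) \<le> L / n * (1 + norm (?Y p))" for p
    proof -
      have "norm (c (s i, interp (s i) p) - c (r, interp r p))
          \<le> L * dist (s i, interp (s i) p) (r, interp r p)"
        unfolding dist_norm[symmetric] by (rule lipschitz_onD[OF c UNIV_I UNIV_I])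
      also have "dist (s i, interp (s i) p) (r, interp r p) \<le> \<bar>s i - r\<bar> + norm (interp (s i) p - interp r p)"
        using norm_Pair_le[of "s i - r" "interp (s i) p - interp r p"]
        by (simp add: dist_norm)
      also have "\<dots> = \<bar>s i - r\<bar> * (1 + norm (?Y p))"
        by (simp only: interp_diff norm_scaleR distrib_left mult_1_right)
      also have "\<dots> \<le> 1 / n * (1 + norm (?Y p))"
        using rs by (intro mult_right_mono) (auto simp: abs_minus_commute add_nonneg_nonneg)
      finally show ?thesis using L0 by (simp add: mult_left_mono)
    qed
    have "(\<integral>\<^sup>+p. norm (g i (r, p)) \<partial>P) \<le>
        (\<integral>\<^sup>+p. ennreal (norm (?Y p - Z p)) + ennreal (norm (z i p - c (s i, interp (s i) p)))
          + ennreal (L / n * (1 + norm (?Y p))) \<partial>P)"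
    proof (rule nn_integral_mono)
      fix p
      have "g i (r, p) = (?Y p - Z p) + (z i p - c (s i, interp (s i) p))
          + (c (s i, interp (s i) p) - c (r, interp r p))"
        by (simp add: g_def D_def)
      then have "norm (g i (r, p)) \<le> norm (?Y p - Z p) + norm (z i p - c (s i, interp (s i) p))
          + norm (c (s i, interp (s i) p) - c (r, interp r p))"
        by (simp only:) (intro norm_triangle_le add_mono norm_triangle_ineq order_refl)
      then have "norm (g i (r, p)) \<le> norm (?Y p - Z p) + norm (z i p - c (s i, interp (s i) p))
          + L / n * (1 + norm (?Y p))"
        using osc[of p] by linarith
      then show "ennreal (norm (g i (r, p))) \<le> ennreal (norm (?Y p - Z p))
          + ennreal (norm (z i p - c (s i, interp (s i) p))) + ennreal (L / n * (1 + norm (?Y p)))"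
        using L0 by (simp add: ennreal_leI flip: ennreal_plus)
    qed
    also have "\<dots> = (\<integral>\<^sup>+p. norm (?Y p - Z p) \<partial>P) + (\<integral>\<^sup>+p. norm (z i p - c (s i, interp (s i) p)) \<partial>P)
        + (\<integral>\<^sup>+p. ennreal (L / n * (1 + norm (?Y p))) \<partial>P)"
      by (simp add: nn_integral_add)
    also have "(\<integral>\<^sup>+p. ennreal (L / n * (1 + norm (?Y p))) \<partial>P) = ennreal (L / n * (1 + EY))"
      using integrable_velocity L0 unfolding EY_def
      by (subst nn_integral_eq_integral) (auto simp: prob_space[unfolded space_P])
    also have "L / n * (1 + EY) \<le> e" using n2 by simp
    also have "(\<integral>\<^sup>+p. norm (z i p - c (s i, interp (s i) p)) \<partial>P) \<le>
        (\<integral>\<^sup>+p. norm (?Y p - Z p) \<partial>P) + field_error c (s i) + ennreal (L * h)"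
      unfolding z_def a_def by (rule drift_error[OF si cell near c bc Z B(1)])
    also have "(\<integral>\<^sup>+p. norm (?Y p - Z p) \<partial>P) \<le> ennreal e" by (rule YZ)
    also have "ennreal e + (ennreal e + field_error c (s i) + ennreal (L * h)) + ennreal e
        \<le> ennreal e + (ennreal e + field_error c (s i) + ennreal e) + ennreal e"
      using Lh by (intro add_mono order_refl ennreal_leI)
    also have "\<dots> = ennreal (4 * e) + field_error c (s i)"
    proof -
      have "ennreal (4 * e) = ennreal e + ennreal e + ennreal e + ennreal e"
        using e by (simp flip: ennreal_plus)
      then show ?thesis by (simp add: ac_simps)
    qed
    finally show ?thesis by (simp add: add_mono ennreal_leI)
  qed
  \<comment> \<open>The factor 2 on \<open>I\<close> comes from \<open>len 1 i \<le> 2 / n\<close>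
    against the shifted Riemann sum; it also doubles the slack \<open>e\<close> of the chosen shift,
    so that \<open>4 * e\<close> becomes \<open>6 * e\<close>.\<close>
  have err_total: "(\<integral>\<^sup>+\<omega>. (\<integral>\<^sup>+r. norm (err r \<omega>) * indicator {0..1} r \<partial>lborel) \<partial>M) \<le> 2 * I + ennreal (6 * e)"
  proof -
    have "(\<integral>\<^sup>+\<omega>. (\<integral>\<^sup>+r. norm (err r \<omega>) * indicator {0..1} r \<partial>lborel) \<partial>M) =
        (\<integral>\<^sup>+r. (\<integral>\<^sup>+\<omega>. ennreal (norm (err r \<omega>)) * indicator {0..1} r \<partial>M) \<partial>lborel)"
    proof -
      interpret LM: pair_sigma_finite lborel M by unfold_locales
      have [measurable]: "(\<lambda>x. err (fst x) (snd x)) \<in> borel_measurable (lborel \<Otimes>\<^sub>M M)"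
        using err by simp
      show ?thesis
        by (simp add: ennreal_mult'' ennreal_indicator) (rule LM.Fubini', measurable)
    qed
    also have "\<dots> \<le> (\<integral>\<^sup>+r. (ennreal (4 * e) + field_error c (s (seg r))) * indicator {0..1} r \<partial>lborel)"
    proof (rule nn_integral_mono)
      fix r :: real
      show "(\<integral>\<^sup>+\<omega>. ennreal (norm (err r \<omega>)) * indicator {0..1} r \<partial>M)
          \<le> (ennreal (4 * e) + field_error c (s (seg r))) * indicator {0..1} r"
      proof (cases "r \<in> {0..1}")
        case True
        have "(\<integral>\<^sup>+\<omega>. ennreal (norm (err r \<omega>)) \<partial>M) =
            (\<integral>\<^sup>+p. ennreal (norm (g (seg r) (r, p))) \<partial>distr M P (\<lambda>\<omega>. \<omega> (seg r)))"
          unfolding err_def by (subst nn_integral_distr) auto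
        also have "\<dots> = (\<integral>\<^sup>+p. ennreal (norm (g (seg r) (r, p))) \<partial>P)"
          using marg[of "seg r"] seg_less[of r] True by simp
        also have "\<dots> \<le> ennreal (4 * e) + field_error c (s (seg r))"
          by (rule seg_err[OF True refl])
        finally show ?thesis using True by simp
      qed simp
    qed
    also have "\<dots> = (\<Sum>i<n. ennreal (len 1 i) * (ennreal (4 * e) + field_error c (s i)))"
      by (rule nn_integral_seg)
    also have "\<dots> = (\<Sum>i<n. ennreal (len 1 i) * ennreal (4 * e)) + (\<Sum>i<n. ennreal (len 1 i) * field_error c (s i))"
      by (simp add: distrib_left sum.distrib)
    also have "(\<Sum>i<n. ennreal (len 1 i) * ennreal (4 * e)) = ennreal (4 * e)"
      using e by (subst nn_integral_seg[symmetric, of "\<lambda>_. ennreal (4 * e)"]) (simp add: nn_integral_cmult)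
    also have "(\<Sum>i<n. ennreal (len 1 i) * field_error c (s i))
        \<le> (\<Sum>i<n. ennreal (2 / n) * field_error c (s i))"
      by (intro sum_mono mult_right_mono ennreal_leI len_le) auto
    also have "\<dots> = ennreal (2 / n) * (\<Sum>i<n. field_error c (s i))"
      by (simp add: sum_distrib_left)
    also have "\<dots> \<le> ennreal (2 / n) * (of_nat n * (I + ennreal e))"
      using shift by (intro mult_left_mono) (auto simp: s_def)
    also have "\<dots> = (ennreal (2 / n) * of_nat n) * (I + ennreal e)" by (simp add: mult.assoc)
    also have "ennreal (2 / n) * of_nat n = 2"
      using n0 by (simp add: ennreal_of_nat_eq_real_of_nat flip: ennreal_mult)
    also have "ennreal (4 * e) + 2 * (I + ennreal e) = 2 * I + ennreal (6 * e)"
    proof -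
      have "ennreal (6 * e) = ennreal (4 * e) + 2 * ennreal e"
        using e by (simp add: ennreal_mult[symmetric] flip: ennreal_plus ennreal_numeral)
      then show ?thesis by (simp add: distrib_left ac_simps)
    qed
    finally show ?thesis by (simp add: add_mono)
  qed
  have noise: "(\<integral>\<^sup>+\<omega>. norm (\<Sum>i<n. len t i *\<^sub>R D i (\<omega> i)) \<partial>M) \<le> ennreal e" if t: "t \<in> {0..1}" for t
  proof -
    define N where "N \<omega> = (\<Sum>i<n. len t i *\<^sub>R D i (\<omega> i))" for \<omega> :: "nat \<Rightarrow> 'a \<times> 'a"
    have [measurable]: "N \<in> borel_measurable M" unfolding N_def by measurable
    have bN: "norm (N \<omega>) \<le> (\<Sum>i<n. len t i * (2 * B))" for \<omega>
      unfolding N_def by (intro sum_norm_le) (auto intro!: mult_mono bD simp: len_nonneg)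
    have iN2: "integrable M (\<lambda>\<omega>. (norm (N \<omega>))\<^sup>2)"
      by (rule M.integrable_const_bound[where B="(\<Sum>i<n. len t i * (2 * B))\<^sup>2"])
         (auto intro!: AE_I2 power_mono bN)
    have "(\<integral>\<omega>. (norm (N \<omega>))\<^sup>2 \<partial>M) \<le> e\<^sup>2"
    proof -
      \<comment> \<open>The chain has one coordinate more than there are segments; its weight is set
        to 0.\<close>
      have "N \<omega> = (\<Sum>i\<le>n. (if i < n then len t i else 0) *\<^sub>R D i (\<omega> i))" for \<omega>
        unfolding N_def lessThan_Suc_atMost[symmetric] by simp
      then have "(\<integral>\<omega>. (norm (N \<omega>))\<^sup>2 \<partial>M) \<le> (\<Sum>i\<le>n. (if i < n then len t i else 0)\<^sup>2 * (2 * B)\<^sup>2)"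
        using L2[of "\<lambda>i. if i < n then len t i else 0"] by simp
      also have "\<dots> = (\<Sum>i<n. (len t i)\<^sup>2 * (2 * B)\<^sup>2)"
        unfolding lessThan_Suc_atMost[symmetric] by simp
      also have "\<dots> \<le> (\<Sum>i<n. (2 / n)\<^sup>2 * (2 * B)\<^sup>2)"
        by (intro sum_mono mult_right_mono power_mono len_le len_nonneg) auto
      also have "\<dots> = 16 * B\<^sup>2 / n" using n0 by (simp add: field_simps power2_eq_square)
      finally show ?thesis using n1 by simp
    qed
    have "(\<integral>\<^sup>+\<omega>. norm (N \<omega>) \<partial>M) \<le> (\<integral>\<^sup>+\<omega>. ennreal (e / 2 + (norm (N \<omega>))\<^sup>2 / (2 * e)) \<partial>M)"
    proof (intro nn_integral_mono ennreal_leI)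
      fix \<omega>
      \<comment> \<open>The inequality \<open>x \<le> e/2 + x^2/(2 e)\<close> turns the second
        moment bound \<open>e^2\<close> into the first moment bound \<open>e\<close>.\<close>
      have "0 \<le> (norm (N \<omega>) - e)\<^sup>2" by simp
      then show "norm (N \<omega>) \<le> e / 2 + (norm (N \<omega>))\<^sup>2 / (2 * e)"
        using e by (simp add: field_simps power2_eq_square)
    qed
    also have "\<dots> = ennreal (\<integral>\<omega>. e / 2 + (norm (N \<omega>))\<^sup>2 / (2 * e) \<partial>M)"
      using iN2 e by (intro nn_integral_eq_integral) auto
    also have "(\<integral>\<omega>. e / 2 + (norm (N \<omega>))\<^sup>2 / (2 * e) \<partial>M) = e / 2 + (\<integral>\<omega>. (norm (N \<omega>))\<^sup>2 \<partial>M) / (2 * e)"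
      using iN2 by (simp add: M.prob_space)
    also have "\<dots> \<le> e / 2 + e\<^sup>2 / (2 * e)"
      using \<open>(\<integral>\<omega>. (norm (N \<omega>))\<^sup>2 \<partial>M) \<le> e\<^sup>2\<close> e by (intro add_mono divide_right_mono) auto
    also have "\<dots> = e" using e by (simp add: power2_eq_square)
    finally show ?thesis unfolding N_def by (simp add: ennreal_leI)
  qed
  \<comment> \<open>One null set serves all times: only the finitely many label agreements are
    almost sure, the rest holds for each path.\<close>
  have decomp: "AE \<omega> in M. \<forall>t\<in>{0..1}.
      ennreal (norm (\<gamma> t \<omega> - \<gamma> 0 \<omega> - (LINT r:{0..t}|lborel. c (r, \<gamma> r \<omega>))))
      \<le> ennreal e + ennreal (norm (\<Sum>i<n. len t i *\<^sub>R D i (\<omega> i)))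
        + (\<integral>\<^sup>+r. norm (err r \<omega>) * indicator {0..1} r \<partial>lborel)"
  proof -
    have "AE \<omega> in M. \<forall>i\<in>{..<n}. a (Suc i) (\<omega> i) = a (Suc i) (\<omega> (Suc i))"
      by (intro AE_finite_allI) (auto intro: agree)
    then show ?thesis using AE_space
    proof eventually_elim
      case (elim \<omega>)
      then have sp: "\<omega> \<in> space M"
        and ag: "\<And>i. i < n \<Longrightarrow> a (Suc i) (\<omega> i) = a (Suc i) (\<omega> (Suc i))"
        by auto
      show ?case
      proof
        fix t :: real assume t: "t \<in> {0..1}"
        let ?J = "\<Sum>i<seg t. interp (node (Suc i)) (\<omega> (Suc i)) - interp (node (Suc i)) (\<omega> i)"
        let ?D = "\<Sum>i<n. len t i *\<^sub>R D i (\<omega> i)"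
        have sn: "seg t < n" using t seg_less by auto
        \<comment> \<open>Consecutive lines share a cell at their common node, which for index
          \<open>Suc i\<close> coincides with the base point \<open>s (Suc i)\<close>.\<close>
        have "norm ?J \<le> (\<Sum>i<seg t. h)"
        proof (rule sum_norm_le)
          fix i assume "i \<in> {..<seg t}"
          then have "a (Suc i) (\<omega> i) = a (Suc i) (\<omega> (Suc i))" using sn by (intro ag) auto
          then have "dist (interp (s (Suc i)) (\<omega> (Suc i))) (interp (s (Suc i)) (\<omega> i)) \<le> h"
            unfolding a_def by (intro near) simp
          then show "norm (interp (node (Suc i)) (\<omega> (Suc i)) - interp (node (Suc i)) (\<omega> i)) \<le> h"
            by (simp add: dist_norm node_def s_def)
        qed
        also have "\<dots> \<le> real n * h" using sn h by (simp add: mult_right_mono)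
        finally have J: "norm ?J \<le> e" using nh by simp
        have [measurable]: "(\<lambda>r. \<gamma> r \<omega>) \<in> borel_measurable borel"
          using measurable_compose[OF measurable_Pair2'[OF sp] \<gamma>] by simp
        have [measurable]: "(\<lambda>r. c (r, \<gamma> r \<omega>)) \<in> borel_measurable borel"
          by (rule measurable_compose[OF _ cm]) measurable
        have i1: "set_integrable lborel {0..t} (\<lambda>r. c (r, \<gamma> r \<omega>))"
          by (rule set_integrable_bounded_interval[where B=Bc]) (auto simp: bc)
        note i2 = has_integral_seg(1)[OF t, of "\<lambda>i. ?Y (\<omega> i) - D i (\<omega> i)"]
        have "(LINT r:{0..t}|lborel. err r \<omega>) =
            (LINT r:{0..t}|lborel. (?Y (\<omega> (seg r)) - D (seg r) (\<omega> (seg r))) - c (r, \<gamma> r \<omega>))"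
          by (simp add: err_def g_def \<gamma>_def)
        also have "\<dots> = (\<Sum>i<n. len t i *\<^sub>R (?Y (\<omega> i) - D i (\<omega> i))) - (LINT r:{0..t}|lborel. c (r, \<gamma> r \<omega>))"
          by (subst set_integral_diff(2)[OF i2 i1]) (simp only: has_integral_seg(2)[OF t, of "\<lambda>i. ?Y (\<omega> i) - D i (\<omega> i)"])
        also have "(\<Sum>i<n. len t i *\<^sub>R (?Y (\<omega> i) - D i (\<omega> i))) = \<gamma> t \<omega> - \<gamma> 0 \<omega> - ?J - ?D"
          using telescope[OF t, of \<omega>] by (simp add: \<gamma>_def scaleR_diff_right sum_subtractf)
        finally have "\<gamma> t \<omega> - \<gamma> 0 \<omega> - (LINT r:{0..t}|lborel. c (r, \<gamma> r \<omega>)) =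
            ?J + ?D + (LINT r:{0..t}|lborel. err r \<omega>)"
          by (simp add: algebra_simps)
        then have 1: "norm (\<gamma> t \<omega> - \<gamma> 0 \<omega> - (LINT r:{0..t}|lborel. c (r, \<gamma> r \<omega>))) \<le>
            e + norm ?D + norm (LINT r:{0..t}|lborel. err r \<omega>)"
          using J by (simp add: norm_triangle_le)
        have i3: "set_integrable lborel {0..t} (\<lambda>r. err r \<omega>)"
          using set_integral_diff(1)[OF i2 i1] by (simp add: err_def g_def \<gamma>_def)
        have "ennreal (norm (LINT r:{0..t}|lborel. err r \<omega>))
            \<le> (\<integral>\<^sup>+r. norm (indicator {0..t} r *\<^sub>R err r \<omega>) \<partial>lborel)"
          using i3 unfolding set_integrable_def set_lebesgue_integral_def by (rule integral_norm_bound_ennreal)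
        also have "\<dots> \<le> (\<integral>\<^sup>+r. norm (err r \<omega>) * indicator {0..1} r \<partial>lborel)"
          using t by (intro nn_integral_mono) (auto simp: indicator_def)
        finally have 2: "ennreal (norm (LINT r:{0..t}|lborel. err r \<omega>))
            \<le> (\<integral>\<^sup>+r. norm (err r \<omega>) * indicator {0..1} r \<partial>lborel)" .
        have "ennreal (norm (\<gamma> t \<omega> - \<gamma> 0 \<omega> - (LINT r:{0..t}|lborel. c (r, \<gamma> r \<omega>)))) \<le>
            ennreal e + ennreal (norm ?D) + ennreal (norm (LINT r:{0..t}|lborel. err r \<omega>))"
          using 1 e by (simp add: ennreal_leI flip: ennreal_plus)
        then show "ennreal (norm (\<gamma> t \<omega> - \<gamma> 0 \<omega> - (LINT r:{0..t}|lborel. c (r, \<gamma> r \<omega>))))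
            \<le> ennreal e + ennreal (norm ?D) + (\<integral>\<^sup>+r. norm (err r \<omega>) * indicator {0..1} r \<partial>lborel)"
          using 2 by (rule order_trans[OF _ add_left_mono])
      qed
    qed
  qed
  have "(\<integral>\<^sup>+\<omega>. norm (\<gamma> t \<omega> - \<gamma> 0 \<omega> - (LINT r:{0..t}|lborel. c (r, \<gamma> r \<omega>))) \<partial>M) \<le> 2 * I + ennreal \<epsilon>"
    if t: "t \<in> {0..1}" for t
  proof -
    have [measurable]: "(\<lambda>x. err (fst x) (snd x)) \<in> borel_measurable (lborel \<Otimes>\<^sub>M M)"
      using err by simp
    have [measurable]: "(\<lambda>x. err (snd x) (fst x)) \<in> borel_measurable (M \<Otimes>\<^sub>M lborel)"
      using measurable_compose[OF measurable_pair_swap' \<open>(\<lambda>x. err (fst x) (snd x)) \<in> borel_measurable (lborel \<Otimes>\<^sub>M M)\<close>]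
      by (simp add: case_prod_beta)
    have "(\<integral>\<^sup>+\<omega>. norm (\<gamma> t \<omega> - \<gamma> 0 \<omega> - (LINT r:{0..t}|lborel. c (r, \<gamma> r \<omega>))) \<partial>M) \<le>
        (\<integral>\<^sup>+\<omega>. ennreal e + ennreal (norm (\<Sum>i<n. len t i *\<^sub>R D i (\<omega> i)))
        + (\<integral>\<^sup>+r. norm (err r \<omega>) * indicator {0..1} r \<partial>lborel) \<partial>M)"
      using decomp t by (intro nn_integral_mono_AE) (auto elim!: eventually_mono)
    also have "\<dots> = ennreal e + (\<integral>\<^sup>+\<omega>. norm (\<Sum>i<n. len t i *\<^sub>R D i (\<omega> i)) \<partial>M)
        + (\<integral>\<^sup>+\<omega>. (\<integral>\<^sup>+r. norm (err r \<omega>) * indicator {0..1} r \<partial>lborel) \<partial>M)"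
      by (simp add: nn_integral_add M.emeasure_space_1)
    also have "\<dots> \<le> ennreal e + ennreal e + (2 * I + ennreal (6 * e))"
      by (intro add_mono order_refl noise[OF t] err_total)
    also have "\<dots> = 2 * I + ennreal \<epsilon>"
    proof -
      have "ennreal \<epsilon> = ennreal e + ennreal e + ennreal (6 * e)"
        using e by (simp add: e_def flip: ennreal_plus)
      then show ?thesis by (simp add: ac_simps)
    qed
    finally show ?thesis .
  qed
  with M \<gamma> law show thesis unfolding I_def by (rule that)
qed

end

section \<open>Lipschitz approximation of the velocity field\<close>

lemma Lipschitz_bump_tendsto_indicator:
  fixes K :: "'b::metric_space set"
  assumes "closed K" "K \<noteq> {}"
  shows "(\<lambda>k::nat. max 0 (1 - real k * infdist x K)) \<longlonglongrightarrow> indicator K x"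
proof (cases "x \<in> K")
  case False
  then have pos: "infdist x K > 0"
    using assms infdist_nonneg[of x K] in_closed_iff_infdist_zero[of K x] by auto
  obtain k0 :: nat where k0: "1 / infdist x K \<le> real k0" using real_arch_simple by blast
  have "\<forall>\<^sub>F k in sequentially. max 0 (1 - real k * infdist x K) = indicator K x"
    using eventually_ge_at_top[of k0]
  proof eventually_elim
    case (elim k)
    then have "1 / infdist x K \<le> real k" using k0 by linarith
    then have "1 \<le> real k * infdist x K" using pos by (simp add: field_simps)
    then show ?case using False by simp
  qed
  then show ?thesis by (rule tendsto_eventually)
qed simp

lemma Lipschitz_bump:
  fixes K :: "'b::metric_space set" and w :: "'v::real_normed_vector"
  shows "(real k * norm w)-lipschitz_on UNIV (\<lambda>x. max 0 (1 - real k * infdist x K) *\<^sub>R w)"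
proof (rule lipschitz_onI)
  fix x y :: 'b
  have "\<bar>max 0 (1 - real k * infdist x K) - max 0 (1 - real k * infdist y K)\<bar>
      \<le> \<bar>real k * infdist x K - real k * infdist y K\<bar>" by linarith
  also have "\<dots> = real k * \<bar>infdist x K - infdist y K\<bar>"
    by (simp add: abs_mult flip: right_diff_distrib)
  also have "\<dots> \<le> real k * dist x y"
    by (intro mult_left_mono infdist_triangle_abs) auto
  finally have "\<bar>max 0 (1 - real k * infdist x K) - max 0 (1 - real k * infdist y K)\<bar> * norm w
      \<le> (real k * dist x y) * norm w" by (rule mult_right_mono) simp
  then show "dist (max 0 (1 - real k * infdist x K) *\<^sub>R w) (max 0 (1 - real k * infdist y K) *\<^sub>R w)
      \<le> real k * norm w * dist x y"
    by (simp add: dist_norm ac_simps flip: scaleR_diff_left)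
qed simp

text \<open>The approximants need a Lipschitz constant, hence distance bumps around an inner compact
  set: each is Lipschitz, and they decrease to the indicator of that set.\<close>

lemma bounded_Lipschitz_dense_L1:
  fixes M :: "'b::euclidean_space measure" and f :: "'b \<Rightarrow> 'v::euclidean_space"
  assumes M: "finite_measure M" and sM[measurable_cong]: "sets M = sets borel"
    and f: "integrable M f"
  shows "0 < \<epsilon> \<Longrightarrow> \<exists>c L B. L-lipschitz_on UNIV c \<and> (\<forall>x. norm (c x) \<le> B) \<and>
    (\<integral>\<^sup>+x. norm (f x - c x) \<partial>M) \<le> ennreal \<epsilon>"
  using f
proof (induction f arbitrary: \<epsilon> rule: integrable_induct)
  case (base A w)
  interpret finite_measure M by fact
  have A: "A \<in> sets borel" using base by (simp add: sM)
  define e where "e = \<epsilon> / (2 * (1 + norm w))"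
  have e: "0 < e" using base by (simp add: e_def add_pos_nonneg)
  have e2: "e * norm w \<le> \<epsilon> / 2"
  proof -
    have "e * norm w \<le> e * (1 + norm w)" using e by (intro mult_left_mono) auto
    also have "\<dots> = \<epsilon> / 2"
      using add_pos_nonneg[OF zero_less_one norm_ge_zero[of w]] by (simp add: e_def field_simps)
    finally show ?thesis .
  qed
  have "emeasure M A = (SUP K \<in> {K. K \<subseteq> A \<and> compact K}. emeasure M K)"
    by (rule inner_regular[OF sM _ A]) simp
  note SUP = this
  obtain K where K: "K \<subseteq> A" "compact K" and mK: "measure M A - e \<le> measure M K"
  proof (cases "measure M A = 0")
    case True
    then show ?thesis using e by (intro that[of "{}"]) auto
  next
    case False
    then have "ennreal (measure M A - e) < emeasure M A"
      using e by (simp add: emeasure_eq_measure zero_less_measure_iff ennreal_lessI)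
    then obtain K where K: "K \<subseteq> A" "compact K" "ennreal (measure M A - e) < emeasure M K"
      unfolding SUP less_SUP_iff by auto
    then have "measure M A - e \<le> measure M K"
      by (simp add: emeasure_eq_measure) (metis ennreal_le_iff less_imp_le measure_nonneg)
    with K show ?thesis by (intro that)
  qed
  have Kb[measurable]: "K \<in> sets M" using K by (simp add: sM borel_compact)
  have Am[measurable]: "A \<in> sets M" by fact
  obtain b :: "nat \<Rightarrow> 'b \<Rightarrow> real" and l where bl: "\<And>k. (l k)-lipschitz_on UNIV (\<lambda>x. b k x *\<^sub>R w)"
    and b01: "\<And>k x. 0 \<le> b k x" "\<And>k x. b k x \<le> 1" and blim: "\<And>x. (\<lambda>k. b k x) \<longlonglongrightarrow> indicator K x"
  proof (cases "K = {}")
    \<comment> \<open>The distance to the empty set is 0 by convention, so the bumps would be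
      constantly 1; the zero function is used instead.\<close>
    case True
    show ?thesis
      by (rule that[of "\<lambda>_. 0" "\<lambda>_ _. 0"]) (auto simp: True intro: lipschitz_on_constant)
  next
    case False
    have cl: "closed K" using K(2) by (rule compact_imp_closed)
    show ?thesis
      by (rule that[OF Lipschitz_bump[of _ w K] _ _ Lipschitz_bump_tendsto_indicator[OF cl False]])
         (auto simp: infdist_nonneg)
  qed
  have bm[measurable]: "(\<lambda>x. b k x *\<^sub>R w) \<in> borel_measurable M" for k
    using bl[THEN lipschitz_on_continuous_on, THEN borel_measurable_continuous_onI]
    by (simp cong: measurable_cong_sets add: sM)
  have "(\<lambda>k. \<integral>\<^sup>+x. norm (indicator K x *\<^sub>R w - b k x *\<^sub>R w) \<partial>M) \<longlonglongrightarrow> (\<integral>\<^sup>+x. 0 \<partial>M)"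
  proof (rule nn_integral_dominated_convergence[where w="\<lambda>x. ennreal (norm w)"])
    show "AE x in M. ennreal (norm (indicator K x *\<^sub>R w - b k x *\<^sub>R w)) \<le> ennreal (norm w)" for k
    proof (intro AE_I2 ennreal_leI)
      fix x
      have "\<bar>indicator K x - b k x\<bar> * norm w \<le> 1 * norm w"
        using b01[of k x] by (intro mult_right_mono) (auto simp: indicator_def)
      then show "norm (indicator K x *\<^sub>R w - b k x *\<^sub>R w) \<le> norm w"
        by (simp flip: scaleR_diff_left)
    qed
    show "(\<integral>\<^sup>+x. ennreal (norm w) \<partial>M) < \<infinity>"
      by (simp add: emeasure_eq_measure ennreal_mult_less_top)
    show "AE x in M. (\<lambda>k. ennreal (norm (indicator K x *\<^sub>R w - b k x *\<^sub>R w))) \<longlonglongrightarrow> 0"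
    proof (rule AE_I2)
      fix x
      have "(\<lambda>k. norm (indicator K x *\<^sub>R w - b k x *\<^sub>R w)) \<longlonglongrightarrow> norm (indicator K x *\<^sub>R w - indicator K x *\<^sub>R w)"
        by (intro tendsto_intros blim)
      then have "(\<lambda>k. norm (indicator K x *\<^sub>R w - b k x *\<^sub>R w)) \<longlonglongrightarrow> 0" by simp
      from tendsto_ennrealI[OF this]
      show "(\<lambda>k. ennreal (norm (indicator K x *\<^sub>R w - b k x *\<^sub>R w))) \<longlonglongrightarrow> 0" by simp
    qed
  qed auto
  then have "\<forall>\<^sub>F k in sequentially. (\<integral>\<^sup>+x. norm (indicator K x *\<^sub>R w - b k x *\<^sub>R w) \<partial>M) < ennreal (\<epsilon> / 2)"
    using base by (intro order_tendstoD) auto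
  then obtain k where k: "(\<integral>\<^sup>+x. norm (indicator K x *\<^sub>R w - b k x *\<^sub>R w) \<partial>M) < ennreal (\<epsilon> / 2)"
    by (auto simp: eventually_sequentially)
  have "(\<integral>\<^sup>+x. norm (indicator A x *\<^sub>R w - b k x *\<^sub>R w) \<partial>M) \<le>
      (\<integral>\<^sup>+x. ennreal (norm w) * indicator (A - K) x + ennreal (norm (indicator K x *\<^sub>R w - b k x *\<^sub>R w)) \<partial>M)"
  proof (intro nn_integral_mono)
    fix x
    have "indicator A x *\<^sub>R w - b k x *\<^sub>R w =
        indicator (A - K) x *\<^sub>R w + (indicator K x *\<^sub>R w - b k x *\<^sub>R w)"
      using K(1) by (auto simp: indicator_def)
    then have "norm (indicator A x *\<^sub>R w - b k x *\<^sub>R w) \<le>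
        norm w * indicator (A - K) x + norm (indicator K x *\<^sub>R w - b k x *\<^sub>R w)"
      by (simp only:) (rule norm_triangle_le, simp)
    then have "ennreal (norm (indicator A x *\<^sub>R w - b k x *\<^sub>R w)) \<le>
        ennreal (norm w * indicator (A - K) x) + ennreal (norm (indicator K x *\<^sub>R w - b k x *\<^sub>R w))"
      by (simp add: ennreal_leI flip: ennreal_plus)
    then show "ennreal (norm (indicator A x *\<^sub>R w - b k x *\<^sub>R w)) \<le> ennreal (norm w) * indicator (A - K) x
        + ennreal (norm (indicator K x *\<^sub>R w - b k x *\<^sub>R w))"
      by (simp add: ennreal_mult ennreal_indicator)
  qed
  also have "\<dots> = ennreal (norm w) * emeasure M (A - K) + (\<integral>\<^sup>+x. norm (indicator K x *\<^sub>R w - b k x *\<^sub>R w) \<partial>M)"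
    by (subst nn_integral_add) (auto simp: nn_integral_cmult_indicator)
  also have "emeasure M (A - K) \<le> ennreal e"
    using mK K(1) by (simp add: emeasure_eq_measure finite_measure_Diff ennreal_leI)
  also have "ennreal (norm w) * ennreal e \<le> ennreal (\<epsilon> / 2)"
    using e2 e by (simp add: mult.commute ennreal_leI flip: ennreal_mult)
  also have "ennreal (\<epsilon> / 2) + (\<integral>\<^sup>+x. norm (indicator K x *\<^sub>R w - b k x *\<^sub>R w) \<partial>M)
      \<le> ennreal (\<epsilon> / 2) + ennreal (\<epsilon> / 2)"
    using k by (intro add_mono) auto
  also have "\<dots> = ennreal \<epsilon>" using base by (simp flip: ennreal_plus)
  finally have "(\<integral>\<^sup>+x. norm (indicator A x *\<^sub>R w - b k x *\<^sub>R w) \<partial>M) \<le> ennreal \<epsilon>"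
    by (simp add: add_mono mult_left_mono)
  moreover have "\<forall>x. norm (b k x *\<^sub>R w) \<le> norm w"
    using b01 by (simp add: mult_left_le_one_le)
  ultimately show ?case using bl[of k] by blast
next
  case (add f g)
  interpret finite_measure M by fact
  have half: "0 < \<epsilon> / 2" using add.prems by simp
  from add.IH(1)[OF half] obtain c1 L1 B1 where
    c1: "L1-lipschitz_on UNIV c1" "\<forall>x. norm (c1 x) \<le> B1" "(\<integral>\<^sup>+x. norm (f x - c1 x) \<partial>M) \<le> ennreal (\<epsilon> / 2)"
    by (elim exE conjE)
  from add.IH(2)[OF half] obtain c2 L2 B2 where
    c2: "L2-lipschitz_on UNIV c2" "\<forall>x. norm (c2 x) \<le> B2" "(\<integral>\<^sup>+x. norm (g x - c2 x) \<partial>M) \<le> ennreal (\<epsilon> / 2)"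
    by (elim exE conjE)
  note c = c1 c2
  have [measurable]: "c1 \<in> borel_measurable M" "c2 \<in> borel_measurable M"
    using c(1,4)[THEN lipschitz_on_continuous_on, THEN borel_measurable_continuous_onI]
    by (simp_all cong: measurable_cong_sets add: sM)
  have [measurable]: "f \<in> borel_measurable M" "g \<in> borel_measurable M" using add by auto
  have "(\<integral>\<^sup>+x. norm (f x + g x - (c1 x + c2 x)) \<partial>M) \<le>
      (\<integral>\<^sup>+x. ennreal (norm (f x - c1 x)) + ennreal (norm (g x - c2 x)) \<partial>M)"
    by (intro nn_integral_mono) (simp add: norm_diff_triangle_ineq ennreal_leI flip: ennreal_plus)
  also have "\<dots> = (\<integral>\<^sup>+x. norm (f x - c1 x) \<partial>M) + (\<integral>\<^sup>+x. norm (g x - c2 x) \<partial>M)"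
    by (rule nn_integral_add) measurable
  also have "\<dots> \<le> ennreal (\<epsilon> / 2) + ennreal (\<epsilon> / 2)" by (intro add_mono c)
  also have "\<dots> = ennreal \<epsilon>" using add.prems by (simp flip: ennreal_plus)
  finally have "(\<integral>\<^sup>+x. norm (f x + g x - (c1 x + c2 x)) \<partial>M) \<le> ennreal \<epsilon>" .
  moreover have "(L1 + L2)-lipschitz_on UNIV (\<lambda>x. c1 x + c2 x)"
    by (rule lipschitz_on_add) (use c in auto)
  moreover have "\<forall>x. norm (c1 x + c2 x) \<le> B1 + B2"
    using c by (auto intro: norm_triangle_le add_mono)
  ultimately show ?case by blast
next
  case (lim f s)
  interpret finite_measure M by fact
  have [measurable]: "f \<in> borel_measurable M" "\<And>i. s i \<in> borel_measurable M" using lim by auto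
  have "(\<lambda>i. \<integral>\<^sup>+x. norm (s i x - f x) \<partial>M) \<longlonglongrightarrow> (\<integral>\<^sup>+x. 0 \<partial>M)"
  proof (rule nn_integral_dominated_convergence[where w="\<lambda>x. ennreal (3 * norm (f x))"])
    show "AE x in M. ennreal (norm (s i x - f x)) \<le> ennreal (3 * norm (f x))" for i
      using lim.hyps(3) norm_triangle_ineq4
      by (intro AE_I2 ennreal_leI) (smt (verit) lim.hyps(3) norm_triangle_ineq4)
    show "(\<integral>\<^sup>+x. ennreal (3 * norm (f x)) \<partial>M) < \<infinity>"
      using lim.hyps by (subst nn_integral_eq_integral) auto
    show "AE x in M. (\<lambda>i. ennreal (norm (s i x - f x))) \<longlonglongrightarrow> 0"
    proof (rule AE_I2)
      fix x assume "x \<in> space M"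
      then have "(\<lambda>i. norm (s i x - f x)) \<longlonglongrightarrow> 0"
        using lim.hyps(2) LIM_zero tendsto_norm_zero by blast
      then show "(\<lambda>i. ennreal (norm (s i x - f x))) \<longlonglongrightarrow> 0"
        using tendsto_ennrealI by fastforce
    qed
  qed auto
  then have "\<forall>\<^sub>F i in sequentially. (\<integral>\<^sup>+x. norm (s i x - f x) \<partial>M) < ennreal (\<epsilon> / 2)"
    using lim.prems by (intro order_tendstoD) auto
  then obtain i where i: "(\<integral>\<^sup>+x. norm (s i x - f x) \<partial>M) < ennreal (\<epsilon> / 2)"
    by (auto simp: eventually_sequentially)
  have half: "0 < \<epsilon> / 2" using lim.prems by simp
  from lim.IH[OF half, of i] obtain c L B where
    c: "L-lipschitz_on UNIV c" "\<forall>x. norm (c x) \<le> B" "(\<integral>\<^sup>+x. norm (s i x - c x) \<partial>M) \<le> ennreal (\<epsilon> / 2)"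
    by (elim exE conjE)
  have [measurable]: "c \<in> borel_measurable M"
    using c(1)[THEN lipschitz_on_continuous_on, THEN borel_measurable_continuous_onI]
    by (simp cong: measurable_cong_sets add: sM)
  have "(\<integral>\<^sup>+x. norm (f x - c x) \<partial>M) \<le>
      (\<integral>\<^sup>+x. ennreal (norm (s i x - f x)) + ennreal (norm (s i x - c x)) \<partial>M)"
  proof (intro nn_integral_mono)
    fix x
    show "ennreal (norm (f x - c x)) \<le> ennreal (norm (s i x - f x)) + ennreal (norm (s i x - c x))"
      using norm_triangle_ineq[of "f x - s i x" "s i x - c x"]
      by (simp add: norm_minus_commute ennreal_leI flip: ennreal_plus)
  qed
  also have "\<dots> = (\<integral>\<^sup>+x. norm (s i x - f x) \<partial>M) + (\<integral>\<^sup>+x. norm (s i x - c x) \<partial>M)"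
    by (rule nn_integral_add) measurable
  also have "\<dots> \<le> ennreal (\<epsilon> / 2) + ennreal (\<epsilon> / 2)"
    using i c by (intro add_mono) auto
  also have "\<dots> = ennreal \<epsilon>" using lim.prems by (simp flip: ennreal_plus)
  finally show ?case using c by blast
qed

section \<open>The space-time law of the interpolation\<close>

context rectified_flow begin

text \<open>The definition of \<open>v\<close> gives integrability for each time separately; this
  bound is uniform in time. Per coordinate, the defining identity is tested on the sets where that
  coordinate of \<open>v t\<close> is positive and where it is negative; summing over the basis
  produces the factor \<open>DIM('a)\<close>.\<close>

lemma nn_integral_norm_field_le:
  assumes t: "t \<in> {0..1}"
  shows "(\<integral>\<^sup>+p. norm (v t (interp t p)) \<partial>P) \<le> ennreal (real DIM('a) * (\<integral>p. norm (snd p - fst p) \<partial>P))"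
proof -
  let ?Y = "\<lambda>p::'a \<times> 'a. snd p - fst p" and ?V = "\<lambda>p. v t (interp t p)"
  have iV: "integrable P ?V" and iY: "integrable P ?Y"
    using integrable_field[OF t] integrable_velocity by auto
  note [measurable] = borel_measurable_integrable[OF iV] borel_measurable_integrable[OF iY]
  have comp: "(\<integral>p. \<bar>?V p \<bullet> b\<bar> \<partial>P) \<le> (\<integral>p. norm (?Y p) \<partial>P)" if b: "b \<in> Basis" for b
  proof -
    define S1 where "S1 = {x. v t x \<bullet> b > 0}"
    define S2 where "S2 = {x. v t x \<bullet> b < 0}"
    have vt[measurable]: "v t \<in> borel_measurable borel" by measurable
    have S[measurable]: "S1 \<in> sets borel" "S2 \<in> sets borel"
      unfolding S1_def S2_def by measurable
    have ind[measurable]: "(\<lambda>p. indicator A (interp t p) :: real) \<in> borel_measurable P"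
      if [measurable]: "A \<in> sets borel" for A :: "'a set" by measurable
    have int: "integrable P (\<lambda>p. indicator A (interp t p) *\<^sub>R f p)"
      if A: "A \<in> sets borel" and f: "integrable P f" for A and f :: "'a \<times> 'a \<Rightarrow> 'a"
      by (rule Bochner_Integration.integrable_bound[OF f])
         (use ind[OF A] borel_measurable_integrable[OF f] in \<open>auto simp: indicator_def\<close>)
    have eq: "(\<integral>p. indicator A (interp t p) *\<^sub>R ?V p \<bullet> b \<partial>P) = (\<integral>p. indicator A (interp t p) *\<^sub>R ?Y p \<bullet> b \<partial>P)"
      if A: "A \<in> sets borel" for A
      using integral_inner_left[OF int[OF A iV], of b] integral_inner_left[OF int[OF A iY], of b]
        field_eq[OF t A] by simp
    have "(\<integral>p. \<bar>?V p \<bullet> b\<bar> \<partial>P) =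
        (\<integral>p. indicator S1 (interp t p) *\<^sub>R ?V p \<bullet> b - indicator S2 (interp t p) *\<^sub>R ?V p \<bullet> b \<partial>P)"
      by (intro Bochner_Integration.integral_cong) (auto simp: S1_def S2_def indicator_def)
    also have "\<dots> = (\<integral>p. indicator S1 (interp t p) *\<^sub>R ?Y p \<bullet> b - indicator S2 (interp t p) *\<^sub>R ?Y p \<bullet> b \<partial>P)"
      using int[OF S(1) iV] int[OF S(2) iV] int[OF S(1) iY] int[OF S(2) iY]
        eq[OF S(1)] eq[OF S(2)]
      by (subst (1 2) Bochner_Integration.integral_diff) (auto intro!: integrable_inner_left simp del: inner_scaleR_left)
    also have "\<dots> \<le> (\<integral>p. norm (?Y p) \<partial>P)"
    proof (rule integral_mono)
      show "integrable P (\<lambda>p. indicator S1 (interp t p) *\<^sub>R ?Y p \<bullet> b - indicator S2 (interp t p) *\<^sub>R ?Y p \<bullet> b)"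
        using int[OF S(1) iY] int[OF S(2) iY] by (intro Bochner_Integration.integrable_diff integrable_inner_left)
      show "indicator S1 (interp t p) *\<^sub>R ?Y p \<bullet> b - indicator S2 (interp t p) *\<^sub>R ?Y p \<bullet> b \<le> norm (?Y p)" for p
        using Basis_le_norm[OF b, of "?Y p"] by (auto simp: S1_def S2_def indicator_def)
    qed (use iY in auto)
    finally show ?thesis .
  qed
  have "(\<integral>\<^sup>+p. norm (?V p) \<partial>P) = ennreal (\<integral>p. norm (?V p) \<partial>P)"
    using iV by (intro nn_integral_eq_integral) auto
  also have "(\<integral>p. norm (?V p) \<partial>P) \<le> (\<integral>p. (\<Sum>b\<in>Basis. \<bar>?V p \<bullet> b\<bar>) \<partial>P)"
    using iV by (intro integral_mono norm_le_l1) auto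
  also have "\<dots> = (\<Sum>b\<in>Basis. (\<integral>p. \<bar>?V p \<bullet> b\<bar> \<partial>P))"
    using iV by (intro Bochner_Integration.integral_sum) auto
  also have "\<dots> \<le> (\<Sum>b\<in>(Basis::'a set). (\<integral>p. norm (?Y p) \<partial>P))"
    by (intro sum_mono comp)
  also have "\<dots> = real DIM('a) * (\<integral>p. norm (?Y p) \<partial>P)" by simp
  finally show ?thesis by (simp add: ennreal_leI)
qed

text \<open>The law of time and position when the time is uniform on the unit interval and
  independent of the coupling. A jointly measurable random path with the same one-time marginals has
  this expected occupation measure, so bounds proved here transfer to it by Fubini.\<close>

definition occupation :: "(real \<times> 'a) measure" where
  "occupation = distr (density lborel (indicator {0..1}) \<Otimes>\<^sub>M P) borel (\<lambda>x. (fst x, interp (fst x) (snd x)))"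

lemma sets_occupation[measurable_cong]: "sets occupation = sets borel"
  by (simp add: occupation_def)

lemma nn_integral_occupation:
  assumes F[measurable]: "F \<in> borel_measurable borel"
  shows "(\<integral>\<^sup>+x. F x \<partial>occupation) = (\<integral>\<^sup>+r. (\<integral>\<^sup>+p. F (r, interp r p) \<partial>P) * indicator {0..1} r \<partial>lborel)"
proof -
  let ?U = "density lborel (indicator {0..1}) :: real measure"
  have m: "(\<lambda>x. (fst x, interp (fst x) (snd x))) \<in> measurable (lborel \<Otimes>\<^sub>M P) borel"
    by measurable
  have m': "(\<lambda>x. (fst x, interp (fst x) (snd x))) \<in> measurable (?U \<Otimes>\<^sub>M P) borel"
    using m by (simp cong: measurable_cong_sets sets_pair_measure_cong)
  have Fm[measurable]: "(\<lambda>x. F (fst x, interp (fst x) (snd x))) \<in> borel_measurable (lborel \<Otimes>\<^sub>M P)"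
    by (rule measurable_compose[OF m F])
  have Fm': "(\<lambda>x. F (fst x, interp (fst x) (snd x))) \<in> borel_measurable (?U \<Otimes>\<^sub>M P)"
    by (rule measurable_compose[OF m' F])
  have Fi[measurable]: "(\<lambda>r. \<integral>\<^sup>+p. F (r, interp r p) \<partial>P) \<in> borel_measurable lborel"
    using borel_measurable_nn_integral_fst[OF Fm] by simp
  have "(\<integral>\<^sup>+x. F x \<partial>occupation) = (\<integral>\<^sup>+x. F (fst x, interp (fst x) (snd x)) \<partial>(?U \<Otimes>\<^sub>M P))"
    unfolding occupation_def by (rule nn_integral_distr[OF m']) simp
  also have "\<dots> = (\<integral>\<^sup>+r. \<integral>\<^sup>+p. F (r, interp r p) \<partial>P \<partial>?U)"
    using nn_integral_fst[OF Fm'] by simp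
  also have "\<dots> = (\<integral>\<^sup>+r. (\<integral>\<^sup>+p. F (r, interp r p) \<partial>P) * indicator {0..1} r \<partial>lborel)"
    by (subst nn_integral_density) (auto simp: mult.commute)
  finally show ?thesis .
qed

lemma prob_space_occupation: "prob_space occupation"
proof (rule prob_spaceI)
  have "emeasure occupation (space occupation) = (\<integral>\<^sup>+x. 1 \<partial>occupation)" by simp
  also have "\<dots> = 1"
    by (subst nn_integral_occupation) (auto simp: emeasure_space_1[unfolded space_P])
  finally show "emeasure occupation (space occupation) = 1" .
qed

lemma integrable_field_occupation: "integrable occupation (\<lambda>x. v (fst x) (snd x))"
proof (rule integrableI_bounded)
  let ?C = "real DIM('a) * (\<integral>p. norm (snd p - fst p) \<partial>P)"
  have "(\<integral>\<^sup>+x. norm (v (fst x) (snd x)) \<partial>occupation) =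
      (\<integral>\<^sup>+r. (\<integral>\<^sup>+p. norm (v r (interp r p)) \<partial>P) * indicator {0..1} r \<partial>lborel)"
    by (subst nn_integral_occupation) auto
  also have "\<dots> \<le> (\<integral>\<^sup>+r. ennreal ?C * indicator {0..1::real} r \<partial>lborel)"
    by (intro nn_integral_mono) (auto simp: indicator_def nn_integral_norm_field_le)
  also have "\<dots> < \<infinity>" by (simp add: nn_integral_cmult_indicator)
  finally show "(\<integral>\<^sup>+x. norm (v (fst x) (snd x)) \<partial>occupation) < \<infinity>" .
qed measurable

lemma nn_integral_field_error:
  assumes [measurable]: "c \<in> borel_measurable borel"
  shows "(\<integral>\<^sup>+r. field_error c r * indicator {0..1} r \<partial>lborel) = (\<integral>\<^sup>+x. norm (v (fst x) (snd x) - c x) \<partial>occupation)"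
  by (subst nn_integral_occupation) (auto simp: field_error_def)

text \<open>The rate \<open>(1/4)^m\<close> leaves room for the weights \<open>2^m\<close> of the
  penalty. Summability makes the approximants converge off a null set \<open>N\<close>; enlarging
  \<open>N\<close> to open sets \<open>U m\<close> of small measure gives exceptional sets that
  behave well when paths converge.\<close>

lemma approximants_exist:
  obtains c :: "nat \<Rightarrow> real \<times> 'a \<Rightarrow> 'a" and L B :: "nat \<Rightarrow> real" and U :: "nat \<Rightarrow> (real \<times> 'a) set"
  where "\<And>m. (L m)-lipschitz_on UNIV (c m)" "\<And>m x. norm (c m x) \<le> B m"
    "\<And>m. (\<integral>\<^sup>+r. field_error (c m) r * indicator {0..1} r \<partial>lborel) \<le> ennreal ((1/4)^m)"
    "\<And>m. open (U m)" "\<And>m. emeasure occupation (U m) \<le> ennreal ((1/4)^m)"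
    "\<And>m x. x \<notin> U m \<Longrightarrow> (\<lambda>k. c k x) \<longlonglongrightarrow> v (fst x) (snd x)"
proof -
  interpret O: prob_space occupation by (rule prob_space_occupation)
  have "\<forall>m::nat. \<exists>c L B. L-lipschitz_on UNIV (c) \<and> (\<forall>x. norm (c x) \<le> B) \<and>
      (\<integral>\<^sup>+x. norm (v (fst x) (snd x) - c x) \<partial>occupation) \<le> ennreal ((1/4)^m)"
    by (intro allI bounded_Lipschitz_dense_L1[OF O.finite_measure_axioms sets_occupation integrable_field_occupation])
       simp
  from choice[OF this] obtain c where "\<forall>m::nat. \<exists>L B. L-lipschitz_on UNIV (c m) \<and> (\<forall>x. norm (c m x) \<le> B) \<and>
      (\<integral>\<^sup>+x. norm (v (fst x) (snd x) - c m x) \<partial>occupation) \<le> ennreal ((1/4)^m)"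
    by (elim exE)
  from choice[OF this] obtain L where "\<forall>m::nat. \<exists>B. (L m)-lipschitz_on UNIV (c m) \<and> (\<forall>x. norm (c m x) \<le> B) \<and>
      (\<integral>\<^sup>+x. norm (v (fst x) (snd x) - c m x) \<partial>occupation) \<le> ennreal ((1/4)^m)"
    by (elim exE)
  from choice[OF this] obtain B where cLB: "\<forall>m::nat. (L m)-lipschitz_on UNIV (c m) \<and> (\<forall>x. norm (c m x) \<le> B m) \<and>
      (\<integral>\<^sup>+x. norm (v (fst x) (snd x) - c m x) \<partial>occupation) \<le> ennreal ((1/4)^m)"
    by (elim exE)
  then have c: "\<And>m::nat. (L m)-lipschitz_on UNIV (c m)" "\<And>m x. norm (c m x) \<le> B m"
    and ce: "\<And>m. (\<integral>\<^sup>+x. norm (v (fst x) (snd x) - c m x) \<partial>occupation) \<le> ennreal ((1/4)^m)"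
    by blast+
  have cm[measurable]: "c m \<in> borel_measurable borel" for m
    by (intro borel_measurable_continuous_onI lipschitz_on_continuous_on[OF c(1)])
  define S where "S x = (\<Sum>m. ennreal (norm (v (fst x) (snd x) - c m x)))" for x
  have [measurable]: "S \<in> borel_measurable borel" unfolding S_def by measurable
  have "(\<integral>\<^sup>+x. S x \<partial>occupation) = (\<Sum>m. \<integral>\<^sup>+x. norm (v (fst x) (snd x) - c m x) \<partial>occupation)"
    unfolding S_def by (rule nn_integral_suminf) measurable
  also have "\<dots> \<le> (\<Sum>m. ennreal ((1/4)^m))"
    by (intro suminf_le ce) auto
  also have "\<dots> = ennreal (\<Sum>m. (1/4)^m)"
    by (intro suminf_ennreal2) (auto intro!: summable_geometric)
  also have "\<dots> < \<infinity>" by simp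
  finally have fin: "AE x in occupation. S x \<noteq> \<infinity>"
    by (intro nn_integral_PInf_AE) (auto simp: top_unique)
  define N where "N = {x. S x = \<infinity>}"
  have N[measurable]: "N \<in> sets borel" unfolding N_def by measurable
  have N0: "emeasure occupation N = 0"
    using fin N by (subst AE_iff_measurable[symmetric, where P="\<lambda>x. S x \<noteq> \<infinity>"])
      (auto simp: N_def sets_occupation sets_eq_imp_space_eq[OF sets_occupation])
  have conv: "(\<lambda>k. c k x) \<longlonglongrightarrow> v (fst x) (snd x)" if "x \<notin> N" for x
  proof -
    have "summable (\<lambda>m. norm (v (fst x) (snd x) - c m x))"
      using that by (intro summable_suminf_not_top) (auto simp: N_def S_def)
    then have "(\<lambda>m. v (fst x) (snd x) - c m x) \<longlonglongrightarrow> 0"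
      using summable_LIMSEQ_zero tendsto_norm_zero_iff by blast
    from tendsto_diff[OF tendsto_const[of "v (fst x) (snd x)"] this] show ?thesis by simp
  qed
  have "\<forall>m::nat. \<exists>U. open U \<and> N \<subseteq> U \<and> emeasure occupation U \<le> ennreal ((1/4)^m)"
  proof
    fix m :: nat
    have "emeasure occupation N = (INF U \<in> {U. N \<subseteq> U \<and> open U}. emeasure occupation U)"
      by (rule outer_regular[OF sets_occupation _ N]) simp
    then have "(INF U \<in> {U. N \<subseteq> U \<and> open U}. emeasure occupation U) < ennreal ((1/4)^m)"
      using N0 by simp
    then obtain U where "U \<in> {U. N \<subseteq> U \<and> open U}" "emeasure occupation U < ennreal ((1/4)^m)"
      unfolding INF_less_iff by (elim bexE)
    then show "\<exists>U. open U \<and> N \<subseteq> U \<and> emeasure occupation U \<le> ennreal ((1/4)^m)"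
      by (intro exI[of _ U]) auto
  qed
  from choice[OF this] obtain U
    where U: "\<forall>m::nat. open (U m) \<and> N \<subseteq> U m \<and> emeasure occupation (U m) \<le> ennreal ((1/4)^m)"
    by (elim exE)
  show thesis
  proof (rule that)
    show "(\<integral>\<^sup>+r. field_error (c m) r * indicator {0..1} r \<partial>lborel) \<le> ennreal ((1/4)^m)" for m
      by (simp only: nn_integral_field_error[OF cm] ce)
    show "x \<notin> U m \<Longrightarrow> (\<lambda>k. c k x) \<longlonglongrightarrow> v (fst x) (snd x)" for m x
      using U by (intro conv) auto
  qed (use c U in auto)
qed

end

text \<open>Moving the variable end point into the integrand as an indicator reduces the claim to a
  parametrized integral over the line. It makes the defect measurable in time, and jointly in path
  and time.\<close>

lemma measurable_primitive:
  fixes f :: "'b \<Rightarrow> real \<Rightarrow> 'v::euclidean_space"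
  assumes f[measurable]: "(\<lambda>x. f (fst x) (snd x)) \<in> borel_measurable (N \<Otimes>\<^sub>M lborel)"
    and h[measurable]: "h \<in> borel_measurable N"
  shows "(\<lambda>x. LINT r:{0..h x}|lborel. f x r) \<in> borel_measurable N"
proof -
  have "(\<lambda>x. (if 0 \<le> snd x \<and> snd x \<le> h (fst x) then 1 else 0) *\<^sub>R f (fst x) (snd x))
      \<in> borel_measurable (N \<Otimes>\<^sub>M lborel)"
    by measurable
  then have "(\<lambda>(x, r). indicator {0..h x} r *\<^sub>R f x r) \<in> borel_measurable (N \<Otimes>\<^sub>M lborel)"
    by (simp add: indicator_def of_bool_def case_prod_beta)
  then show ?thesis
    unfolding set_lebesgue_integral_def by (rule lborel.borel_measurable_lebesgue_integral)
qed

section \<open>Compactness of approximate solutions\<close>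

text \<open>When \<open>f\<close> is not integrable on \<open>A\<close> the left-hand side is 0 by
  convention.\<close>

lemma norm_set_integral_le_nn_integral:
  fixes f :: "real \<Rightarrow> 'v::euclidean_space"
  assumes "A \<subseteq> S"
  shows "ennreal (norm (LINT r:A|lborel. f r)) \<le> (\<integral>\<^sup>+r. norm (f r) * indicator S r \<partial>lborel)"
proof (cases "set_integrable lborel A f")
  case True
  then have "ennreal (norm (LINT r:A|lborel. f r)) \<le> (\<integral>\<^sup>+r. norm (indicator A r *\<^sub>R f r) \<partial>lborel)"
    unfolding set_integrable_def set_lebesgue_integral_def by (rule integral_norm_bound_ennreal)
  also have "\<dots> \<le> (\<integral>\<^sup>+r. norm (f r) * indicator S r \<partial>lborel)"
    using assms by (intro nn_integral_mono) (auto simp: indicator_def)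
  finally show ?thesis .
next
  case False
  then show ?thesis
    unfolding set_integrable_def set_lebesgue_integral_def by (simp add: not_integrable_integral_eq)
qed

lemma primitive_increment:
  fixes f :: "real \<Rightarrow> 'v::euclidean_space"
  assumes f: "f \<in> borel_measurable borel" "\<And>r. norm (f r) \<le> B" and st: "0 \<le> s" "s \<le> t"
  shows "(LINT r:{0..t}|lborel. f r) - (LINT r:{0..s}|lborel. f r) = (LINT r:{s<..t}|lborel. f r)"
proof -
  have i: "set_integrable lborel {0..t} f" by (rule set_integrable_bounded_interval[OF f])
  have "(LINT r:{0..s} \<union> {s<..t}|lborel. f r) = (LINT r:{0..s}|lborel. f r) + (LINT r:{s<..t}|lborel. f r)"
    by (rule set_integral_Un) (use st in \<open>auto intro!: set_integrable_subset[OF i]\<close>)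
  moreover have "{0..s} \<union> {s<..t} = {0..t}" using st by auto
  ultimately show ?thesis by simp
qed

lemma primitive_Lipschitz:
  fixes f :: "real \<Rightarrow> 'v::euclidean_space"
  assumes f: "f \<in> borel_measurable borel" "\<And>r. norm (f r) \<le> B" and st: "0 \<le> s" "s \<le> t"
  shows "norm ((LINT r:{0..t}|lborel. f r) - (LINT r:{0..s}|lborel. f r)) \<le> B * (t - s)"
proof -
  have B: "0 \<le> B" using f(2) norm_ge_zero order_trans by blast
  have "ennreal (norm ((LINT r:{0..t}|lborel. f r) - (LINT r:{0..s}|lborel. f r)))
      \<le> (\<integral>\<^sup>+r. norm (f r) * indicator {s<..t} r \<partial>lborel)"
    unfolding primitive_increment[OF f st] by (rule norm_set_integral_le_nn_integral) simp
  also have "\<dots> \<le> (\<integral>\<^sup>+r. ennreal B * indicator {s<..t} r \<partial>lborel)"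
    using f(2) by (intro nn_integral_mono) (auto simp: indicator_def ennreal_leI)
  also have "\<dots> = ennreal (B * (t - s))"
    using st B by (simp add: nn_integral_cmult_indicator ennreal_mult)
  finally show ?thesis using st B by (simp add: ennreal_le_iff)
qed

lemma ennreal_le_divide_power:
  assumes "ennreal (2 ^ l) * x \<le> ennreal C" "0 \<le> C"
  shows "x \<le> ennreal (C / 2 ^ l)"
proof -
  have "x = ennreal (1 / 2 ^ l) * (ennreal (2 ^ l) * x)"
    by (simp add: mult.assoc[symmetric] flip: ennreal_mult)
  also have "\<dots> \<le> ennreal (1 / 2 ^ l) * ennreal C" by (intro mult_left_mono assms) simp
  also have "\<dots> = ennreal (C / 2 ^ l)" using assms(2) by (simp flip: ennreal_mult)
  finally show ?thesis .
qed

text \<open>The deterministic half of the argument: it speaks of single paths and of sequences of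
  paths. The bounds \<open>B m\<close> may grow with \<open>m\<close>.\<close>

locale field_approximation =
  fixes v :: "real \<Rightarrow> 'a::euclidean_space \<Rightarrow> 'a" and c :: "nat \<Rightarrow> real \<times> 'a \<Rightarrow> 'a"
    and B :: "nat \<Rightarrow> real" and U :: "nat \<Rightarrow> (real \<times> 'a) set"
  assumes field[measurable]: "(\<lambda>x. v (fst x) (snd x)) \<in> borel_measurable borel"
    and c_cont: "\<And>m. continuous_on UNIV (c m)"
    and c_bound: "\<And>m x. norm (c m x) \<le> B m"
    and U_open: "\<And>m. open (U m)"
    and c_conv: "\<And>m x. x \<notin> U m \<Longrightarrow> (\<lambda>k. c k x) \<longlonglongrightarrow> v (fst x) (snd x)"
begin

text \<open>A finite integral of the penalty along a path controls all approximations at once, with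
  geometric rates, and keeps the path off the null set on which they fail to converge.\<close>

definition penalty :: "real \<times> 'a \<Rightarrow> ennreal" where
  "penalty x = (\<Sum>m. ennreal (2 ^ m) * (ennreal (norm (v (fst x) (snd x) - c m x)) + indicator (U m) x))"

definition defect :: "nat \<Rightarrow> (real \<Rightarrow> 'a) \<Rightarrow> real \<Rightarrow> 'a" where
  "defect m \<gamma> t = \<gamma> t - \<gamma> 0 - (LINT r:{0..t}|lborel. c m (r, \<gamma> r))"

text \<open>\<open>m\<close> is the level at which the path nearly solves its equation, while the
  penalty covers all levels. Defects small in the time integral give convergence at almost every
  time only, so the time \<open>T\<close> of interest gets a clause of its own. Paths are merely
  Borel since the constructed ones jump.\<close>

definition good :: "real \<Rightarrow> real \<Rightarrow> nat \<Rightarrow> (real \<Rightarrow> 'a) \<Rightarrow> bool" where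
  "good C T m \<gamma> \<longleftrightarrow> \<gamma> \<in> borel_measurable borel \<and>
    (\<integral>\<^sup>+r. penalty (r, \<gamma> r) * indicator {0..1} r \<partial>lborel) \<le> ennreal C \<and>
    (\<integral>\<^sup>+t. norm (defect m \<gamma> t) * indicator {0..1} t \<partial>lborel) \<le> ennreal (C / 2 ^ m) \<and>
    norm (defect m \<gamma> T) \<le> C / 2 ^ m"

lemma c_measurable[measurable]: "c m \<in> borel_measurable borel"
  by (intro borel_measurable_continuous_onI c_cont)

lemma B_nonneg: "0 \<le> B m"
  using c_bound[of m undefined] norm_ge_zero order_trans by blast

lemma measurable_along[measurable (raw)]:
  assumes [measurable]: "\<gamma> \<in> borel_measurable borel"
  shows "(\<lambda>r. c m (r, \<gamma> r)) \<in> borel_measurable borel" "(\<lambda>r. v r (\<gamma> r)) \<in> borel_measurable borel"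
    "Measurable.pred borel (\<lambda>r. (r, \<gamma> r) \<in> U m)"
proof -
  have *: "(\<lambda>r. (r, \<gamma> r)) \<in> borel_measurable borel" by measurable
  show "(\<lambda>r. c m (r, \<gamma> r)) \<in> borel_measurable borel"
    by (rule measurable_compose[OF * c_measurable])
  show "(\<lambda>r. v r (\<gamma> r)) \<in> borel_measurable borel"
    using measurable_compose[OF * field] by simp
  have [measurable]: "U m \<in> sets borel" using U_open by auto
  show "Measurable.pred borel (\<lambda>r. (r, \<gamma> r) \<in> U m)"
    using * by (rule pred_sets2[rotated]) measurable
qed

text \<open>A single summand is below the whole penalty, and its weight \<open>2 ^ l\<close> can be
  divided out; hence control at every level \<open>l\<close>, not only at the level \<open>m\<close>
  of the path.\<close>

lemma good_bounds:
  assumes g: "good C T m \<gamma>" and C: "0 \<le> C"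
  shows "(\<integral>\<^sup>+r. norm (v r (\<gamma> r) - c l (r, \<gamma> r)) * indicator {0..1} r \<partial>lborel) \<le> ennreal (C / 2 ^ l)"
    and "(\<integral>\<^sup>+r. indicator (U l) (r, \<gamma> r) * indicator {0..1} r \<partial>lborel) \<le> ennreal (C / 2 ^ l)"
proof -
  have [measurable]: "\<gamma> \<in> borel_measurable borel" using g by (simp add: good_def)
  let ?t = "\<lambda>l x. ennreal (2 ^ l) * (ennreal (norm (v (fst x) (snd x) - c l x)) + indicator (U l) x)"
  have le: "?t l x \<le> penalty x" for x
    unfolding penalty_def using sum_le_suminf[of "\<lambda>l. ?t l x" "{l}"] by simp
  have bound: "(\<integral>\<^sup>+r. F r * indicator {0..1} r \<partial>lborel) \<le> ennreal (C / 2 ^ l)"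
    if [measurable]: "F \<in> borel_measurable borel"
      and F: "\<And>r. F r \<le> ennreal (norm (v r (\<gamma> r) - c l (r, \<gamma> r))) + indicator (U l) (r, \<gamma> r)"
    for F :: "real \<Rightarrow> ennreal"
  proof -
    have "ennreal (2 ^ l) * (\<integral>\<^sup>+r. F r * indicator {0..1} r \<partial>lborel)
        = (\<integral>\<^sup>+r. ennreal (2 ^ l) * (F r * indicator {0..1} r) \<partial>lborel)"
      by (rule nn_integral_cmult[symmetric]) measurable
    also have "\<dots> \<le> (\<integral>\<^sup>+r. penalty (r, \<gamma> r) * indicator {0..1} r \<partial>lborel)"
    proof (intro nn_integral_mono)
      fix r
      have "ennreal (2 ^ l) * F r \<le> penalty (r, \<gamma> r)"
        by (rule order_trans[OF _ le[of "(r, \<gamma> r)"]]) (simp add: mult_left_mono F)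
      then show "ennreal (2 ^ l) * (F r * indicator {0..1} r) \<le> penalty (r, \<gamma> r) * indicator {0..1} r"
        by (auto simp: indicator_def)
    qed
    also have "\<dots> \<le> ennreal C" using g by (simp add: good_def)
    finally show ?thesis by (rule ennreal_le_divide_power) fact
  qed
  show "(\<integral>\<^sup>+r. norm (v r (\<gamma> r) - c l (r, \<gamma> r)) * indicator {0..1} r \<partial>lborel) \<le> ennreal (C / 2 ^ l)"
    using bound[of "\<lambda>r. ennreal (norm (v r (\<gamma> r) - c l (r, \<gamma> r)))"] by (simp add: ennreal_mult ennreal_indicator)
  show "(\<integral>\<^sup>+r. indicator (U l) (r, \<gamma> r) * indicator {0..1} r \<partial>lborel) \<le> ennreal (C / 2 ^ l)"
    by (rule bound) simp_all
qed

lemma approximations_close: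
  assumes g: "good C T m \<gamma>" and C: "0 \<le> C" and jl: "j \<le> l"
  shows "(\<integral>\<^sup>+r. norm (c l (r, \<gamma> r) - c j (r, \<gamma> r)) * indicator {0..1} r \<partial>lborel) \<le> ennreal (2 * C / 2 ^ j)"
proof -
  have [measurable]: "\<gamma> \<in> borel_measurable borel" using g by (simp add: good_def)
  let ?e = "\<lambda>l r. ennreal (norm (v r (\<gamma> r) - c l (r, \<gamma> r)) * indicator {0..1} r)"
  have "(\<integral>\<^sup>+r. norm (c l (r, \<gamma> r) - c j (r, \<gamma> r)) * indicator {0..1} r \<partial>lborel) \<le> (\<integral>\<^sup>+r. ?e l r + ?e j r \<partial>lborel)"
  proof (intro nn_integral_mono)
    fix r
    have "norm (c l (r, \<gamma> r) - c j (r, \<gamma> r)) \<le> norm (v r (\<gamma> r) - c l (r, \<gamma> r)) + norm (v r (\<gamma> r) - c j (r, \<gamma> r))"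
      using norm_triangle_ineq4[of "v r (\<gamma> r) - c j (r, \<gamma> r)" "v r (\<gamma> r) - c l (r, \<gamma> r)"] by simp
    then show "ennreal (norm (c l (r, \<gamma> r) - c j (r, \<gamma> r)) * indicator {0..1} r) \<le> ?e l r + ?e j r"
      by (auto simp: indicator_def ennreal_leI simp flip: ennreal_plus)
  qed
  also have "\<dots> = (\<integral>\<^sup>+r. ?e l r \<partial>lborel) + (\<integral>\<^sup>+r. ?e j r \<partial>lborel)" by (rule nn_integral_add) measurable
  also have "\<dots> \<le> ennreal (C / 2 ^ l) + ennreal (C / 2 ^ j)"
    by (intro add_mono good_bounds(1)[OF g C])
  also have "\<dots> = ennreal (C / 2 ^ l + C / 2 ^ j)" using C by (simp flip: ennreal_plus)
  also have "\<dots> \<le> ennreal (2 * C / 2 ^ j)"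
  proof (rule ennreal_leI)
    have "C / 2 ^ l \<le> C / 2 ^ j" using C jl by (intro divide_left_mono power_increasing) auto
    then show "C / 2 ^ l + C / 2 ^ j \<le> 2 * C / 2 ^ j" by simp
  qed
  finally show ?thesis .
qed

text \<open>The modulus must not depend on \<open>m\<close>. For \<open>m \<le> j\<close> the sup
  bound of \<open>c m\<close> suffices; for larger \<open>m\<close>, \<open>c m\<close> is replaced
  by the fixed \<open>c j\<close> at a price of order \<open>C / 2 ^ j\<close>.\<close>

lemma primitive_equicontinuous:
  assumes g: "good C T m \<gamma>" and C: "0 \<le> C" and st: "0 \<le> s" "s \<le> t" "t \<le> 1"
  shows "norm ((LINT r:{0..t}|lborel. c m (r, \<gamma> r)) - (LINT r:{0..s}|lborel. c m (r, \<gamma> r)))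
    \<le> 2 * C / 2 ^ j + (\<Sum>l\<le>j. B l) * (t - s)"
proof -
  have \<gamma>[measurable]: "\<gamma> \<in> borel_measurable borel" using g by (simp add: good_def)
  let ?D = "(LINT r:{0..t}|lborel. c m (r, \<gamma> r)) - (LINT r:{0..s}|lborel. c m (r, \<gamma> r))"
  have Bl: "B l * (t - s) \<le> (\<Sum>l\<le>j. B l) * (t - s)" if "l \<le> j" for l
    using that B_nonneg st by (intro mult_right_mono member_le_sum) auto
  have cm: "(\<lambda>r. c m (r, \<gamma> r)) \<in> borel_measurable borel" by measurable
  show ?thesis
  proof (cases "m \<le> j")
    case True
    have "norm ?D \<le> B m * (t - s)" by (rule primitive_Lipschitz[OF cm c_bound st(1,2)])
    then show ?thesis using Bl[OF True] C by (simp add: add_increasing)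
  next
    case False
    let ?e = "\<lambda>r. ennreal (norm (c m (r, \<gamma> r) - c j (r, \<gamma> r)) * indicator {0..1} r)"
    have "ennreal (norm ?D) \<le> (\<integral>\<^sup>+r. norm (c m (r, \<gamma> r)) * indicator {s<..t} r \<partial>lborel)"
      unfolding primitive_increment[OF cm c_bound st(1,2)] by (rule norm_set_integral_le_nn_integral) simp
    also have "\<dots> \<le> (\<integral>\<^sup>+r. ?e r + ennreal (B j) * indicator {s<..t} r \<partial>lborel)"
    proof (intro nn_integral_mono)
      fix r
      have "norm (c m (r, \<gamma> r)) \<le> norm (c m (r, \<gamma> r) - c j (r, \<gamma> r)) + B j"
        using c_bound[of j "(r, \<gamma> r)"] norm_triangle_sub[of "c m (r, \<gamma> r)" "c j (r, \<gamma> r)"] by simp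
      then have "ennreal (norm (c m (r, \<gamma> r))) \<le> ennreal (norm (c m (r, \<gamma> r) - c j (r, \<gamma> r))) + ennreal (B j)"
        using B_nonneg[of j] by (simp add: ennreal_leI flip: ennreal_plus)
      then show "norm (c m (r, \<gamma> r)) * indicator {s<..t} r \<le> ?e r + ennreal (B j) * indicator {s<..t} r"
        using st by (auto simp: indicator_def)
    qed
    also have "\<dots> = (\<integral>\<^sup>+r. ?e r \<partial>lborel) + ennreal (B j * (t - s))"
      using st B_nonneg by (simp add: nn_integral_add nn_integral_cmult_indicator ennreal_mult)
    also have "(\<integral>\<^sup>+r. ?e r \<partial>lborel) \<le> ennreal (2 * C / 2 ^ j)"
      using False by (intro approximations_close[OF g C]) simp
    finally have "ennreal (norm ?D) \<le> ennreal (2 * C / 2 ^ j + B j * (t - s))"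
      using C st B_nonneg by (simp add: add_mono)
    then have "norm ?D \<le> 2 * C / 2 ^ j + B j * (t - s)"
      using C st B_nonneg by (subst (asm) ennreal_le_iff) auto
    with Bl[OF order_refl] show ?thesis by linarith
  qed
qed

end

lemma set_integral_lborel_singleton: "(LINT r:{0..0::real}|lborel. f r) = (0::'v::euclidean_space)"
  unfolding set_lebesgue_integral_def
proof (rule integral_eq_zero_AE)
  show "AE r in lborel. indicator {0..0::real} r *\<^sub>R f r = 0"
    using AE_lborel_singleton[of "0::real"] by eventually_elim simp
qed

lemma nn_integral_le_of_liminf:
  fixes F :: "nat \<Rightarrow> 'b \<Rightarrow> ennreal"
  assumes "\<And>i. F i \<in> borel_measurable M" "AE x in M. F' x \<le> liminf (\<lambda>i. F i x)"
    and "\<And>i. (\<integral>\<^sup>+x. F i x \<partial>M) \<le> b"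
  shows "(\<integral>\<^sup>+x. F' x \<partial>M) \<le> b"
proof -
  have "(\<integral>\<^sup>+x. F' x \<partial>M) \<le> (\<integral>\<^sup>+x. liminf (\<lambda>i. F i x) \<partial>M)"
    by (rule nn_integral_mono_AE) fact
  also have "\<dots> \<le> liminf (\<lambda>i. \<integral>\<^sup>+x. F i x \<partial>M)"
    by (rule nn_integral_liminf) fact
  also have "\<dots> \<le> limsup (\<lambda>i. \<integral>\<^sup>+x. F i x \<partial>M)" by (rule Liminf_le_Limsup) simp
  also have "\<dots> \<le> b" by (rule Limsup_bounded) (use assms(3) in auto)
  finally show ?thesis .
qed

context field_approximation begin

text \<open>The paths may jump, so Arzela-Ascoli is applied to the primitives \<open>y\<close>. Path
  and primitive differ by the defect, which vanishes in L1, hence almost everywhere along a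
  subsequence, and separately at \<open>T\<close>; at 0 they agree. The limit is shown to solve the
  equation by comparing at a fixed level \<open>j\<close>, where \<open>c j\<close> is continuous,
  and sending \<open>j\<close> to infinity last.\<close>

lemma good_paths_converge:
  assumes good: "\<And>i. good C T (m i) (\<gamma> i)" and m: "\<And>i. i \<le> m i" and C: "0 \<le> C"
    and T: "T \<in> {0..1}" and K: "compact K" "\<And>i. \<gamma> i 0 \<in> K"
  obtains s :: "nat \<Rightarrow> nat" and R where "strict_mono s" "is_flow_solution v (R 0) R" "R 0 \<in> K"
    "(\<lambda>i. \<gamma> (s i) 0) \<longlonglongrightarrow> R 0" "(\<lambda>i. \<gamma> (s i) T) \<longlonglongrightarrow> R T"
proof -
  have \<gamma>[measurable]: "\<gamma> i \<in> borel_measurable borel" for i using good by (simp add: good_def)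
  define y where "y i t = \<gamma> i 0 + (LINT r:{0..t}|lborel. c (m i) (r, \<gamma> i r))" for i t
  have y0: "y i 0 = \<gamma> i 0" for i by (simp only: y_def set_integral_lborel_singleton add_0_right)
  have defect_y: "defect (m i) (\<gamma> i) t = \<gamma> i t - y i t" for i t
    by (simp add: defect_def y_def)
  have y_inc: "norm (y i t - y i s) \<le> 2 * C / 2 ^ j + (\<Sum>l\<le>j. B l) * \<bar>t - s\<bar>"
    if "t \<in> {0..1}" "s \<in> {0..1}" for i t s j
  proof (cases "s \<le> t")
    case True
    then show ?thesis
      using primitive_equicontinuous[OF good C, of s t i j] that by (simp add: y_def)
  next
    case False
    then show ?thesis
      using primitive_equicontinuous[OF good C, of t s i j] that by (simp add: y_def norm_minus_commute)
  qed
  define BB where "BB j = (\<Sum>l\<le>j. B l)" for j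
  have BB: "0 \<le> BB j" for j unfolding BB_def by (intro sum_nonneg B_nonneg)
  have small: "\<exists>j. a * C / 2 ^ j < e" if "0 < e" for a e :: real
  proof -
    have "(\<lambda>j. a * C * (1 / 2) ^ j) \<longlonglongrightarrow> a * C * 0" by (intro tendsto_intros) auto
    then have "\<forall>\<^sub>F j in sequentially. a * C * (1 / 2) ^ j < e"
      using that by (intro order_tendstoD) auto
    then obtain j where "a * C * (1 / 2) ^ j < e" by (auto simp: eventually_sequentially)
    then show ?thesis by (intro exI[of _ j]) (simp add: power_divide)
  qed
  obtain b0 where b0: "\<And>x. x \<in> K \<Longrightarrow> norm x \<le> b0"
    using compact_imp_bounded[OF K(1)] unfolding bounded_iff by blast
  obtain g and k :: "nat \<Rightarrow> nat" where g: "continuous_on {0..1::real} g" and k: "strict_mono k"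
    and unif: "\<And>e. 0 < e \<Longrightarrow> \<exists>N. \<forall>n x. n \<ge> N \<and> x \<in> {0..1} \<longrightarrow> norm (y (k n) x - g x) < e"
  proof (rule Arzela_Ascoli[of "{0..1::real}" y "b0 + (2 * C + BB 0)"])
    \<comment> \<open>Equicontinuity at level \<open>j = 0\<close> over the whole unit time, added
      to the bound \<open>b0\<close> for the compact set of starting points.\<close>
    show "norm (y i x) \<le> b0 + (2 * C + BB 0)" if "x \<in> {0..1}" for i x
    proof -
      have "BB 0 * \<bar>x - 0\<bar> \<le> BB 0 * 1" using that BB by (intro mult_left_mono) auto
      then have "norm (y i x - y i 0) \<le> 2 * C + BB 0"
        using y_inc[OF that, of 0 i 0] unfolding BB_def[symmetric] by simp
      then show ?thesis
        using b0[OF K(2)[of i]] norm_triangle_sub[of "y i x" "y i 0"] by (simp add: y0)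
    qed
    show "\<exists>d>0. \<forall>n y'. y' \<in> {0..1} \<and> norm (x - y') < d \<longrightarrow> norm (y n x - y n y') < e"
      if x: "x \<in> {0..1}" and e: "0 < e" for x e :: real
    proof -
      obtain j where j: "2 * C / 2 ^ j < e / 2" using small[of "e / 2" 2] e by auto
      define d where "d = e / (2 * (BB j + 1))"
      have d: "0 < d" using e BB[of j] by (simp add: d_def)
      have "norm (y n x - y n x') < e" if x': "x' \<in> {0..1}" "norm (x - x') < d" for n x'
      proof -
        have "BB j * \<bar>x - x'\<bar> \<le> (BB j + 1) * d"
          using x' BB[of j] by (intro mult_mono) auto
        also have "\<dots> = e / 2" using BB[of j] by (simp add: d_def field_simps)
        finally show ?thesis using y_inc[OF x x'(1), of n j] j unfolding BB_def[symmetric] by linarith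
      qed
      with d show ?thesis by blast
    qed
  qed auto
  define R where "R t = g (max 0 (min 1 t))" for t
  have R_cont: "continuous_on UNIV R"
    unfolding R_def by (rule continuous_on_compose2[OF g]) (auto intro!: continuous_intros)
  have [measurable]: "R \<in> borel_measurable borel" by (rule borel_measurable_continuous_onI[OF R_cont])
  have y_lim: "(\<lambda>i. y (k i) t) \<longlonglongrightarrow> R t" if t: "t \<in> {0..1}" for t
  proof (rule LIMSEQ_I)
    fix e :: real assume "0 < e"
    then obtain N where N: "\<forall>n x. n \<ge> N \<and> x \<in> {0..1} \<longrightarrow> norm (y (k n) x - g x) < e"
      using unif by blast
    have "max 0 (min 1 t) = t" using t by auto
    then show "\<exists>no. \<forall>n\<ge>no. norm (y (k n) t - R t) < e"
      using N t by (intro exI[of _ N]) (simp add: R_def)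
  qed
  define u where "u i t = indicator {0..1} t *\<^sub>R defect (m (k i)) (\<gamma> (k i)) t" for i t
  have dm[measurable]: "defect j (\<gamma> i) \<in> borel_measurable borel" for i j
    unfolding defect_def
  proof (intro borel_measurable_diff measurable_primitive)
    have "(\<lambda>x. c j (snd x, \<gamma> i (snd x))) \<in> borel_measurable (borel \<Otimes>\<^sub>M lborel)"
      by (rule measurable_compose[OF measurable_snd, of "\<lambda>r. c j (r, \<gamma> i r)"]) simp
    then show "(\<lambda>x. c j (snd x, \<gamma> i (snd x))) \<in> borel_measurable ((borel :: real measure) \<Otimes>\<^sub>M lborel)" .
  qed measurable
  have u_nn: "(\<integral>\<^sup>+t. norm (u i t) \<partial>lborel) \<le> ennreal (C / 2 ^ i)" for i
  proof -
    have "(\<integral>\<^sup>+t. norm (u i t) \<partial>lborel) = (\<integral>\<^sup>+t. norm (defect (m (k i)) (\<gamma> (k i)) t) * indicator {0..1} t \<partial>lborel)"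
      by (intro nn_integral_cong) (auto simp: u_def indicator_def)
    also have "\<dots> \<le> ennreal (C / 2 ^ m (k i))" using good[of "k i"] by (simp add: good_def)
    also have "\<dots> \<le> ennreal (C / 2 ^ i)"
      using C m[of "k i"] seq_suble[OF k, of i]
      by (intro ennreal_leI divide_left_mono power_increasing) auto
    finally show ?thesis .
  qed
  have u_int: "integrable lborel (u i)" for i
  proof (rule integrableI_bounded)
    show "u i \<in> borel_measurable lborel" unfolding u_def by measurable
    show "(\<integral>\<^sup>+t. norm (u i t) \<partial>lborel) < \<infinity>"
      using u_nn[of i] by (rule le_less_trans) simp
  qed
  have "(\<lambda>i. \<integral>t. norm (u i t) \<partial>lborel) \<longlonglongrightarrow> 0"
  proof (rule tendsto_sandwich[of "\<lambda>_. 0" _ _ "\<lambda>i. C * (1 / 2) ^ i"])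
    show "\<forall>\<^sub>F i in sequentially. (\<integral>t. norm (u i t) \<partial>lborel) \<le> C * (1 / 2) ^ i"
    proof (intro always_eventually allI)
      fix i
      have "ennreal (\<integral>t. norm (u i t) \<partial>lborel) \<le> ennreal (C / 2 ^ i)"
        using u_nn[of i] u_int[of i] by (subst (asm) nn_integral_eq_integral) auto
      then show "(\<integral>t. norm (u i t) \<partial>lborel) \<le> C * (1 / 2) ^ i"
        using C by (subst (asm) ennreal_le_iff) (auto simp: power_divide)
    qed
    have "(\<lambda>i. C * (1 / 2) ^ i) \<longlonglongrightarrow> C * 0" by (intro tendsto_intros) auto
    then show "(\<lambda>i. C * (1 / 2) ^ i) \<longlonglongrightarrow> 0" by simp
  qed auto
  from tendsto_L1_AE_subseq[OF u_int this]
  obtain r :: "nat \<Rightarrow> nat" where r: "strict_mono r" and u_AE: "AE t in lborel. (\<lambda>i. u (r i) t) \<longlonglongrightarrow> 0"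
    by auto
  define s where "s = k \<circ> r"
  have s: "strict_mono s" unfolding s_def using k r by (rule strict_mono_o)
  have ms: "i \<le> m (s i)" for i using m[of "s i"] seq_suble[OF s, of i] by linarith
  have ys: "(\<lambda>i. y (s i) t) \<longlonglongrightarrow> R t" if "t \<in> {0..1}" for t
    using LIMSEQ_subseq_LIMSEQ[OF y_lim[OF that] r] by (simp add: s_def comp_def)
  have \<gamma>_AE: "AE t in lborel. t \<in> {0..1} \<longrightarrow> (\<lambda>i. \<gamma> (s i) t) \<longlonglongrightarrow> R t"
    using u_AE
  proof eventually_elim
    case (elim t)
    show ?case
    proof
      assume t: "t \<in> {0..1}"
      then have "(\<lambda>i. \<gamma> (s i) t - y (s i) t) \<longlonglongrightarrow> 0"
        using elim by (simp add: u_def defect_y s_def)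
      from tendsto_add[OF this ys[OF t]] show "(\<lambda>i. \<gamma> (s i) t) \<longlonglongrightarrow> R t" by simp
    qed
  qed
  have start: "(\<lambda>i. \<gamma> (s i) 0) \<longlonglongrightarrow> R 0" using ys[of 0] by (simp add: y0)
  have end_T: "(\<lambda>i. \<gamma> (s i) T) \<longlonglongrightarrow> R T"
  proof -
    have "(\<lambda>i. defect (m (s i)) (\<gamma> (s i)) T) \<longlonglongrightarrow> 0"
    proof (rule Lim_null_comparison)
      show "\<forall>\<^sub>F i in sequentially. norm (defect (m (s i)) (\<gamma> (s i)) T) \<le> C * (1 / 2) ^ i"
      proof (intro always_eventually allI)
        fix i
        have "norm (defect (m (s i)) (\<gamma> (s i)) T) \<le> C / 2 ^ m (s i)" using good by (simp add: good_def)
        also have "\<dots> \<le> C / 2 ^ i"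
          using C ms by (intro divide_left_mono power_increasing) auto
        finally show "norm (defect (m (s i)) (\<gamma> (s i)) T) \<le> C * (1 / 2) ^ i" by (simp add: power_divide)
      qed
      have "(\<lambda>i. C * (1 / 2) ^ i) \<longlonglongrightarrow> C * 0" by (intro tendsto_intros) auto
      then show "(\<lambda>i. C * (1 / 2) ^ i) \<longlonglongrightarrow> 0" by simp
    qed
    from tendsto_add[OF this ys[OF T]] show ?thesis by (simp add: defect_y)
  qed
  have c_lim: "(\<lambda>i. c j (t, \<gamma> (s i) t)) \<longlonglongrightarrow> c j (t, R t)" if "(\<lambda>i. \<gamma> (s i) t) \<longlonglongrightarrow> R t" for j t
    by (rule continuous_on_tendsto_compose[OF c_cont]) (use that in \<open>simp_all add: tendsto_Pair\<close>)
  \<comment> \<open>Since \<open>U j\<close> is open, whenever the limit path is in it at a time of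
    convergence, the approximating paths eventually are; this is the semicontinuity that Fatou
    needs.\<close>
  have U_limit: "(\<integral>\<^sup>+t. indicator (U j) (t, R t) * indicator {0..1} t \<partial>lborel) \<le> ennreal (C / 2 ^ j)" for j
  proof (rule nn_integral_le_of_liminf[where F="\<lambda>i t. indicator (U j) (t, \<gamma> (s i) t) * indicator {0..1} t"])
    show "AE t in lborel. indicator (U j) (t, R t) * indicator {0..1} t
        \<le> liminf (\<lambda>i. indicator (U j) (t, \<gamma> (s i) t) * indicator {0..1} t :: ennreal)"
      using \<gamma>_AE
    proof eventually_elim
      case (elim t)
      show ?case
      proof (cases "t \<in> {0..1} \<and> (t, R t) \<in> U j")
        case True
        then have "(\<lambda>i. (t, \<gamma> (s i) t)) \<longlonglongrightarrow> (t, R t)" using elim by (intro tendsto_intros) auto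
        then have "\<forall>\<^sub>F i in sequentially. (t, \<gamma> (s i) t) \<in> U j"
          using topological_tendstoD[OF _ U_open] True by blast
        then show ?thesis
          by (intro Liminf_bounded) (auto elim!: eventually_mono simp: indicator_def)
      qed (auto simp: indicator_def)
    qed
    show "(\<integral>\<^sup>+t. indicator (U j) (t, \<gamma> (s i) t) * indicator {0..1} t \<partial>lborel) \<le> ennreal (C / 2 ^ j)" for i
      by (rule good_bounds(2)[OF good C])
  qed measurable
  \<comment> \<open>The exceptional times are those at which \<open>(t, R t)\<close> lies in all
    \<open>U j\<close>; their measure is at most \<open>C / 2 ^ j\<close> for every
    \<open>j\<close>, hence zero.\<close>
  have AE_conv: "AE t in lborel. t \<in> {0..1} \<longrightarrow> (\<lambda>j. c j (t, R t)) \<longlonglongrightarrow> v t (R t)"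
  proof -
    define N where "N t = (if \<forall>j. (t, R t) \<in> U j then 1 else 0 :: ennreal) * indicator {0..1} t" for t :: real
    have N[measurable]: "N \<in> borel_measurable borel" unfolding N_def by measurable
    have N_small: "(\<integral>\<^sup>+t. N t \<partial>lborel) \<le> ennreal e" if "0 < e" for e
    proof -
      obtain j where j: "1 * C / 2 ^ j < e" using small \<open>0 < e\<close> by blast
      have "(\<integral>\<^sup>+t. N t \<partial>lborel) \<le> (\<integral>\<^sup>+t. indicator (U j) (t, R t) * indicator {0..1} t \<partial>lborel)"
        by (intro nn_integral_mono) (auto simp: N_def indicator_def)
      also have "\<dots> \<le> ennreal (C / 2 ^ j)" by (rule U_limit)
      also have "\<dots> \<le> ennreal e" using j by (intro ennreal_leI) simp
      finally show ?thesis .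
    qed
    have "(\<integral>\<^sup>+t. N t \<partial>lborel) \<le> 0"
    proof (rule ennreal_le_epsilon)
      show "(\<integral>\<^sup>+t. N t \<partial>lborel) \<le> 0 + ennreal e" if "0 < e" for e
        using N_small[OF that] by simp
    qed
    then have "(\<integral>\<^sup>+t. N t \<partial>lborel) = 0" by simp
    then have "AE t in lborel. N t = 0"
      by (subst (asm) nn_integral_0_iff_AE) simp_all
    then show ?thesis
    proof eventually_elim
      case (elim t)
      then show ?case using c_conv[of "(t, R t)"] by (auto simp: N_def split: if_splits)
    qed
  qed
  \<comment> \<open>The difference of \<open>v\<close> and \<open>c j\<close> cannot be passed to
    the limit in the path, since \<open>v\<close> need not be continuous; differences of two
    approximants can.\<close>
  have cc_limit: "(\<integral>\<^sup>+t. norm (c l (t, R t) - c j (t, R t)) * indicator {0..1} t \<partial>lborel) \<le> ennreal (2 * C / 2 ^ j)"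
    if "j \<le> l" for j l
  proof (rule nn_integral_le_of_liminf[where F="\<lambda>i t. norm (c l (t, \<gamma> (s i) t) - c j (t, \<gamma> (s i) t)) * indicator {0..1} t"])
    show "AE t in lborel. ennreal (norm (c l (t, R t) - c j (t, R t)) * indicator {0..1} t)
        \<le> liminf (\<lambda>i. ennreal (norm (c l (t, \<gamma> (s i) t) - c j (t, \<gamma> (s i) t)) * indicator {0..1} t))"
      using \<gamma>_AE
    proof eventually_elim
      case (elim t)
      show ?case
      proof (cases "t \<in> {0..1}")
        case True
        then have "(\<lambda>i. ennreal (norm (c l (t, \<gamma> (s i) t) - c j (t, \<gamma> (s i) t)) * indicator {0..1} t)) \<longlonglongrightarrow>
            ennreal (norm (c l (t, R t) - c j (t, R t)) * indicator {0..1} t)"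
          using elim by (intro tendsto_ennrealI tendsto_intros c_lim) auto
        from lim_imp_Liminf[OF _ this] show ?thesis by simp
      qed simp
    qed
    show "(\<integral>\<^sup>+t. norm (c l (t, \<gamma> (s i) t) - c j (t, \<gamma> (s i) t)) * indicator {0..1} t \<partial>lborel) \<le> ennreal (2 * C / 2 ^ j)" for i
      by (rule approximations_close[OF good C that])
  qed measurable
  \<comment> \<open>Second limit, now along the fixed path \<open>R\<close>: the upper level tends
    to infinity, and \<open>c (l + j)\<close> tends to \<open>v\<close> by
    \<open>AE_conv\<close>.\<close>
  have vc_limit: "(\<integral>\<^sup>+t. norm (v t (R t) - c j (t, R t)) * indicator {0..1} t \<partial>lborel) \<le> ennreal (2 * C / 2 ^ j)" for j
  proof (rule nn_integral_le_of_liminf[where F="\<lambda>l t. norm (c (l + j) (t, R t) - c j (t, R t)) * indicator {0..1} t"])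
    show "AE t in lborel. ennreal (norm (v t (R t) - c j (t, R t)) * indicator {0..1} t)
        \<le> liminf (\<lambda>l. ennreal (norm (c (l + j) (t, R t) - c j (t, R t)) * indicator {0..1} t))"
      using AE_conv
    proof eventually_elim
      case (elim t)
      show ?case
      proof (cases "t \<in> {0..1}")
        case True
        then have "(\<lambda>l. c (l + j) (t, R t)) \<longlonglongrightarrow> v t (R t)"
          using elim by (intro LIMSEQ_ignore_initial_segment) auto
        then have "(\<lambda>l. ennreal (norm (c (l + j) (t, R t) - c j (t, R t)) * indicator {0..1} t)) \<longlonglongrightarrow>
            ennreal (norm (v t (R t) - c j (t, R t)) * indicator {0..1} t)"
          by (intro tendsto_ennrealI tendsto_intros)
        from lim_imp_Liminf[OF _ this] show ?thesis by simp
      qed simp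
    qed
    show "(\<integral>\<^sup>+t. norm (c (l + j) (t, R t) - c j (t, R t)) * indicator {0..1} t \<partial>lborel) \<le> ennreal (2 * C / 2 ^ j)" for l
      by (rule cc_limit) simp
  qed measurable
  have c_int: "set_integrable lborel {0..t} (\<lambda>r. c j (r, R r))" for j t
    by (rule set_integrable_bounded_interval[OF _ c_bound]) measurable
  have cR_meas: "(\<lambda>r. c j (r, R r)) \<in> borel_measurable borel" for j by measurable
  have diff_int: "set_integrable lborel {0..1} (\<lambda>r. v r (R r) - c 0 (r, R r))"
    unfolding set_integrable_def
  proof (rule integrableI_bounded)
    have "(\<integral>\<^sup>+r. norm (indicator {0..1} r *\<^sub>R (v r (R r) - c 0 (r, R r))) \<partial>lborel) =
        (\<integral>\<^sup>+r. norm (v r (R r) - c 0 (r, R r)) * indicator {0..1} r \<partial>lborel)"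
      by (intro nn_integral_cong) (auto simp: indicator_def)
    also have "\<dots> < \<infinity>" using vc_limit[of 0] by (rule le_less_trans) simp
    finally show "(\<integral>\<^sup>+r. norm (indicator {0..1} r *\<^sub>R (v r (R r) - c 0 (r, R r))) \<partial>lborel) < \<infinity>" .
  qed measurable
  have v_int: "set_integrable lborel {0..t} (\<lambda>r. v r (R r))" if "t \<in> {0..1}" for t
  proof -
    have "set_integrable lborel {0..1} (\<lambda>r. v r (R r))"
      using set_integral_add(1)[OF diff_int c_int[where j=0 and t=1]] by simp
    then show ?thesis by (rule set_integrable_subset) (use that in auto)
  qed
  have "R t = R 0 + (LINT r:{0..t}|lborel. v r (R r))" if t: "t \<in> {0..1}" for t
  proof -
    let ?I = "LINT r:{0..t}|lborel. v r (R r)"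
    have lim: "(\<lambda>i. norm (y (s i) t - \<gamma> (s i) 0 - ?I)) \<longlonglongrightarrow> norm (R t - R 0 - ?I)"
      by (intro tendsto_intros ys[OF t] start)
    \<comment> \<open>Replacing the approximant of the path's own level by \<open>c j\<close>, and
      \<open>v\<close> along \<open>R\<close> by \<open>c j\<close>, costs
      \<open>2 * C / 2 ^ j\<close> each; the remaining difference tends to 0 for fixed
      \<open>j\<close> by continuity and boundedness of \<open>c j\<close>.\<close>
    have bound: "norm (R t - R 0 - ?I) \<le> 4 * C / 2 ^ j" for j
    proof -
      let ?\<delta> = "\<lambda>i. norm ((LINT r:{0..t}|lborel. c j (r, \<gamma> (s i) r)) - (LINT r:{0..t}|lborel. c j (r, R r)))"
      have "(\<lambda>i. LINT r:{0..t}|lborel. c j (r, \<gamma> (s i) r)) \<longlonglongrightarrow> (LINT r:{0..t}|lborel. c j (r, R r))"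
        unfolding set_lebesgue_integral_def
      proof (rule integral_dominated_convergence[where w="\<lambda>r. indicator {0..t} r *\<^sub>R B j"])
        show "integrable lborel (\<lambda>r. indicator {0..t} r *\<^sub>R B j)"
          using set_integrable_bounded_interval[of "\<lambda>_. B j" "\<bar>B j\<bar>" 0 t] by (simp add: set_integrable_def)
        show "AE r in lborel. (\<lambda>i. indicator {0..t} r *\<^sub>R c j (r, \<gamma> (s i) r)) \<longlonglongrightarrow> indicator {0..t} r *\<^sub>R c j (r, R r)"
          using \<gamma>_AE
        proof eventually_elim
          case (elim r)
          then show ?case using t by (cases "r \<in> {0..t}") (auto intro!: c_lim)
        qed
        show "AE r in lborel. norm (indicator {0..t} r *\<^sub>R c j (r, \<gamma> (s i) r)) \<le> indicator {0..t} r *\<^sub>R B j" for i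
          using c_bound by (intro AE_I2) (auto simp: indicator_def)
      qed measurable
      then have \<delta>: "?\<delta> \<longlonglongrightarrow> 0" by (intro tendsto_norm_zero) (simp add: LIM_zero)
      have "(\<lambda>i. ?\<delta> i + 4 * C / 2 ^ j) \<longlonglongrightarrow> 0 + 4 * C / 2 ^ j" by (intro tendsto_intros \<delta>)
      moreover have "norm (y (s i) t - \<gamma> (s i) 0 - ?I) \<le> ?\<delta> i + 4 * C / 2 ^ j" if i: "j \<le> i" for i
      proof -
        let ?m = "m (s i)" and ?g = "\<gamma> (s i)"
        have gi: "set_integrable lborel {0..t} (\<lambda>r. c l (r, ?g r))" for l
          by (rule set_integrable_bounded_interval[OF _ c_bound]) measurable
        have A: "norm (LINT r:{0..t}|lborel. c ?m (r, ?g r) - c j (r, ?g r)) \<le> 2 * C / 2 ^ j"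
        proof -
          have "ennreal (norm (LINT r:{0..t}|lborel. c ?m (r, ?g r) - c j (r, ?g r)))
              \<le> (\<integral>\<^sup>+r. norm (c ?m (r, ?g r) - c j (r, ?g r)) * indicator {0..1} r \<partial>lborel)"
            by (rule norm_set_integral_le_nn_integral) (use t in auto)
          also have "\<dots> \<le> ennreal (2 * C / 2 ^ j)"
            using i ms[of i] by (intro approximations_close[OF good C]) simp
          finally show ?thesis using C by (subst (asm) ennreal_le_iff) auto
        qed
        have Bd: "norm (LINT r:{0..t}|lborel. v r (R r) - c j (r, R r)) \<le> 2 * C / 2 ^ j"
        proof -
          have "ennreal (norm (LINT r:{0..t}|lborel. v r (R r) - c j (r, R r)))
              \<le> (\<integral>\<^sup>+r. norm (v r (R r) - c j (r, R r)) * indicator {0..1} r \<partial>lborel)"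
            by (rule norm_set_integral_le_nn_integral) (use t in auto)
          also have "\<dots> \<le> ennreal (2 * C / 2 ^ j)" by (rule vc_limit)
          finally show ?thesis using C by (subst (asm) ennreal_le_iff) auto
        qed
        have "y (s i) t - ?g 0 - ?I = (LINT r:{0..t}|lborel. c ?m (r, ?g r) - c j (r, ?g r))
            + ((LINT r:{0..t}|lborel. c j (r, ?g r)) - (LINT r:{0..t}|lborel. c j (r, R r)))
            - (LINT r:{0..t}|lborel. v r (R r) - c j (r, R r))"
          unfolding y_def set_integral_diff(2)[OF gi gi] set_integral_diff(2)[OF v_int[OF t] c_int] by simp
        moreover have "norm (a + b - d) \<le> norm a + norm b + norm d" for a b d :: 'a
          by (meson add_mono norm_triangle_ineq norm_triangle_ineq4 order_refl order_trans)
        ultimately have "norm (y (s i) t - ?g 0 - ?I) \<le>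
            norm (LINT r:{0..t}|lborel. c ?m (r, ?g r) - c j (r, ?g r)) + ?\<delta> i
            + norm (LINT r:{0..t}|lborel. v r (R r) - c j (r, R r))"
          by simp
        then show ?thesis using A Bd by simp
      qed
      ultimately show ?thesis
        using lim by (intro LIMSEQ_le[where X="\<lambda>i. norm (y (s i) t - \<gamma> (s i) 0 - ?I)"]) auto
    qed
    have "norm (R t - R 0 - ?I) \<le> 0"
    proof (rule field_le_epsilon)
      fix e :: real assume "0 < e"
      then obtain j where "4 * C / 2 ^ j < e" using small[of e 4] by blast
      then show "norm (R t - R 0 - ?I) \<le> 0 + e" using bound[of j] by simp
    qed
    then show ?thesis by (simp add: algebra_simps)
  qed
  then have "is_flow_solution v (R 0) R"
    unfolding is_flow_solution_def using v_int by blast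
  moreover have "R 0 \<in> K"
    by (rule closed_sequentially[OF compact_imp_closed[OF K(1)] _ start]) (rule K(2))
  ultimately show thesis by (intro that[of s R] s start end_T)
qed

end

section \<open>Limits of end points\<close>

context field_approximation begin

definition endpoints :: "real \<Rightarrow> real \<Rightarrow> 'a set \<Rightarrow> nat \<Rightarrow> ('a \<times> 'a) set" where
  "endpoints C T K n = {(\<gamma> 0, \<gamma> T) | \<gamma> m. n \<le> m \<and> good C T m \<gamma> \<and> \<gamma> 0 \<in> K}"

text \<open>Working with this closed set of limits of end point pairs replaces a limit measure on path
  space, hence no Prokhorov theorem is needed.\<close>

definition limit_graph :: "real \<Rightarrow> real \<Rightarrow> 'a set \<Rightarrow> ('a \<times> 'a) set" where
  "limit_graph C T K = (\<Inter>n. closure (endpoints C T K n))"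

text \<open>Once uniqueness provides a flow map \<open>\<Phi>\<close>, this is the preimage of
  \<open>F\<close> under \<open>\<Phi>\<close>, cut down to the starting points of limit
  pairs.\<close>

definition starts :: "real \<Rightarrow> real \<Rightarrow> 'a set \<Rightarrow> 'a set \<Rightarrow> 'a set" where
  "starts C T K F = fst ` (limit_graph C T K \<inter> UNIV \<times> F)"

context
  fixes C T :: real and K :: "'a set" and \<Phi> :: "'a \<Rightarrow> 'a"
  assumes C: "0 \<le> C" and T: "T \<in> {0..1}" and K: "compact K"
    and unique: "\<And>x R. x \<in> K \<Longrightarrow> is_flow_solution v x R \<Longrightarrow> R T = \<Phi> x"
begin

lemma endpoints_subseq:
  assumes p: "\<And>i. p i \<in> endpoints C T K i"
  obtains s x where "strict_mono s" "x \<in> K" "(\<lambda>i. p (s i)) \<longlonglongrightarrow> (x, \<Phi> x)"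
proof -
  have "\<forall>i. \<exists>\<gamma> m. p i = (\<gamma> 0, \<gamma> T) \<and> i \<le> m \<and> good C T m \<gamma> \<and> \<gamma> 0 \<in> K"
    using p unfolding endpoints_def by blast
  from choice[OF this] obtain \<gamma> where
    "\<forall>i. \<exists>m. p i = (\<gamma> i 0, \<gamma> i T) \<and> i \<le> m \<and> good C T m (\<gamma> i) \<and> \<gamma> i 0 \<in> K" by (elim exE)
  from choice[OF this] obtain m where
    all: "\<forall>i. p i = (\<gamma> i 0, \<gamma> i T) \<and> i \<le> m i \<and> good C T (m i) (\<gamma> i) \<and> \<gamma> i 0 \<in> K" by (elim exE)
  obtain s R where s: "strict_mono s" and R: "is_flow_solution v (R 0) R" "R 0 \<in> K"
    and lim: "(\<lambda>i. \<gamma> (s i) 0) \<longlonglongrightarrow> R 0" "(\<lambda>i. \<gamma> (s i) T) \<longlonglongrightarrow> R T"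
    by (rule good_paths_converge[of C T m \<gamma> K]) (use all C T K in auto)
  have "(\<lambda>i. p (s i)) \<longlonglongrightarrow> (R 0, R T)"
    using tendsto_Pair[OF lim] all by simp
  with unique[OF R(2,1)] show thesis using s R(2) by (intro that[of s "R 0"]) auto
qed

lemma endpoints_antimono: "n \<le> n' \<Longrightarrow> endpoints C T K n' \<subseteq> endpoints C T K n"
  unfolding endpoints_def by (blast intro: order_trans)

lemma limit_in_limit_graph:
  assumes p: "\<And>i. p i \<in> endpoints C T K i" and s: "strict_mono s" and lim: "(\<lambda>i. p (s i)) \<longlonglongrightarrow> z"
  shows "z \<in> limit_graph C T K"
  unfolding limit_graph_def
proof
  fix n
  have 1: "p (s (i + n)) \<in> closure (endpoints C T K n)" for i
    using p[of "s (i + n)"] endpoints_antimono[of n "s (i + n)"] seq_suble[OF s, of "i + n"] closure_subset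
    by (auto dest!: subsetD)
  have 2: "(\<lambda>i. p (s (i + n))) \<longlonglongrightarrow> z" using lim by (rule LIMSEQ_ignore_initial_segment)
  show "z \<in> closure (endpoints C T K n)" by (rule closed_sequentially[OF closed_closure 1 2])
qed

lemma closed_limit_graph: "closed (limit_graph C T K)"
  unfolding limit_graph_def by auto

text \<open>Each \<open>q i\<close> is approximated by a pair of level \<open>i\<close> within
  \<open>1 / Suc i\<close>, which carries the compactness of end point pairs over to the closed
  limit set. The constant sequence then shows that limit pairs lie on the graph of
  \<open>\<Phi>\<close>.\<close>

lemma limit_graph_approx:
  fixes q :: "nat \<Rightarrow> 'a \<times> 'a"
  assumes q: "\<And>i. q i \<in> limit_graph C T K"
  obtains s x where "strict_mono s" "x \<in> K" "(\<lambda>i. q (s i)) \<longlonglongrightarrow> (x, \<Phi> x)"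
proof -
  have "\<forall>i. \<exists>p. p \<in> endpoints C T K i \<and> dist p (q i) < 1 / real (Suc i)"
  proof
    fix i
    have "q i \<in> closure (endpoints C T K i)" using q[of i] unfolding limit_graph_def by blast
    moreover have "0 < 1 / real (Suc i)" by simp
    ultimately show "\<exists>p. p \<in> endpoints C T K i \<and> dist p (q i) < 1 / real (Suc i)"
      unfolding closure_approachable by blast
  qed
  from choice[OF this] obtain p where p: "\<And>i. p i \<in> endpoints C T K i"
    and d: "\<And>i. dist (p i) (q i) < 1 / real (Suc i)" by blast
  obtain s x where s: "strict_mono s" and x: "x \<in> K" and lim: "(\<lambda>i. p (s i)) \<longlonglongrightarrow> (x, \<Phi> x)"
    by (rule endpoints_subseq[OF p])
  have "(\<lambda>i. q i - p i) \<longlonglongrightarrow> 0"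
  proof (rule Lim_null_comparison)
    show "\<forall>\<^sub>F i in sequentially. norm (q i - p i) \<le> 1 / real (Suc i)"
      using d by (intro always_eventually allI less_imp_le) (simp add: dist_norm norm_minus_commute)
    show "(\<lambda>i. 1 / real (Suc i)) \<longlonglongrightarrow> 0" using LIMSEQ_inverse_real_of_nat by (simp add: inverse_eq_divide)
  qed
  from tendsto_add[OF LIMSEQ_subseq_LIMSEQ[OF this s] lim]
  have "(\<lambda>i. q (s i)) \<longlonglongrightarrow> (x, \<Phi> x)" by (simp add: comp_def flip: zero_prod_def)
  then show thesis by (rule that[OF s x])
qed

lemma limit_graph_subset: "z \<in> limit_graph C T K \<Longrightarrow> fst z \<in> K \<and> snd z = \<Phi> (fst z)"
proof -
  assume "z \<in> limit_graph C T K"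
  then obtain s :: "nat \<Rightarrow> nat" and x where "x \<in> K" "(\<lambda>i. z) \<longlonglongrightarrow> (x, \<Phi> x)"
    by (rule limit_graph_approx[of "\<lambda>_. z"])
  then have "z = (x, \<Phi> x)" by (simp add: LIMSEQ_const_iff)
  with \<open>x \<in> K\<close> show ?thesis by simp
qed

text \<open>With \<open>closed_starts\<close> the source of measurability: on the closed set
  \<open>starts C T K UNIV\<close> the preimage of a closed set under \<open>\<Phi>\<close> is again
  closed.\<close>

lemma starts_iff: "x \<in> starts C T K F \<longleftrightarrow> x \<in> starts C T K UNIV \<and> \<Phi> x \<in> F"
  using limit_graph_subset by (fastforce simp: starts_def image_iff)

text \<open>Projections of closed sets need not be closed; here the second components converge along
  a subsequence because \<open>limit_graph_approx\<close> provides compactness.\<close>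

lemma closed_starts:
  assumes F: "closed F"
  shows "closed (starts C T K F)"
  unfolding closed_sequential_limits
proof (intro allI impI, elim conjE)
  fix x l assume x: "\<forall>n. x n \<in> starts C T K F" and lim: "x \<longlonglongrightarrow> l"
  have q: "(x i, \<Phi> (x i)) \<in> limit_graph C T K" "\<Phi> (x i) \<in> F" for i
  proof -
    obtain z where z: "z \<in> limit_graph C T K" "snd z \<in> F" "fst z = x i"
      using x[rule_format, of i] by (auto simp: starts_def)
    then have "z = (x i, \<Phi> (x i))" using limit_graph_subset[OF z(1)] by (auto simp: prod_eq_iff)
    with z show "(x i, \<Phi> (x i)) \<in> limit_graph C T K" "\<Phi> (x i) \<in> F" by auto
  qed
  obtain s y where s: "strict_mono s" and y: "(\<lambda>i. (x (s i), \<Phi> (x (s i)))) \<longlonglongrightarrow> (y, \<Phi> y)"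
    by (rule limit_graph_approx[OF q(1)])
  have "(\<lambda>i. x (s i)) \<longlonglongrightarrow> y" using tendsto_fst[OF y] by simp
  moreover have "(\<lambda>i. x (s i)) \<longlonglongrightarrow> l" using LIMSEQ_subseq_LIMSEQ[OF lim s] by (simp add: comp_def)
  ultimately have "y = l" by (rule LIMSEQ_unique)
  have "(y, \<Phi> y) \<in> limit_graph C T K"
    by (rule closed_sequentially[OF closed_limit_graph _ y]) (rule q(1))
  moreover have "\<Phi> y \<in> F"
    by (rule closed_sequentially[OF F, of "\<lambda>i. \<Phi> (x (s i))"]) (use q(2) tendsto_snd[OF y] in auto)
  ultimately show "l \<in> starts C T K F"
    unfolding starts_def \<open>y = l\<close> by (intro image_eqI[of _ _ "(l, \<Phi> l)"]) auto
qed

text \<open>Pairs of ever higher level ending in \<open>F\<close> and starting off \<open>V\<close>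
  would accumulate at a limit pair ending in \<open>F\<close> whose start lies off the open set
  \<open>V\<close>. This brings the statement about limits down to one finite level, where actual
  random paths exist.\<close>

lemma endpoints_eventually_near:
  assumes F: "closed F" and V: "open V" "starts C T K F \<subseteq> V"
  shows "\<exists>n. \<forall>z\<in>endpoints C T K n. snd z \<in> F \<longrightarrow> fst z \<in> V"
proof (rule ccontr)
  assume "\<not> ?thesis"
  then have "\<forall>n. \<exists>z. z \<in> endpoints C T K n \<and> snd z \<in> F \<and> fst z \<in> - V" by blast
  from choice[OF this] obtain p where p: "\<And>n. p n \<in> endpoints C T K n"
    and pF: "\<And>n. snd (p n) \<in> F" and pV: "\<And>n. fst (p n) \<in> - V" by blast
  obtain s x where s: "strict_mono s" and lim: "(\<lambda>i. p (s i)) \<longlonglongrightarrow> (x, \<Phi> x)"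
    by (rule endpoints_subseq[OF p])
  have "(x, \<Phi> x) \<in> limit_graph C T K" by (rule limit_in_limit_graph[OF p s lim])
  moreover have "\<Phi> x \<in> F"
    by (rule closed_sequentially[OF F, of "\<lambda>i. snd (p (s i))"]) (use pF tendsto_snd[OF lim] in auto)
  moreover have "x \<in> - V"
    by (rule closed_sequentially[of "- V" "\<lambda>i. fst (p (s i))"]) (use V pV tendsto_fst[OF lim] in auto)
  ultimately show False using V(2) by (force simp: starts_def)
qed

end

end

text \<open>Inner regularity carries the inequality from compact sets to all Borel sets; applied to
  complements, with equal total mass, it reverses.\<close>

lemma prob_measure_eqI_closed:
  fixes M N :: "'a::euclidean_space measure"
  assumes M: "prob_space M" "sets M = sets borel" and N: "prob_space N" "sets N = sets borel"
    and le: "\<And>F. closed F \<Longrightarrow> emeasure M F \<le> emeasure N F"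
  shows "M = N"
proof (rule measure_eqI)
  interpret M: prob_space M by fact
  interpret N: prob_space N by fact
  have sp: "space M = UNIV" "space N = UNIV"
    using sets_eq_imp_space_eq[OF M(2)] sets_eq_imp_space_eq[OF N(2)] by auto
  have le_all: "emeasure M A \<le> emeasure N A" if A: "A \<in> sets borel" for A
  proof -
    have "emeasure M A = (SUP K \<in> {K. K \<subseteq> A \<and> compact K}. emeasure M K)"
      by (rule inner_regular[OF M(2) _ A]) simp
    also have "\<dots> \<le> emeasure N A"
    proof (rule SUP_least)
      fix K assume "K \<in> {K. K \<subseteq> A \<and> compact K}"
      then have K: "closed K" "K \<subseteq> A" using compact_imp_closed by auto
      have "emeasure M K \<le> emeasure N K" by (rule le[OF K(1)])
      also have "\<dots> \<le> emeasure N A" using A K(2) N(2) by (intro emeasure_mono) auto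
      finally show "emeasure M K \<le> emeasure N A" .
    qed
    finally show ?thesis .
  qed
  show "sets M = sets N" using M N by simp
  fix A assume "A \<in> sets M"
  then have A: "A \<in> sets borel" using M by simp
  have "measure M (- A) \<le> measure N (- A)"
    using le_all[of "- A"] A by (simp add: M.emeasure_eq_measure N.emeasure_eq_measure)
  then have "measure N A \<le> measure M A"
    using M.prob_compl[of A] N.prob_compl[of A] A M N sp by (simp add: Compl_eq_Diff_UNIV)
  then show "emeasure M A = emeasure N A"
    using le_all[OF A] by (simp add: M.emeasure_eq_measure N.emeasure_eq_measure)
qed

section \<open>Comparison of the laws\<close>

locale flow_approximation = rectified_flow P v + field_approximation v c B U
  for P :: "('a::euclidean_space \<times> 'a) measure" and v c B U +
  fixes L :: "nat \<Rightarrow> real"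
  assumes c_Lipschitz: "\<And>m. (L m)-lipschitz_on UNIV (c m)"
    and c_error: "\<And>m. (\<integral>\<^sup>+r. field_error (c m) r * indicator {0..1} r \<partial>lborel) \<le> ennreal ((1/4)^m)"
    and U_small: "\<And>m. emeasure occupation (U m) \<le> ennreal ((1/4)^m)"
begin

lemma U_borel[measurable]: "U m \<in> sets borel"
  using U_open by auto

lemma penalty_measurable[measurable]: "penalty \<in> borel_measurable borel"
  unfolding penalty_def by measurable

text \<open>The summands are at most \<open>2^m * 2 * (1/4)^m\<close>, which is
  \<open>2 * (1/2)^m\<close>, with sum 4.\<close>

lemma nn_integral_penalty: "(\<integral>\<^sup>+x. penalty x \<partial>occupation) \<le> ennreal 4"
proof -
  have "(\<integral>\<^sup>+x. penalty x \<partial>occupation) =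
      (\<Sum>m. \<integral>\<^sup>+x. ennreal (2 ^ m) * (ennreal (norm (v (fst x) (snd x) - c m x)) + indicator (U m) x) \<partial>occupation)"
    unfolding penalty_def by (rule nn_integral_suminf) measurable
  also have "\<dots> \<le> (\<Sum>m. ennreal (2 * (1/2)^m))"
  proof (rule suminf_le)
    fix m
    have "(\<integral>\<^sup>+x. ennreal (2 ^ m) * (ennreal (norm (v (fst x) (snd x) - c m x)) + indicator (U m) x) \<partial>occupation) =
        ennreal (2 ^ m) * ((\<integral>\<^sup>+x. norm (v (fst x) (snd x) - c m x) \<partial>occupation) + emeasure occupation (U m))"
      by (simp add: nn_integral_cmult nn_integral_add sets_occupation)
    also have "\<dots> \<le> ennreal (2 ^ m) * (ennreal ((1/4)^m) + ennreal ((1/4)^m))"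
      using c_error[of m] unfolding nn_integral_field_error[OF c_measurable]
      by (intro mult_left_mono add_mono U_small) auto
    also have "\<dots> = ennreal (2 ^ m * ((1/4)^m + (1/4)^m))"
      by (subst ennreal_mult, simp, simp, subst ennreal_plus) simp_all
    also have "(2::real) ^ m * ((1/4)^m + (1/4)^m) = 2 * (2 * (1/4))^m"
      unfolding power_mult_distrib by simp
    finally show "(\<integral>\<^sup>+x. ennreal (2 ^ m) * (ennreal (norm (v (fst x) (snd x) - c m x)) + indicator (U m) x) \<partial>occupation)
        \<le> ennreal (2 * (1/2)^m)" by simp
  qed auto
  also have "\<dots> = ennreal (\<Sum>m. 2 * (1/2)^m)"
    by (intro suminf_ennreal2) (auto intro!: summable_mult summable_geometric)
  also have "(\<Sum>m. 2 * (1/2::real)^m) = 4"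
    by (subst suminf_mult) (auto simp: suminf_geometric summable_geometric)
  finally show ?thesis .
qed

text \<open>Markov's inequality for penalty plus rescaled defects. The expected penalty depends only
  on the marginals and is at most 4. Each of the two defect terms has expectation at most
  \<open>3 * (1/4)^m\<close>, two field errors plus the slack \<open>(1/4)^m\<close>; after
  rescaling by \<open>2^m\<close> they contribute at most 6. Hence the 10, uniform in
  \<open>m\<close>.\<close>

lemma good_flow_exists:
  assumes C: "0 < C" and T: "T \<in> {0..1}"
  obtains M :: "(nat \<Rightarrow> 'a \<times> 'a) measure" and \<gamma> bad
  where "prob_space M"
    and "\<And>t. t \<in> {0..1} \<Longrightarrow> \<gamma> t \<in> borel_measurable M"
    and "\<And>t. t \<in> {0..1} \<Longrightarrow> distr M borel (\<gamma> t) = distr P borel (interp t)"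
    and "bad \<in> sets M" "emeasure M bad \<le> ennreal (10 / C)"
    and "\<And>\<omega>. \<omega> \<in> space M - bad \<Longrightarrow> good C T m (\<lambda>t. \<gamma> t \<omega>)"
proof -
  obtain M :: "(nat \<Rightarrow> 'a \<times> 'a) measure" and \<gamma> where M: "prob_space M"
    and \<gamma>: "(\<lambda>x. \<gamma> (fst x) (snd x)) \<in> borel_measurable (borel \<Otimes>\<^sub>M M)"
    and law: "\<And>t. t \<in> {0..1} \<Longrightarrow> distr M borel (\<gamma> t) = distr P borel (interp t)"
    and err: "\<And>t. t \<in> {0..1} \<Longrightarrow>
      (\<integral>\<^sup>+\<omega>. norm (\<gamma> t \<omega> - \<gamma> 0 \<omega> - (LINT r:{0..t}|lborel. c m (r, \<gamma> r \<omega>))) \<partial>M)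
      \<le> 2 * (\<integral>\<^sup>+r. field_error (c m) r * indicator {0..1} r \<partial>lborel) + ennreal ((1/4)^m)"
    by (rule approximate_flow_exists[OF c_Lipschitz[of m] c_bound[of m], of "(1/4)^m"]) auto
  interpret M: prob_space M by fact
  interpret MT: pair_sigma_finite M lborel by unfold_locales
  note [measurable] = \<gamma>
  have \<gamma>_t[measurable]: "\<gamma> t \<in> borel_measurable M" for t
    using measurable_compose[OF measurable_Pair1' \<gamma>, of t] by simp
  have path_meas: "(\<lambda>t. \<gamma> t \<omega>) \<in> borel_measurable borel" if "\<omega> \<in> space M" for \<omega>
    using measurable_compose[OF measurable_Pair2'[OF that] \<gamma>] by simp
  have swap[measurable]: "(\<lambda>x. \<gamma> (snd x) (fst x)) \<in> borel_measurable (M \<Otimes>\<^sub>M lborel)"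
  proof -
    have "(\<lambda>x. (snd x, fst x)) \<in> measurable (M \<Otimes>\<^sub>M lborel) (borel \<Otimes>\<^sub>M M)" by measurable
    from measurable_compose[OF this \<gamma>] show ?thesis by simp
  qed
  define G where "G \<omega> t = defect m (\<lambda>t. \<gamma> t \<omega>) t" for \<omega> t
  have G[measurable]: "(\<lambda>x. G (fst x) (snd x)) \<in> borel_measurable (M \<Otimes>\<^sub>M lborel)"
    unfolding G_def defect_def
  proof (intro borel_measurable_diff measurable_primitive)
    have "(\<lambda>x. (snd x, \<gamma> (snd x) (fst (fst x)))) \<in> measurable ((M \<Otimes>\<^sub>M lborel) \<Otimes>\<^sub>M lborel) borel"
    proof -
      have "(\<lambda>x. (snd x, fst (fst x))) \<in> measurable ((M \<Otimes>\<^sub>M lborel) \<Otimes>\<^sub>M (lborel :: real measure)) (borel \<Otimes>\<^sub>M M)"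
        by measurable
      from measurable_compose[OF this \<gamma>]
      have [measurable]: "(\<lambda>x. \<gamma> (snd x) (fst (fst x))) \<in> borel_measurable ((M \<Otimes>\<^sub>M lborel) \<Otimes>\<^sub>M (lborel :: real measure))"
        by simp
      show ?thesis by measurable
    qed
    from measurable_compose[OF this c_measurable]
    show "(\<lambda>x. c m (snd x, \<gamma> (snd x) (fst (fst x)))) \<in> borel_measurable ((M \<Otimes>\<^sub>M lborel) \<Otimes>\<^sub>M lborel)" .
    show "(\<lambda>x. \<gamma> 0 (fst x)) \<in> borel_measurable (M \<Otimes>\<^sub>M lborel)" by measurable
  qed measurable
  have G_t[measurable]: "(\<lambda>\<omega>. G \<omega> t) \<in> borel_measurable M" for t
    using measurable_compose[OF measurable_Pair2'[of t lborel M] G] by simp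
  have EG: "(\<integral>\<^sup>+\<omega>. norm (G \<omega> t) \<partial>M) \<le> ennreal (3 * (1/4)^m)" if "t \<in> {0..1}" for t
  proof -
    have "(\<integral>\<^sup>+\<omega>. norm (G \<omega> t) \<partial>M) \<le> 2 * (\<integral>\<^sup>+r. field_error (c m) r * indicator {0..1} r \<partial>lborel) + ennreal ((1/4)^m)"
      using err[OF that] by (simp add: G_def defect_def)
    also have "\<dots> \<le> 2 * ennreal ((1/4)^m) + ennreal ((1/4)^m)"
      by (intro add_mono mult_left_mono c_error) auto
    also have "\<dots> = ennreal (2 * (1/4)^m + (1/4)^m)"
      by (subst ennreal_plus, simp, simp, subst ennreal_mult) simp_all
    also have "2 * (1/4)^m + (1/4)^m = 3 * (1/4::real)^m" by simp
    finally show ?thesis .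
  qed
  have pen[measurable]: "(\<lambda>x. penalty (snd x, \<gamma> (snd x) (fst x))) \<in> borel_measurable (M \<Otimes>\<^sub>M lborel)"
  proof -
    have "(\<lambda>x. (snd x, \<gamma> (snd x) (fst x))) \<in> measurable (M \<Otimes>\<^sub>M lborel) borel" by measurable
    from measurable_compose[OF this penalty_measurable] show ?thesis .
  qed
  define H1 where "H1 \<omega> = (\<integral>\<^sup>+r. penalty (r, \<gamma> r \<omega>) * indicator {0..1} r \<partial>lborel)" for \<omega>
  define H2 where "H2 \<omega> = (\<integral>\<^sup>+t. norm (G \<omega> t) * indicator {0..1} t \<partial>lborel)" for \<omega>
  \<comment> \<open>The defect terms carry the weight \<open>2^m\<close>, so
    \<open>H \<omega> \<le> C\<close> gives all clauses of \<open>good\<close> with the same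
    \<open>C\<close>.\<close>
  define H where "H \<omega> = H1 \<omega> + ennreal (2^m) * (H2 \<omega> + ennreal (norm (G \<omega> T)))" for \<omega>
  have H1m[measurable]: "H1 \<in> borel_measurable M" unfolding H1_def by measurable
  have H2m[measurable]: "H2 \<in> borel_measurable M" unfolding H2_def by measurable
  have Hm[measurable]: "H \<in> borel_measurable M" unfolding H_def by measurable
  have EH1: "(\<integral>\<^sup>+\<omega>. H1 \<omega> \<partial>M) \<le> ennreal 4"
  proof -
    have "(\<integral>\<^sup>+\<omega>. H1 \<omega> \<partial>M) = (\<integral>\<^sup>+r. \<integral>\<^sup>+\<omega>. penalty (r, \<gamma> r \<omega>) * indicator {0..1} r \<partial>M \<partial>lborel)"
      unfolding H1_def by (rule MT.Fubini'[symmetric]) measurable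
    also have "\<dots> = (\<integral>\<^sup>+r. (\<integral>\<^sup>+p. penalty (r, interp r p) \<partial>P) * indicator {0..1} r \<partial>lborel)"
    proof (rule nn_integral_cong)
      fix r :: real
      show "(\<integral>\<^sup>+\<omega>. penalty (r, \<gamma> r \<omega>) * indicator {0..1} r \<partial>M) =
          (\<integral>\<^sup>+p. penalty (r, interp r p) \<partial>P) * indicator {0..1} r"
      proof (cases "r \<in> {0..1}")
        case True
        have [measurable]: "(\<lambda>x. penalty (r, x)) \<in> borel_measurable borel"
          by (rule measurable_compose[OF _ penalty_measurable]) measurable
        have "(\<integral>\<^sup>+\<omega>. penalty (r, \<gamma> r \<omega>) \<partial>M) = (\<integral>\<^sup>+x. penalty (r, x) \<partial>distr M borel (\<gamma> r))"
          by (subst nn_integral_distr) auto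
        also have "\<dots> = (\<integral>\<^sup>+p. penalty (r, interp r p) \<partial>P)"
          unfolding law[OF True] by (subst nn_integral_distr) auto
        finally show ?thesis using True by simp
      qed simp
    qed
    also have "\<dots> = (\<integral>\<^sup>+x. penalty x \<partial>occupation)"
      by (rule nn_integral_occupation[symmetric]) measurable
    finally show ?thesis using nn_integral_penalty by simp
  qed
  have EH2: "(\<integral>\<^sup>+\<omega>. H2 \<omega> \<partial>M) \<le> ennreal (3 * (1/4)^m)"
  proof -
    have "(\<integral>\<^sup>+\<omega>. H2 \<omega> \<partial>M) = (\<integral>\<^sup>+t. \<integral>\<^sup>+\<omega>. ennreal (norm (G \<omega> t) * indicator {0..1} t) \<partial>M \<partial>lborel)"
      unfolding H2_def by (rule MT.Fubini'[symmetric]) measurable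
    also have "\<dots> \<le> (\<integral>\<^sup>+t. ennreal (3 * (1/4)^m) * indicator {0..1::real} t \<partial>lborel)"
    proof (rule nn_integral_mono)
      fix t :: real
      show "(\<integral>\<^sup>+\<omega>. ennreal (norm (G \<omega> t) * indicator {0..1} t) \<partial>M) \<le> ennreal (3 * (1/4)^m) * indicator {0..1} t"
        using EG[of t] by (cases "t \<in> {0..1}") auto
    qed
    also have "\<dots> = ennreal (3 * (1/4)^m)" by (simp add: nn_integral_cmult_indicator)
    finally show ?thesis .
  qed
  have EH: "(\<integral>\<^sup>+\<omega>. H \<omega> \<partial>M) \<le> ennreal 10"
  proof -
    have "(\<integral>\<^sup>+\<omega>. H \<omega> \<partial>M) = (\<integral>\<^sup>+\<omega>. H1 \<omega> \<partial>M) + ennreal (2^m) * ((\<integral>\<^sup>+\<omega>. H2 \<omega> \<partial>M) + (\<integral>\<^sup>+\<omega>. norm (G \<omega> T) \<partial>M))"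
      unfolding H_def by (simp add: nn_integral_add nn_integral_cmult)
    also have "\<dots> \<le> ennreal 4 + ennreal (2^m) * (ennreal (3 * (1/4)^m) + ennreal (3 * (1/4)^m))"
      by (intro add_mono mult_left_mono EH1 EH2 EG[OF T]) auto
    also have "\<dots> = ennreal (4 + 2^m * (3 * (1/4)^m + 3 * (1/4)^m))"
      by (subst ennreal_plus, simp, simp, subst ennreal_mult, simp, simp, subst ennreal_plus) simp_all
    also have "\<dots> \<le> ennreal 10"
    proof (rule ennreal_leI)
      have "(2::real)^m * (3 * (1/4)^m + 3 * (1/4)^m) = 6 * (2 * (1/4))^m"
        unfolding power_mult_distrib by simp
      also have "\<dots> \<le> 6 * 1" by (intro mult_left_mono power_le_one) auto
      finally show "4 + (2::real)^m * (3 * (1/4)^m + 3 * (1/4)^m) \<le> 10" by simp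
    qed
    finally show ?thesis .
  qed
  define bad where "bad = {\<omega> \<in> space M. 1 \<le> ennreal (1 / C) * H \<omega>}"
  have bad: "bad \<in> sets M" unfolding bad_def by measurable
  have bad_le: "emeasure M bad \<le> ennreal (10 / C)"
  proof -
    have "emeasure M bad \<le> ennreal (1 / C) * (\<integral>\<^sup>+\<omega>. H \<omega> * indicator (space M) \<omega> \<partial>M)"
      unfolding bad_def by (rule nn_integral_Markov_inequality) auto
    also have "(\<integral>\<^sup>+\<omega>. H \<omega> * indicator (space M) \<omega> \<partial>M) = (\<integral>\<^sup>+\<omega>. H \<omega> \<partial>M)"
      by (intro nn_integral_cong) auto
    also have "ennreal (1 / C) * \<dots> \<le> ennreal (1 / C) * ennreal 10" by (intro mult_left_mono EH) simp
    also have "\<dots> = ennreal (10 / C)" using C by (subst ennreal_mult[symmetric]) simp_all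
    finally show ?thesis .
  qed
  have is_good: "good C T m (\<lambda>t. \<gamma> t \<omega>)" if "\<omega> \<in> space M - bad" for \<omega>
  proof -
    have "ennreal (1 / C) * H \<omega> < 1" using that by (auto simp: bad_def)
    have HC: "H \<omega> \<le> ennreal C"
    proof -
      have "H \<omega> = ennreal C * (ennreal (1 / C) * H \<omega>)"
        using C by (simp add: mult.assoc[symmetric] flip: ennreal_mult)
      also have "\<dots> \<le> ennreal C * 1"
        using \<open>ennreal (1 / C) * H \<omega> < 1\<close> by (intro mult_left_mono) auto
      finally show ?thesis by simp
    qed
    have "H1 \<omega> \<le> ennreal C" using HC unfolding H_def by (rule order_trans[rotated]) simp
    moreover have "H2 \<omega> \<le> ennreal (C / 2 ^ m)"
      by (rule ennreal_le_divide_power)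
         (use C in \<open>auto intro!: order_trans[OF _ HC] simp: H_def distrib_left add_increasing\<close>)
    moreover have "ennreal (norm (G \<omega> T)) \<le> ennreal (C / 2 ^ m)"
      by (rule ennreal_le_divide_power)
         (use C in \<open>auto intro!: order_trans[OF _ HC] simp: H_def distrib_left add_increasing\<close>)
    ultimately show ?thesis
      using that path_meas C by (simp add: good_def H1_def H2_def G_def)
  qed
  show thesis by (rule that[OF M \<gamma>_t law bad bad_le is_good])
qed

text \<open>For an open \<open>V\<close> around \<open>starts C T K F\<close> there is a level from
  which good paths that start in \<open>K\<close> and end in \<open>F\<close> start in
  \<open>V\<close>; the exceptions are bad paths and those starting off \<open>K\<close>. The paths
  have the laws of \<open>interp 0\<close> and \<open>interp T\<close> at times 0 and
  \<open>T\<close>, so they disappear from the final inequality; outer regularity removes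
  \<open>V\<close>.\<close>

lemma law_le_starts:
  assumes C: "0 < C" and T: "T \<in> {0..1}" and K: "compact K"
    and unique: "\<And>x R. x \<in> K \<Longrightarrow> is_flow_solution v x R \<Longrightarrow> R T = \<Phi> x" and F: "closed F"
  shows "emeasure (distr P borel (interp T)) F \<le> emeasure (distr P borel (interp 0)) (starts C T K F)
    + (emeasure (distr P borel (interp 0)) (- K) + ennreal (10 / C))"
proof -
  let ?\<mu> = "distr P borel (interp 0)" and ?\<rho> = "distr P borel (interp T)"
  let ?b = "emeasure ?\<mu> (- K) + ennreal (10 / C)"
  interpret \<mu>: prob_space ?\<mu> by (rule prob_space_distr) measurable
  have C0: "0 \<le> C" using C by simp
  have Kb[measurable]: "K \<in> sets borel" using K by (simp add: borel_compact)
  have Fb[measurable]: "F \<in> sets borel" using F by simp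
  have S: "starts C T K F \<in> sets borel"
    by (intro borel_closed closed_starts[where \<Phi>=\<Phi>, OF C0 T K _ F] unique)
  have "emeasure ?\<rho> F - ?b \<le> emeasure ?\<mu> V" if V: "starts C T K F \<subseteq> V" "open V" for V
  proof -
    have Vb[measurable]: "V \<in> sets borel" using V by simp
    have "\<exists>n. \<forall>z\<in>endpoints C T K n. snd z \<in> F \<longrightarrow> fst z \<in> V"
      by (rule endpoints_eventually_near[where \<Phi>=\<Phi>, OF C0 T K _ F V(2,1)]) (intro unique)
    then obtain n where n: "\<And>z. z \<in> endpoints C T K n \<Longrightarrow> snd z \<in> F \<Longrightarrow> fst z \<in> V" by blast
    obtain M :: "(nat \<Rightarrow> 'a \<times> 'a) measure" and \<gamma> bad where M: "prob_space M"
      and \<gamma>: "\<And>t. t \<in> {0..1} \<Longrightarrow> \<gamma> t \<in> borel_measurable M"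
      and law: "\<And>t. t \<in> {0..1} \<Longrightarrow> distr M borel (\<gamma> t) = distr P borel (interp t)"
      and bad: "bad \<in> sets M" "emeasure M bad \<le> ennreal (10 / C)"
      and gd: "\<And>\<omega>. \<omega> \<in> space M - bad \<Longrightarrow> good C T n (\<lambda>t. \<gamma> t \<omega>)"
      by (rule good_flow_exists[OF C T, where m=n]) auto
    note [measurable] = \<gamma>[OF T] \<gamma>[of 0, simplified] bad(1)
    have pre: "emeasure (distr P borel (interp t)) A = emeasure M (\<gamma> t -` A \<inter> space M)"
      if "t \<in> {0..1}" "A \<in> sets borel" for t A
      unfolding law[OF that(1), symmetric] by (rule emeasure_distr[OF \<gamma>[OF that(1)] that(2)])
    have "\<gamma> T -` F \<inter> space M \<subseteq> (\<gamma> 0 -` V \<inter> space M) \<union> ((\<gamma> 0 -` (- K) \<inter> space M) \<union> bad)"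
    proof
      fix \<omega> assume \<omega>: "\<omega> \<in> \<gamma> T -` F \<inter> space M"
      show "\<omega> \<in> (\<gamma> 0 -` V \<inter> space M) \<union> ((\<gamma> 0 -` (- K) \<inter> space M) \<union> bad)"
      proof (cases "\<omega> \<in> bad \<or> \<gamma> 0 \<omega> \<notin> K")
        case False
        then have "(\<gamma> 0 \<omega>, \<gamma> T \<omega>) \<in> endpoints C T K n"
          using gd[of \<omega>] \<omega> unfolding endpoints_def
          by (intro CollectI exI[of _ "\<lambda>t. \<gamma> t \<omega>"] exI[of _ n]) auto
        from n[OF this] \<omega> show ?thesis by auto
      qed (use \<omega> in auto)
    qed
    then have "emeasure ?\<rho> F \<le> emeasure M ((\<gamma> 0 -` V \<inter> space M) \<union> ((\<gamma> 0 -` (- K) \<inter> space M) \<union> bad))"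
      unfolding pre[OF T Fb] by (rule emeasure_mono) measurable
    also have "\<dots> \<le> emeasure M (\<gamma> 0 -` V \<inter> space M) + emeasure M ((\<gamma> 0 -` (- K) \<inter> space M) \<union> bad)"
      by (rule emeasure_subadditive) measurable
    also have "emeasure M ((\<gamma> 0 -` (- K) \<inter> space M) \<union> bad) \<le> emeasure M (\<gamma> 0 -` (- K) \<inter> space M) + emeasure M bad"
      by (rule emeasure_subadditive) measurable
    also have "emeasure M bad \<le> ennreal (10 / C)" by (rule bad)
    finally have "emeasure ?\<rho> F \<le> ?b + emeasure ?\<mu> V"
      using pre[of 0 V] pre[of 0 "- K"] by (simp add: ac_simps add_mono)
    then show ?thesis by (simp add: ennreal_minus_le_iff)
  qed
  moreover have "emeasure ?\<mu> (starts C T K F) = (INF V \<in> {V. starts C T K F \<subseteq> V \<and> open V}. emeasure ?\<mu> V)"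
    by (rule outer_regular[OF _ _ S]) auto
  ultimately have "emeasure ?\<rho> F - ?b \<le> emeasure ?\<mu> (starts C T K F)"
    by (auto intro!: INF_greatest)
  then show ?thesis by (simp add: ennreal_minus_le_iff add.commute)
qed

end

section \<open>Measurability of the flow map and identification of its law\<close>

lemma borel_measurableI_closed:
  fixes f :: "'b \<Rightarrow> 'a::topological_space"
  assumes "\<And>F. closed F \<Longrightarrow> f -` F \<inter> space M \<in> sets M"
  shows "f \<in> borel_measurable M"
proof (rule borel_measurableI)
  fix S :: "'a set" assume "open S"
  then have "f -` (- S) \<inter> space M \<in> sets M" by (intro assms) auto
  then have "space M - (f -` (- S) \<inter> space M) \<in> sets M" by auto
  also have "space M - (f -` (- S) \<inter> space M) = f -` S \<inter> space M" by auto
  finally show "f -` S \<inter> space M \<in> sets M" .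
qed

lemma ennreal_le_of_harmonic_error:
  fixes a b :: ennreal
  assumes "\<And>k::nat. a \<le> b + ennreal (C / real (Suc k))" and C: "0 < C"
  shows "a \<le> b"
proof (rule ennreal_le_epsilon)
  fix e :: real assume e: "0 < e"
  obtain k :: nat where "C / e \<le> real k" using real_arch_simple by blast
  then have "C / real (Suc k) \<le> e" using e C by (simp add: field_simps)
  then have "b + ennreal (C / real (Suc k)) \<le> b + ennreal e" by (intro add_left_mono ennreal_leI)
  with assms(1)[of k] show "a \<le> b + ennreal e" by (rule order_trans)
qed

theorem theorem1:
  fixes \<Omega> :: "'a::euclidean_space set"
    and \<mu>0 \<mu>1 :: "'a measure"
    and v :: "real \<Rightarrow> 'a \<Rightarrow> 'a"
    and A :: "'a set"
    and \<R> :: "real \<Rightarrow> 'a \<Rightarrow> 'a"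
  assumes "convex \<Omega>" and "interior \<Omega> \<noteq> {}"
    and "prob_space \<mu>0" and "sets \<mu>0 = sets borel" and "AE x in \<mu>0. x \<in> \<Omega>"
    and "prob_space \<mu>1" and "sets \<mu>1 = sets borel" and "AE x in \<mu>1. x \<in> \<Omega>"
    and "is_velocity_field \<mu>0 \<mu>1 v"
    and "A \<subseteq> \<Omega>" and "AE x in \<mu>0. x \<in> A"
    and "\<forall>x\<in>A. \<forall>R. is_flow_solution v x R \<longrightarrow> (\<forall>t\<in>{0..1}. R t = \<R> t x)"
    and "\<forall>x\<in>A. is_flow_solution v x (\<lambda>t. \<R> t x)"
  shows "\<forall>t\<in>{0..1}. \<R> t \<in> borel_measurable (completion \<mu>0) \<and>
           distr (completion \<mu>0) borel (\<R> t) = distr (\<mu>0 \<Otimes>\<^sub>M \<mu>1) borel (interp t)"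
proof
  fix T :: real assume T: "T \<in> {0..1}"
  let ?P = "\<mu>0 \<Otimes>\<^sub>M \<mu>1"
  interpret \<mu>0: prob_space \<mu>0 by fact
  interpret \<mu>1: prob_space \<mu>1 by fact
  interpret pair_prob_space \<mu>0 \<mu>1 ..
  note sets0[measurable_cong] = \<open>sets \<mu>0 = sets borel\<close>
  have space0: "space \<mu>0 = UNIV" using sets_eq_imp_space_eq[OF sets0] by simp
  have sets_P: "sets ?P = sets borel"
    unfolding sets_pair_measure_cong[OF sets0 \<open>sets \<mu>1 = sets borel\<close>] borel_prod ..
  interpret RF: rectified_flow ?P v
  proof (intro rectified_flow.intro rectified_flow_axioms.intro sets_P)
    note vf = \<open>is_velocity_field \<mu>0 \<mu>1 v\<close>[unfolded is_velocity_field_def case_prod_beta]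
    show "prob_space ?P" by unfold_locales
    show "(\<lambda>x. v (fst x) (snd x)) \<in> borel_measurable borel" using vf by blast
    show "integrable ?P (\<lambda>p. snd p - fst p)" using vf by blast
    show "integrable ?P (\<lambda>p. v t (interp t p))" if "t \<in> {0..1}" for t using vf that by blast
    show "(\<integral>p. indicator B (interp t p) *\<^sub>R (snd p - fst p) \<partial>?P) =
        (\<integral>p. indicator B (interp t p) *\<^sub>R v t (interp t p) \<partial>?P)"
      if "t \<in> {0..1}" "B \<in> sets borel" for t B using vf that by blast
  qed
  obtain c L B U where
    approx: "\<And>m::nat. (L m)-lipschitz_on UNIV (c m)" "\<And>m x. norm (c m x) \<le> B m"
      "\<And>m. (\<integral>\<^sup>+r. RF.field_error (c m) r * indicator {0..1} r \<partial>lborel) \<le> ennreal ((1/4)^m)"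
      "\<And>m. open (U m)" "\<And>m. emeasure RF.occupation (U m) \<le> ennreal ((1/4)^m)"
      "\<And>m x. x \<notin> U m \<Longrightarrow> (\<lambda>k. c k x) \<longlonglongrightarrow> v (fst x) (snd x)"
    by (rule RF.approximants_exist) (blast intro: that)
  interpret FA: flow_approximation ?P v c B U L
    by unfold_locales (auto simp: approx RF.v intro: lipschitz_on_continuous_on approx)
  have start: "distr ?P borel (interp 0) = \<mu>0"
  proof -
    have "distr ?P borel (interp 0) = distr ?P \<mu>0 fst"
      by (rule distr_cong) (auto simp: interp_def sets0)
    then show ?thesis by (simp add: \<mu>1.distr_pair_fst)
  qed
  \<comment> \<open>\<open>A\<close> need not be Borel; the complement of \<open>N\<close> is a
    Borel subset of it with full measure, inside which compact sets are taken.\<close>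
  obtain N where N: "N \<in> null_sets \<mu>0" "{x \<in> space \<mu>0. x \<notin> A} \<subseteq> N"
    using \<open>AE x in \<mu>0. x \<in> A\<close> by (auto elim!: AE_E simp: null_sets_def)
  have A': "- N \<subseteq> A" "- N \<in> sets borel"
    using N space0 sets0 by (auto simp: null_sets_def)
  have "emeasure \<mu>0 (- N) = 1"
    using emeasure_Diff_null_set[OF N(1), of UNIV] \<mu>0.emeasure_space_1 space0 sets0
    by (simp add: Compl_eq_Diff_UNIV)
  have "\<forall>k::nat. \<exists>K. K \<subseteq> - N \<and> compact K \<and> emeasure \<mu>0 (- K) \<le> ennreal (1 / real (Suc k))"
  proof
    fix k :: nat
    have "emeasure \<mu>0 (- N) = (SUP K \<in> {K. K \<subseteq> - N \<and> compact K}. emeasure \<mu>0 K)"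
      by (rule inner_regular[OF sets0 _ A'(2)]) simp
    moreover have "ennreal (1 - 1 / real (Suc k)) < 1"
      by (subst ennreal_1[symmetric], rule ennreal_lessI) auto
    ultimately have "ennreal (1 - 1 / real (Suc k)) < (SUP K \<in> {K. K \<subseteq> - N \<and> compact K}. emeasure \<mu>0 K)"
      using \<open>emeasure \<mu>0 (- N) = 1\<close> by simp
    then obtain K where K: "K \<subseteq> - N" "compact K" and mK: "ennreal (1 - 1 / real (Suc k)) < emeasure \<mu>0 K"
      unfolding less_SUP_iff by blast
    have "1 - 1 / real (Suc k) < measure \<mu>0 K"
      using mK by (simp add: \<mu>0.emeasure_eq_measure ennreal_less_iff)
    moreover have "measure \<mu>0 (- K) = 1 - measure \<mu>0 K"
      using \<mu>0.prob_compl[of K] borel_compact[OF K(2)] by (simp add: space0 sets0 Compl_eq_Diff_UNIV)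
    ultimately have "emeasure \<mu>0 (- K) \<le> ennreal (1 / real (Suc k))"
      unfolding \<mu>0.emeasure_eq_measure by (intro ennreal_leI) linarith
    with K show "\<exists>K. K \<subseteq> - N \<and> compact K \<and> emeasure \<mu>0 (- K) \<le> ennreal (1 / real (Suc k))" by blast
  qed
  from choice[OF this] obtain K where K: "\<And>k. K k \<subseteq> A" "\<And>k. compact (K k)"
    and K_mass: "\<And>k::nat. emeasure \<mu>0 (- K k) \<le> ennreal (1 / real (Suc k))"
    using A'(1) by (metis order_trans)
  \<comment> \<open>Level \<open>k\<close> pairs the compact set \<open>K k\<close> with the
    constant \<open>C = Suc k\<close>; the mass outside \<open>K k\<close> and the bad paths cost
    \<open>1 / Suc k\<close> and \<open>10 / Suc k\<close>, whence the 11 below.\<close>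
  define S where "S k F = FA.starts (real (Suc k)) T (K k) F" for k F
  have unique: "R T = \<R> T x" if "x \<in> K k" "is_flow_solution v x R" for k x R
    using assms(12) K(1) that T by blast
  have S_closed: "closed (S k F)" if "closed F" for k F
    unfolding S_def
    by (rule FA.closed_starts[where \<Phi>="\<R> T", OF _ T K(2) _ that]) (auto intro: unique)
  have S_iff: "x \<in> S k F \<longleftrightarrow> x \<in> S k UNIV \<and> \<R> T x \<in> F" for x k F
    unfolding S_def
    by (rule FA.starts_iff[where \<Phi>="\<R> T", OF _ T K(2)]) (auto intro: unique)
  have law_le: "emeasure (distr ?P borel (interp T)) F \<le> emeasure \<mu>0 (S k F) + ennreal (11 / real (Suc k))"
    if "closed F" for k F
  proof -
    have "emeasure (distr ?P borel (interp T)) F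
        \<le> emeasure \<mu>0 (S k F) + (emeasure \<mu>0 (- K k) + ennreal (10 / real (Suc k)))"
      unfolding S_def
      by (rule FA.law_le_starts[where \<Phi>="\<R> T", OF _ T K(2) _ that, unfolded start]) (auto intro: unique)
    also have "\<dots> \<le> emeasure \<mu>0 (S k F) + (ennreal (1 / real (Suc k)) + ennreal (10 / real (Suc k)))"
      by (intro add_left_mono add_right_mono K_mass)
    also have "ennreal (1 / real (Suc k)) + ennreal (10 / real (Suc k)) = ennreal (11 / real (Suc k))"
      by (subst ennreal_plus[symmetric]) (auto simp flip: add_divide_distrib)
    finally show ?thesis .
  qed
  \<comment> \<open>A countable union of closed sets of starting points of limit pairs. Its full
    measure follows from the law inequality for \<open>F = UNIV\<close>.\<close>
  define D where "D = (\<Union>k. S k UNIV)"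
  have D[measurable]: "D \<in> sets borel" unfolding D_def using S_closed by auto
  \<comment> \<open>A Borel version of \<open>\<R> T\<close>: on \<open>D\<close> preimages of
    closed sets are unions of the closed sets \<open>S k F\<close>, and off \<open>D\<close> it is
    the constant 0.\<close>
  define R' where "R' x = (if x \<in> D then \<R> T x else 0)" for x
  have R'_vimage: "R' -` F \<inter> D = (\<Union>k. S k F)" for F
  proof (rule set_eqI)
    fix x
    have "x \<in> (\<Union>k. S k F) \<longleftrightarrow> (\<exists>k. x \<in> S k UNIV \<and> \<R> T x \<in> F)"
      using S_iff[of x _ F] by blast
    then show "x \<in> R' -` F \<inter> D \<longleftrightarrow> x \<in> (\<Union>k. S k F)" by (auto simp: D_def R'_def)
  qed
  have R'[measurable]: "R' \<in> borel_measurable \<mu>0"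
  proof (rule borel_measurableI_closed)
    fix F :: "'a set" assume F: "closed F"
    have "R' -` F \<inter> space \<mu>0 = (\<Union>k. S k F) \<union> (if 0 \<in> F then - D else {})"
      unfolding R'_vimage[symmetric] space0 by (auto simp: R'_def split: if_splits)
    also have "\<dots> \<in> sets \<mu>0"
      unfolding sets0 using S_closed[OF F] D by auto
    finally show "R' -` F \<inter> space \<mu>0 \<in> sets \<mu>0" .
  qed
  interpret \<rho>: prob_space "distr ?P borel (interp T)"
    by (rule prob_space_distr) measurable
  have "emeasure (distr ?P borel (interp T)) UNIV \<le> emeasure \<mu>0 D"
  proof (rule ennreal_le_of_harmonic_error)
    fix k
    have "emeasure \<mu>0 (S k UNIV) \<le> emeasure \<mu>0 D"
    proof (rule emeasure_mono)
      show "S k UNIV \<subseteq> D" unfolding D_def by blast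
    qed (simp add: sets0 D)
    with law_le[OF closed_UNIV, of k]
    show "emeasure (distr ?P borel (interp T)) UNIV \<le> emeasure \<mu>0 D + ennreal (11 / real (Suc k))"
      by (meson add_right_mono order_trans)
  qed simp
  then have "1 \<le> emeasure \<mu>0 D" using \<rho>.emeasure_space_1 by simp
  with \<mu>0.measure_le_1[of D] have "emeasure \<mu>0 D = 1" by (rule antisym)
  then have D_null: "- D \<in> null_sets \<mu>0"
    using \<mu>0.prob_compl[of D] D
    by (simp add: null_sets_def sets0 space0 Compl_eq_Diff_UNIV \<mu>0.emeasure_eq_measure)
  then have AE_D: "AE x in \<mu>0. \<R> T x = R' x"
    by (rule AE_I') (auto simp: R'_def)
  have meas: "\<R> T \<in> borel_measurable (completion \<mu>0)"
  proof (rule measurableI)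
    fix F :: "'a set" assume "F \<in> sets borel"
    then have "R' -` F \<inter> space \<mu>0 \<in> sets \<mu>0" by (rule measurable_sets[OF R'])
    then have "R' -` F \<inter> D \<in> sets \<mu>0" using D by (simp add: space0 sets0)
    then have "R' -` F \<inter> D \<in> sets (completion \<mu>0)" by (rule sets_completionI_sets)
    \<comment> \<open>Off \<open>D\<close> nothing is known about \<open>\<R> T\<close>, but every
      subset of a null set is measurable for the completion.\<close>
    moreover have "\<R> T -` F \<inter> - D \<in> sets (completion \<mu>0)"
      by (rule null_sets_completion[OF D_null]) auto
    ultimately have "(R' -` F \<inter> D) \<union> (\<R> T -` F \<inter> - D) \<in> sets (completion \<mu>0)"
      by (rule sets.Un)
    also have "(R' -` F \<inter> D) \<union> (\<R> T -` F \<inter> - D) = \<R> T -` F \<inter> space (completion \<mu>0)"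
      by (auto simp: R'_def space0)
    finally show "\<R> T -` F \<inter> space (completion \<mu>0) \<in> sets (completion \<mu>0)" .
  qed simp
  have "distr (completion \<mu>0) borel (\<R> T) = distr (completion \<mu>0) borel R'"
    by (rule distr_cong_AE) (auto intro: AE_completion[OF AE_D] meas measurable_completion R')
  also have "\<dots> = distr \<mu>0 borel R'" by (rule distr_completion) measurable
  also have "\<dots> = distr ?P borel (interp T)"
  proof (rule prob_measure_eqI_closed[symmetric])
    show "prob_space (distr \<mu>0 borel R')" by (rule \<mu>0.prob_space_distr) measurable
    fix F :: "'a set" assume F: "closed F"
    show "emeasure (distr ?P borel (interp T)) F \<le> emeasure (distr \<mu>0 borel R') F"
    proof (rule ennreal_le_of_harmonic_error)
      fix k
      have "emeasure \<mu>0 (S k F) \<le> emeasure \<mu>0 (R' -` F \<inter> space \<mu>0)"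
        using R'_vimage[of F] measurable_sets[OF R', of F] F by (intro emeasure_mono) (auto simp: space0)
      then have "emeasure \<mu>0 (S k F) \<le> emeasure (distr \<mu>0 borel R') F"
        using F by (simp add: emeasure_distr)
      with law_le[OF F, of k]
      show "emeasure (distr ?P borel (interp T)) F \<le> emeasure (distr \<mu>0 borel R') F + ennreal (11 / real (Suc k))"
        by (meson add_right_mono order_trans)
    qed simp
  qed (use \<rho>.prob_space_axioms in auto)
  finally show "\<R> T \<in> borel_measurable (completion \<mu>0) \<and>
      distr (completion \<mu>0) borel (\<R> T) = distr ?P borel (interp T)"
    using meas by blast
qed

end
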